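(* Let $d,s\ge 1$ and $n\ge 2$ be integers, let $\ell_1,\dots,\ell_s\in[S]_1$ be general linear forms, let $F_s=\ell_1^d+\cdots+\ell_s^d\in[S]_d$, and let $A_{F_s}=R/\operatorname{Ann}_R(F_s)$ be the Artinian Gorenstein graded $\mathbb{K}$-algebra of socle degree $d$ with Macaulay dual generator $F_s$. Let $r_s$ be the unique integer such that $$\binom{n-2+r_s}{n-1}<s\le \binom{n-1+r_s}{n-1}.$$ Let $Z_{F_s}=\{P_1,\dots,P_s\}\subset\mathbb{P}^{n-1}$ be the set of points dual to $\ell_1,\dots,\ell_s$, with homogeneous ideal $I(Z_{F_s})\subset R$, and let $$0\longrightarrow F_{n-1}\longrightarrow\cdots\longrightarrow F_2\longrightarrow F_1\longrightarrow R\longrightarrow R/I(Z_{F_s})\longrightarrow 0$$ be the minimal graded free $R$-resolution of $R/I(Z_{F_s})$. If $r_s\le\lfloor d/2\rfloor$, then the minimal graded free $R$-resolution of $A_{F_s}$ has the form $$0\longrightarrow R(-d-n)\longrightarrow F_{n-1}\oplus F_1^{\vee}(-d-n)\longrightarrow\cdots\longrightarrow F_2\oplus F_{n-2}^{\vee}(-d-n)\longrightarrow F_1\oplus F_{n-1}^{\vee}(-d-n)\longrightarrow R\longrightarrow A_{F_s}\longrightarrow 0,$$ i.e. its free module in homological degree $i$ is $F_i\oplus F_{n-i}^{\vee}(-d-n)$ for $1\le i\le n-1$, is $R$ for $i=0$, and is $R(-d-n)$ for $i=n$, where $F_i^{\vee}=\operatorname{Hom}_R(F_i,R)$.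
   Context: $\mathbb{K}$ is an algebraically closed field of characteristic zero, $R=\mathbb{K}[x_1,\dots,x_n]$ and $S=\mathbb{K}[X_1,\dots,X_n]$ with the standard grading. $R$ acts on $S$ by differentiation, $x_i=\partial/\partial X_i$; $\operatorname{Ann}_R(F)=\{p\in R : p(\partial/\partial X_1,\dots,\partial/\partial X_n)\circ F=0\}$. If $F\neq 0$ is homogeneous of degree $d$, then $R/\operatorname{Ann}_R(F)$ is Artinian Gorenstein of socle degree $d$ and $F$ is called its Macaulay dual generator. For a linear form $\ell_i=a_{i,1}X_1+\cdots+a_{i,n}X_n$, the dual point is $P_i=(a_{i,1}:\cdots:a_{i,n})\in\mathbb{P}^{n-1}=\operatorname{Proj}(R)$. The 0-dimensional scheme $Z_{F_s}=\{P_1,\dots,P_s\}$ is called the tight annihilating scheme of $A_{F_s}$. "General": a statement holds for general linear forms $\ell_1,\dots,\ell_s$ if there is a nonempty (dense) Zariski open subset $U\subset \mathbb{K}^{ns}$ such that it holds whenever $(a_{1,1},\dots,a_{1,n},\dots,a_{s,1},\dots,a_{s,n})\in U$. *)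

theory Defs
  imports
    "HOL-Library.Poly_Mapping"
    "HOL-Library.Multiset"
    "HOL-Library.Cardinality"
    "HOL-Computational_Algebra.Computational_Algebra"
begin

section \<open>Polynomials\<close>

text \<open>
  \<open>K[x_j | j :: 'v]\<close>: finitely supported functions from exponent vectors to coefficients, with the
  convolution product of \<^theory>\<open>HOL-Library.Poly_Mapping\<close>. The same type serves for \<open>R\<close>, for
  \<open>S\<close> and for the coordinate ring of affine space.
\<close>

type_synonym ('v, 'k) mpoly = "('v \<Rightarrow>\<^sub>0 nat) \<Rightarrow>\<^sub>0 'k"

definition pvar :: "'v \<Rightarrow> ('v, 'k::comm_ring_1) mpoly" where
  "pvar j = Poly_Mapping.single (Poly_Mapping.single j 1) 1"

definition pconst :: "'k \<Rightarrow> ('v, 'k::comm_ring_1) mpoly" where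
  "pconst c = Poly_Mapping.single 0 c"

definition mdeg :: "('v::finite \<Rightarrow>\<^sub>0 nat) \<Rightarrow> nat" where
  "mdeg m = (\<Sum>j\<in>UNIV. Poly_Mapping.lookup m j)"

definition peval :: "('v::finite, 'k::comm_ring_1) mpoly \<Rightarrow> ('v \<Rightarrow> 'k) \<Rightarrow> 'k" where
  "peval p a = (\<Sum>m\<in>Poly_Mapping.keys p.
     Poly_Mapping.lookup p m * (\<Prod>j\<in>UNIV. a j ^ Poly_Mapping.lookup m j))"

text \<open>The degree is an integer so that negative graded pieces (which are 0) make sense; 0 is
  homogeneous of every degree.\<close>

definition homog :: "int \<Rightarrow> ('v::finite, 'k::comm_ring_1) mpoly \<Rightarrow> bool" where
  "homog t p \<longleftrightarrow> (\<forall>m\<in>Poly_Mapping.keys p. int (mdeg m) = t)"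

definition zariski_open :: "('v::finite \<Rightarrow> 'k::comm_ring_1) set \<Rightarrow> bool" where
  "zariski_open U \<longleftrightarrow> (\<exists>E :: ('v, 'k) mpoly set. U = - {a. \<forall>p\<in>E. peval p a = 0})"


section \<open>Action by differentiation\<close>

definition partial :: "'v \<Rightarrow> ('v, 'k::comm_ring_1) mpoly \<Rightarrow> ('v, 'k) mpoly" where
  "partial j F = (\<Sum>m\<in>Poly_Mapping.keys F.
     Poly_Mapping.single (m - Poly_Mapping.single j 1)
       (of_nat (Poly_Mapping.lookup m j) * Poly_Mapping.lookup F m))"

lemma lookup_partial:
  "Poly_Mapping.lookup (partial j F) k =
     of_nat (Suc (Poly_Mapping.lookup k j)) * Poly_Mapping.lookup F (k + Poly_Mapping.single j 1)"
proof -
  let ?e = "Poly_Mapping.single j (1::nat)"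
  let ?c = "\<lambda>m. of_nat (Poly_Mapping.lookup m j) * Poly_Mapping.lookup F m"
  have eq: "(?c m when m - ?e = k) = (?c m when m = k + ?e)" for m
  proof (cases "Poly_Mapping.lookup m j = 0")
    case False
    have "m - ?e = k \<longleftrightarrow> m = k + ?e"
    proof
      assume "m - ?e = k"
      have "Poly_Mapping.lookup m i = Poly_Mapping.lookup (m - ?e + ?e) i" for i
        using False by (auto simp: lookup_add lookup_minus lookup_single when_def)
      then have "m = m - ?e + ?e" by (rule poly_mapping_eqI)
      with \<open>m - ?e = k\<close> show "m = k + ?e" by simp
    qed simp
    then show ?thesis by (simp add: when_def)
  qed (simp add: when_def)
  have "Poly_Mapping.lookup (partial j F) k = (\<Sum>m\<in>Poly_Mapping.keys F. ?c m when m = k + ?e)"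
    by (simp only: partial_def lookup_sum lookup_single eq)
  also have "\<dots> = ?c (k + ?e)"
    by (auto simp: when_def in_keys_iff)
  finally show ?thesis
    by (simp add: lookup_add lookup_single)
qed

lemma partial_commute: "partial i (partial j F) = partial j (partial i F)"
  by (rule poly_mapping_eqI)
     (auto simp: lookup_partial lookup_add lookup_single when_def algebra_simps)

lemma comp_fun_commute_partial:
  "comp_fun_commute (\<lambda>j. partial j ^^ Poly_Mapping.lookup m j)"
proof
  fix i j :: 'a
  have 1: "partial i ((partial j ^^ b) F) = (partial j ^^ b) (partial i F)"
    for b and F :: "('a, 'b) mpoly"
    by (induction b) (simp_all add: partial_commute[of i j])
  have "(partial i ^^ a) ((partial j ^^ b) F) = (partial j ^^ b) ((partial i ^^ a) F)"
    for a b and F :: "('a, 'b) mpoly"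
    by (induction a) (simp_all add: 1)
  then show "(partial j ^^ Poly_Mapping.lookup m j) \<circ> (partial i ^^ Poly_Mapping.lookup m i) =
      (partial i ^^ Poly_Mapping.lookup m i) \<circ>
      (partial j ^^ Poly_Mapping.lookup m j :: ('a, 'b) mpoly \<Rightarrow> _)"
    by (simp add: fun_eq_iff)
qed

text \<open>The iterated derivative \<open>\<partial>\<^sup>m F\<close>; the partial derivatives commute, so the fold is well defined.\<close>

definition iter_partial :: "('v::finite \<Rightarrow>\<^sub>0 nat) \<Rightarrow> ('v, 'k::comm_ring_1) mpoly \<Rightarrow> ('v, 'k) mpoly" where
  "iter_partial m F = Finite_Set.fold (\<lambda>j. partial j ^^ Poly_Mapping.lookup m j) F UNIV"

definition diff_act ::
  "('v::finite, 'k::comm_ring_1) mpoly \<Rightarrow> ('v, 'k) mpoly \<Rightarrow> ('v, 'k) mpoly" where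
  "diff_act p F = (\<Sum>m\<in>Poly_Mapping.keys p. pconst (Poly_Mapping.lookup p m) * iter_partial m F)"

definition Ann :: "('v::finite, 'k::comm_ring_1) mpoly \<Rightarrow> ('v, 'k) mpoly set" where
  "Ann F = {p. diff_act p F = 0}"


section \<open>Linear forms and points\<close>

definition linear_form :: "('n::finite \<Rightarrow> 'k::comm_ring_1) \<Rightarrow> ('n, 'k) mpoly" where
  "linear_form a = (\<Sum>j\<in>UNIV. pconst (a j) * pvar j)"

text \<open>The point \<open>(a\<^sub>1 : \<dots> : a\<^sub>n)\<close>, as the set of its homogeneous coordinate vectors;
  meaningful for \<open>a \<noteq> 0\<close>.\<close>

definition proj_point :: "('n \<Rightarrow> 'k::field) \<Rightarrow> ('n \<Rightarrow> 'k) set" where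
  "proj_point a = {\<lambda>j. c * a j | c. c \<noteq> 0}"

text \<open>The homogeneous ideal of a set of points: generated by the homogeneous polynomials that
  vanish on it. The span in the module \<open>R\<close> over itself is the generated ideal.\<close>

definition vanishing_ideal :: "('n::finite \<Rightarrow> 'k::field) set set \<Rightarrow> ('n, 'k) mpoly set" where
  "vanishing_ideal Z = module.span (*)
     {f. (\<exists>t. homog t f) \<and> (\<forall>P\<in>Z. \<forall>v\<in>P. peval f v = 0)}"

lemma module_mult_self: "module ((*) :: 'a::comm_ring_1 \<Rightarrow> 'a \<Rightarrow> 'a)"
  by unfold_locales (simp_all add: algebra_simps)

text \<open>A coefficient vector \<open>a \<in> K\<^bsup>ns\<^esup>\<close> is indexed by pairs; \<open>a (i, j)\<close> is the coefficient of
  \<open>X\<^sub>j\<close> in the \<open>i\<close>-th linear form.\<close>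

definition power_sum_form :: "nat \<Rightarrow> ('s::finite \<times> 'n::finite \<Rightarrow> 'k::comm_ring_1) \<Rightarrow> ('n, 'k) mpoly"
  where "power_sum_form d a = (\<Sum>i\<in>UNIV. linear_form (\<lambda>j. a (i, j)) ^ d)"

definition dual_points :: "('s \<times> 'n \<Rightarrow> 'k::field) \<Rightarrow> ('n \<Rightarrow> 'k) set set" where
  "dual_points a = (\<lambda>i. proj_point (\<lambda>j. a (i, j))) ` UNIV"


section \<open>Graded free modules and resolutions\<close>

text \<open>
  A list of shifts \<open>[a\<^sub>0, \<dots>, a\<^sub>k]\<close> stands for \<open>R(-a\<^sub>0) \<oplus> \<dots> \<oplus> R(-a\<^sub>k)\<close>, where
  \<open>R(c)\<^sub>t = R\<^bsub>c+t\<^esub>\<close>. Its elements are the coordinate sequences that vanish beyond the length of the list.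
\<close>

definition free_mod :: "int list \<Rightarrow> (nat \<Rightarrow> ('n::finite, 'k::comm_ring_1) mpoly) set" where
  "free_mod a = {v. \<forall>j\<ge>length a. v j = 0}"

definition grade :: "int list \<Rightarrow> int \<Rightarrow> (nat \<Rightarrow> ('n::finite, 'k::comm_ring_1) mpoly) set" where
  "grade a t = {v \<in> free_mod a. \<forall>j<length a. homog (t - a ! j) (v j)}"

definition graded_hom :: "int list \<Rightarrow> int list \<Rightarrow>
    ((nat \<Rightarrow> ('n::finite, 'k::comm_ring_1) mpoly) \<Rightarrow> (nat \<Rightarrow> ('n, 'k) mpoly)) \<Rightarrow> bool" where
  "graded_hom a b \<phi> \<longleftrightarrow>
     (\<forall>v\<in>free_mod a. \<phi> v \<in> free_mod b) \<and>
     (\<forall>v\<in>free_mod a. \<forall>w\<in>free_mod a. \<phi> (\<lambda>j. v j + w j) = (\<lambda>j. \<phi> v j + \<phi> w j)) \<and>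
     (\<forall>p. \<forall>v\<in>free_mod a. \<phi> (\<lambda>j. p * v j) = (\<lambda>j. p * \<phi> v j)) \<and>
     (\<forall>t. \<forall>v\<in>grade a t. \<phi> v \<in> grade b t)"

text \<open>
  \<open>min_graded_free_res I F \<phi>\<close>: the modules \<open>F i\<close> with the maps \<open>\<phi> i : F (i+1) \<rightarrow> F i\<close> form a
  minimal graded free resolution \<open>\<dots> \<rightarrow> F 2 \<rightarrow> F 1 \<rightarrow> R \<rightarrow> R/I \<rightarrow> 0\<close>, where \<open>F 0 = R\<close> and
  \<open>R \<rightarrow> R/I\<close> is the projection, so that exactness at \<open>R\<close> says that the image of \<open>\<phi> 0\<close> is \<open>I\<close>.
  Minimality says that the image of each \<open>\<phi> i\<close> lies in \<open>(x\<^sub>1, \<dots>, x\<^sub>n) F i\<close>, i.e. its elements have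
  coordinates without constant term. A finite resolution \<open>0 \<rightarrow> F m \<rightarrow> \<dots>\<close> has \<open>F i = []\<close> for \<open>i > m\<close>.
\<close>

definition min_graded_free_res :: "('n::finite, 'k::comm_ring_1) mpoly set \<Rightarrow> (nat \<Rightarrow> int list) \<Rightarrow>
    (nat \<Rightarrow> (nat \<Rightarrow> ('n, 'k) mpoly) \<Rightarrow> (nat \<Rightarrow> ('n, 'k) mpoly)) \<Rightarrow> bool" where
  "min_graded_free_res I F \<phi> \<longleftrightarrow>
     F 0 = [0] \<and>
     (\<forall>i. graded_hom (F (Suc i)) (F i) (\<phi> i)) \<and>
     \<phi> 0 ` free_mod (F 1) = {v \<in> free_mod (F 0). v 0 \<in> I} \<and>
     (\<forall>i. \<phi> (Suc i) ` free_mod (F (Suc (Suc i))) =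
          {v \<in> free_mod (F (Suc i)). \<phi> i v = (\<lambda>_. 0)}) \<and>
     (\<forall>i. \<forall>v\<in>free_mod (F (Suc i)). \<forall>j<length (F i). Poly_Mapping.lookup (\<phi> i v j) 0 = 0)"

text \<open>The twist \<open>M(c)\<close>, with \<open>M(c)\<^sub>t = M\<^bsub>c+t\<^esub>\<close>, and the dual \<open>Hom\<^sub>R(M, R)\<close>.\<close>

definition twist :: "int list \<Rightarrow> int \<Rightarrow> int list" where
  "twist a c = map (\<lambda>x. x - c) a"

definition dual :: "int list \<Rightarrow> int list" where
  "dual a = map uminus a"

lemma homog_sum: "(\<And>i. i \<in> A \<Longrightarrow> homog t (f i)) \<Longrightarrow> homog t (sum f A)"
proof (induction A rule: infinite_finite_induct)
  case (insert x A)
  then show ?case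
    using keys_add[of "f x" "sum f A"] by (fastforce simp: homog_def)
qed (simp_all add: homog_def)

lemma homog_mult: "homog s p \<Longrightarrow> homog t q \<Longrightarrow> homog (s + t) (p * q)"
  using keys_mult[of p q]
  by (fastforce simp: homog_def mdeg_def lookup_add sum.distrib)

text \<open>The degree \<open>t\<close> part of \<open>dual a\<close> is the space of homomorphisms of degree \<open>t\<close> from \<open>a\<close> to
  \<open>R\<close>, that is, of graded homomorphisms from \<open>a\<close> to \<open>R(t)\<close>.\<close>

lemma dual_eq_Hom:
  "graded_hom a (twist [0] t) \<phi> \<longleftrightarrow>
     (\<exists>w\<in>grade (dual a) t. \<forall>v\<in>free_mod a.
        \<phi> v = (\<lambda>i. if i = 0 then \<Sum>j<length a. w j * v j else 0))"
proof
  assume h: "graded_hom a (twist [0] t) \<phi>"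
  define e :: "nat \<Rightarrow> nat \<Rightarrow> ('a, 'b) mpoly" where "e = (\<lambda>k j. if j = k then 1 else 0)"
  define w where "w = (\<lambda>k. if k < length a then \<phi> (e k) 0 else 0)"
  have e_free: "e k \<in> free_mod a" if "k < length a" for k
    using that by (auto simp: e_def free_mod_def)
  have "w \<in> grade (dual a) t"
  proof -
    have "homog (t + a ! k) (w k)" if k: "k < length a" for k
    proof -
      have "e k \<in> grade a (a ! k)"
        using e_free[OF k] by (auto simp: grade_def e_def homog_def mdeg_def)
      then have "\<phi> (e k) \<in> grade (twist [0] t) (a ! k)"
        using h by (auto simp: graded_hom_def)
      then show ?thesis using k by (simp add: w_def grade_def twist_def add.commute)
    qed
    then show ?thesis by (auto simp: grade_def dual_def free_mod_def w_def)
  qed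
  moreover have "\<phi> v = (\<lambda>i. if i = 0 then \<Sum>j<length a. w j * v j else 0)"
    if v: "v \<in> free_mod a" for v
  proof -
    have part: "\<phi> (\<lambda>j. if j < k then v j else 0) 0 = (\<Sum>j<k. w j * v j)"
      if "k \<le> length a" for k
      using that
    proof (induction k)
      case 0
      have 0: "(\<lambda>_. 0) \<in> (free_mod a :: (nat \<Rightarrow> ('a, 'b) mpoly) set)" by (simp add: free_mod_def)
      have "\<forall>p. \<forall>v\<in>free_mod a. \<phi> (\<lambda>j. p * v j) = (\<lambda>j. p * \<phi> v j)"
        using h unfolding graded_hom_def by simp
      from this[rule_format, OF 0, of 0] have "\<phi> (\<lambda>_. 0) = (\<lambda>_. 0)" by simp
      then show ?case by simp
    next
      case (Suc k)
      let ?u = "\<lambda>j. if j < k then v j else 0"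
      have u: "?u \<in> free_mod a" using v by (auto simp: free_mod_def)
      have ek: "e k \<in> free_mod a" using Suc.prems by (intro e_free) simp
      have vek: "(\<lambda>j. v k * e k j) \<in> free_mod a"
        using ek by (auto simp: free_mod_def)
      have "(\<lambda>j. if j < Suc k then v j else 0) = (\<lambda>j. ?u j + v k * e k j)"
        by (auto simp: e_def less_Suc_eq)
      then have "\<phi> (\<lambda>j. if j < Suc k then v j else 0) = (\<lambda>j. \<phi> ?u j + v k * \<phi> (e k) j)"
        using h u ek vek unfolding graded_hom_def by simp
      then show ?case using Suc by (simp add: w_def mult.commute)
    qed
    have "(\<lambda>j. if j < length a then v j else 0) = v"
      using v by (auto simp: free_mod_def)
    then have "\<phi> v 0 = (\<Sum>j<length a. w j * v j)" using part[of "length a"] by simp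
    moreover have "\<phi> v i = 0" if "i \<noteq> 0" for i
      using h v that by (auto simp: graded_hom_def free_mod_def twist_def)
    ultimately show ?thesis by auto
  qed
  ultimately show "\<exists>w\<in>grade (dual a) t. \<forall>v\<in>free_mod a.
      \<phi> v = (\<lambda>i. if i = 0 then \<Sum>j<length a. w j * v j else 0)" by blast
next
  assume "\<exists>w\<in>grade (dual a) t. \<forall>v\<in>free_mod a.
      \<phi> v = (\<lambda>i. if i = 0 then \<Sum>j<length a. w j * v j else 0)"
  then obtain w where w: "w \<in> grade (dual a) t"
    and \<phi>: "\<And>v. v \<in> free_mod a \<Longrightarrow>
      \<phi> v = (\<lambda>i. if i = 0 then \<Sum>j<length a. w j * v j else 0)" by blast
  have "homog (u + t) (\<Sum>j<length a. w j * v j)" if v: "v \<in> grade a u" for u v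
  proof (rule homog_sum)
    fix j assume "j \<in> {..<length a}"
    then have "homog (t + a ! j) (w j)" "homog (u - a ! j) (v j)"
      using w v by (auto simp: grade_def dual_def)
    from homog_mult[OF this] show "homog (u + t) (w j * v j)" by (simp add: add.commute)
  qed
  then show "graded_hom a (twist [0] t) \<phi>"
    by (auto simp: graded_hom_def \<phi> grade_def free_mod_def twist_def fun_eq_iff
        sum.distrib sum_distrib_left algebra_simps)
qed

end

theory Submission
  imports Defs "HOL-Library.Function_Algebras" "HOL-Library.Countable" "HOL-Analysis.Determinants"
begin

text \<open>
  The ranks of the free modules in a minimal graded free resolution of a graded module are dimensions
  of Tor with values in \<open>K\<close>, hence of Koszul homology. So the theorem becomes a comparison of the Koszul
  homology of \<open>A\<close> with that of \<open>R/I(Z)\<close>, degree by degree.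

  The points enter through the property that they impose independent conditions on the forms of
  degree \<open>r\<close>, a condition that is open and, by a Vandermonde determinant, satisfiable
  (\<open>exists_zariski_open_independent_points\<close>). Differentiating \<open>F\<^sub>s\<close> amounts to evaluating the operator at the
  dual points (\<open>lookup_diff_act_power_sum\<close>), so that the annihilator is the radical of the pairing
  \<open>(p, q) \<mapsto> \<Sum>\<^sub>i p(P\<^sub>i) q(P\<^sub>i)\<close> on \<open>R\<^sub>t \<times> R\<^sub>d\<^sub>-\<^sub>t\<close>. Three facts follow.

  \<^item> In degrees up to \<open>d - r\<close> the annihilator is \<open>I(Z)\<close>, because forms of degree at least \<open>r\<close> separate the
    points (\<open>apolar_eq_vanishing\<close>).
  \<^item> \<open>A\<close> is self-dual, and so is the Koszul complex: \<open>Tor\<^sub>i(A, K)\<^sub>j\<close> is dual to \<open>Tor\<^sub>n\<^sub>-\<^sub>i(A, K)\<^sub>d\<^sub>+\<^sub>n\<^sub>-\<^sub>j\<close>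
    (\<open>kh_apolar_dual\<close>).
  \<^item> \<open>Tor\<^sub>i(R/I(Z), K)\<^sub>j\<close> vanishes for \<open>j - i > r\<close> (\<open>regularity\<close>).

  If \<open>j - i < d - r\<close>, then \<open>Tor\<^sub>i(A, K)\<^sub>j\<close> is that of \<open>R/I(Z)\<close>; if \<open>j - i > r\<close>, then it is dual to that of
  \<open>R/I(Z)\<close> in complementary degree; in both ranges the other summand of the claim is zero by regularity.
  As \<open>r \<le> d/2\<close>, the only remaining case is \<open>j - i = r\<close> with \<open>d = 2r\<close>. There the differential that leaves
  \<open>A\<^sub>r\<close> is the transpose of one that enters \<open>A\<^sub>r\<close>, and the ranks for \<open>R/I(Z)\<close> are binomial coefficients
  times \<open>s\<close> since \<open>R/I(Z)\<close> is \<open>K\<^sup>s\<close> from degree \<open>r\<close> on (\<open>kh_apolar\<close>).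

  The identification of Betti numbers with Koszul homology (\<open>betti_eq_kh\<close>) is dimension shifting along the
  resolution. It needs that the Koszul complex of a free module is exact, which in characteristic 0 follows
  from Cartan's formula with the de Rham differential as homotopy (\<open>free_cycle_is_boundary\<close>). Existence of a
  minimal resolution (\<open>exists_min_graded_free_res\<close>) rests on the same shifting: the Koszul homology of \<open>A\<close> is
  zero in large degrees, so each syzygy module has finitely many minimal generators.
\<close>

section \<open>Dimension counts in an arbitrary vector space\<close>

locale abstract_vector_space = vector_space
begin

definition fin_dim :: "'b set \<Rightarrow> bool" where
  "fin_dim V \<longleftrightarrow> (\<exists>S. finite S \<and> V \<subseteq> span S)"

lemma fin_dim_mono: "fin_dim V \<Longrightarrow> U \<subseteq> V \<Longrightarrow> fin_dim U"
  unfolding fin_dim_def by blast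

lemma independent_finite:
  assumes "fin_dim V" "A \<subseteq> V" "independent A"
  shows "finite A"
proof -
  obtain S where "finite S" "V \<subseteq> span S" using assms(1) fin_dim_def by auto
  then show ?thesis using independent_span_bound[of S A] assms by auto
qed

lemma extend_to_basis:
  assumes "fin_dim V" "subspace V" "A \<subseteq> V" "independent A"
  obtains B where "A \<subseteq> B" "B \<subseteq> V" "independent B" "span B = V" "finite B" "card B = dim V"
proof -
  obtain B where B: "A \<subseteq> B" "B \<subseteq> V" "independent B" "V \<subseteq> span B"
    using maximal_independent_subset_extend[OF assms(3,4)] by blast
  have "span B = V" using B assms(2) by (simp add: span_subspace)
  moreover have "finite B" using independent_finite assms B by blast
  moreover have "card B = dim V" using B by (intro basis_card_eq_dim)
  ultimately show ?thesis using that B by blast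
qed

lemma finite_basis:
  assumes "fin_dim V" "subspace V"
  obtains B where "B \<subseteq> V" "independent B" "span B = V" "finite B" "card B = dim V"
  using extend_to_basis[OF assms empty_subsetI independent_empty] that by blast

lemma independent_Diff_span_Int:
  assumes "independent B" "A \<subseteq> B" "x \<in> span A" "x \<in> span (B - A)"
  shows "x = 0"
proof -
  have iA: "independent A" and iBA: "independent (B - A)"
    using assms(1,2) independent_mono by blast+
  have "representation B x = representation A x"
    using representation_extend[OF assms(1,3,2)] .
  moreover have "representation B x = representation (B - A) x"
    using representation_extend[OF assms(1,4)] by blast
  ultimately have eq: "representation A x = representation (B - A) x" by simp
  have "representation A x b = 0" for b
    using representation_ne_zero[of A x b] representation_ne_zero[of "B - A" x b] eq by auto
  then show ?thesis
    using sum_nonzero_representation_eq[OF iA assms(3)] by simp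
qed

text \<open>The vectors that extend a basis of the kernel to a basis of \<open>W\<close> map to a basis of the image.\<close>

lemma rank_nullity:
  assumes L: "Vector_Spaces.linear scale scale L" and W: "fin_dim W" "subspace W"
  shows "dim W = dim (L ` W) + dim {x \<in> W. L x = 0}"
proof -
  interpret L: Vector_Spaces.linear scale scale L by (rule L)
  interpret P: vector_space_pair scale scale by unfold_locales
  let ?K = "{x \<in> W. L x = 0}"
  have K: "subspace ?K"
    using W(2) by (auto simp: subspace_def L.add L.scale)
  obtain A where A: "A \<subseteq> ?K" "independent A" "span A = ?K" "card A = dim ?K"
    by (rule finite_basis[OF fin_dim_mono[OF W(1)] K]) auto
  obtain B where B: "A \<subseteq> B" "B \<subseteq> W" "independent B" "span B = W" "finite B" "card B = dim W"
    by (rule extend_to_basis[OF W, of A]) (use A(1,2) in auto)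
  have inj: "inj_on L (span (B - A))"
  proof (rule inj_onI)
    fix x y assume xy: "x \<in> span (B - A)" "y \<in> span (B - A)" "L x = L y"
    have sub: "span (B - A) \<subseteq> W" using B span_mono[of "B - A" B] by auto
    have "x - y \<in> span (B - A)" using xy span_diff by blast
    moreover from this have "x - y \<in> span A" using xy sub A(3) by (auto simp: L.diff)
    ultimately show "x = y" using independent_Diff_span_Int[OF B(3,1), of "x - y"] by simp
  qed
  have "independent (B - A)" using B(3) independent_mono by blast
  then have ind: "independent (L ` (B - A))"
    using L.independent_injective_image inj by blast
  have "L ` W = span (L ` (B - A))"
  proof -
    have "L ` W = span (L ` B)" using B(4) L.span_image by metis
    also have "L ` B \<subseteq> insert 0 (L ` (B - A))" using A(1) by auto
    then have "span (L ` B) \<subseteq> span (L ` (B - A))" using span_mono span_insert_0 by metis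
    moreover have "span (L ` (B - A)) \<subseteq> span (L ` B)" by (intro span_mono) auto
    ultimately show ?thesis using \<open>L ` W = span (L ` B)\<close> by auto
  qed
  then have "dim (L ` W) = card (L ` (B - A))"
    using ind dim_span_eq_card_independent by simp
  also have "\<dots> = card (B - A)"
    using inj inj_on_subset[OF inj span_superset] by (simp add: card_image)
  also have "\<dots> = card B - card A" using B card_Diff_subset finite_subset by metis
  finally show ?thesis using A(4) B card_mono[OF B(5,1)] by simp
qed

text \<open>Both quotients \<open>W / P\<close> and \<open>L W / L P\<close> are the same when the kernel of \<open>L\<close> on \<open>W\<close> lies in
  \<open>P\<close>; this is how dimensions of homology are transported along a zigzag of maps.\<close>

lemma dim_quotient_image:
  assumes L: "Vector_Spaces.linear scale scale L" and W: "fin_dim W" "subspace W" and P: "subspace P" "P \<subseteq> W"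
    and ker: "\<And>x. x \<in> W \<Longrightarrow> L x = 0 \<Longrightarrow> x \<in> P"
  shows "int (dim W) - int (dim P) = int (dim (L ` W)) - int (dim (L ` P))"
proof -
  have "{x \<in> W. L x = 0} = {x \<in> P. L x = 0}" using ker P(2) by auto
  then show ?thesis
    using rank_nullity[OF L W] rank_nullity[OF L fin_dim_mono[OF W(1) P(2)] P(1)] by simp
qed

text \<open>The map \<open>p\<close> plays the part of the projection to the quotient by \<open>U\<close>.\<close>

lemma exists_linear_with_kernel:
  assumes "subspace U"
  obtains p where "Vector_Spaces.linear scale scale p" "\<And>x. p x = 0 \<longleftrightarrow> x \<in> U"
proof -
  interpret P: vector_space_pair scale scale by unfold_locales
  obtain A where A: "A \<subseteq> U" "independent A" "U \<subseteq> span A"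
    using maximal_independent_subset by blast
  have sA: "span A = U" using A assms span_subspace by blast
  obtain B where B: "A \<subseteq> B" "independent B" "UNIV \<subseteq> span B"
    using maximal_independent_subset_extend[of A UNIV] A by auto
  define p where "p = P.construct B (\<lambda>b. if b \<in> A then 0 else b)"
  have lin: "Vector_Spaces.linear scale scale p" unfolding p_def using P.linear_construct[OF B(2)] .
  then interpret p: Vector_Spaces.linear scale scale p .
  have p: "p b = (if b \<in> A then 0 else b)" if "b \<in> B" for b
    unfolding p_def using P.construct_basis[OF B(2) that] by simp
  have pA: "p x = 0" if "x \<in> span A" for x
    by (rule p.eq_0_on_span[OF _ that]) (use p B(1) in auto)
  have pBA: "p x = x" if "x \<in> span (B - A)" for x
    by (rule P.linear_eq_on[OF lin linear_ident that]) (simp add: p)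
  have "x \<in> U" if "p x = 0" for x
  proof -
    have "A \<union> (B - A) = B" using B(1) by blast
    then have "x \<in> span (A \<union> (B - A))" using B(3) by auto
    then obtain y z where "x = y + z" "y \<in> span A" "z \<in> span (B - A)"
      unfolding span_Un by blast
    then show ?thesis using that pA pBA sA by (auto simp: p.add)
  qed
  then show ?thesis using that[OF lin] pA sA by blast
qed

text \<open>The dimension of \<open>U + L V\<close> is found modulo \<open>U\<close>, where the kernel of \<open>L\<close> becomes the
  preimage of \<open>U\<close>.\<close>

lemma dim_sum_image:
  assumes L: "Vector_Spaces.linear scale scale L" and U: "fin_dim U" "subspace U" and V: "fin_dim V" "subspace V"
  shows "dim {u + L v | u v. u \<in> U \<and> v \<in> V} + dim {v \<in> V. L v \<in> U} = dim U + dim V"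
proof -
  interpret L: Vector_Spaces.linear scale scale L by (rule L)
  let ?S = "{u + L v | u v. u \<in> U \<and> v \<in> V}"
  obtain p where p: "Vector_Spaces.linear scale scale p" "\<And>x. p x = 0 \<longleftrightarrow> x \<in> U"
    using exists_linear_with_kernel[OF U(2)] by blast
  interpret p: Vector_Spaces.linear scale scale p by (rule p(1))
  have S_alt: "?S = {x + y | x y. x \<in> U \<and> y \<in> L ` V}" by blast
  have sub: "subspace ?S"
    unfolding S_alt using U(2) L.subspace_image[OF V(2)] by (rule subspace_sums)
  obtain SU SV where SU: "finite SU" "U \<subseteq> span SU" and SV: "finite SV" "V \<subseteq> span SV"
    using U V fin_dim_def by auto
  have "L ` V \<subseteq> span (L ` SV)" using L.spans_image[OF SV(2)] .
  then have "?S \<subseteq> span (SU \<union> L ` SV)"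
    unfolding span_Un using SU by blast
  then have fd: "fin_dim ?S" unfolding fin_dim_def using SU SV by (intro exI[of _ "SU \<union> L ` SV"]) auto
  have pL: "Vector_Spaces.linear scale scale (p \<circ> L)" using Vector_Spaces.linear_compose[OF L p(1)] .
  have mem: "u + L v \<in> ?S" if "u \<in> U" "v \<in> V" for u v using that by blast
  have pS: "p (u + L v) = p (L v)" if "u \<in> U" for u v using p(2) that by (simp add: p.add)
  have "{x \<in> ?S. p x = 0} = U"
  proof (intro equalityI subsetI)
    fix x assume "x \<in> {x \<in> ?S. p x = 0}"
    then show "x \<in> U" using p(2) by blast
  next
    fix x assume x: "x \<in> U"
    then have "x \<in> ?S" using mem[OF x subspace_0[OF V(2)]] by (simp only: L.zero add_0_right)
    then show "x \<in> {x \<in> ?S. p x = 0}" using p(2) x by blast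
  qed
  moreover have "p ` ?S = (p \<circ> L) ` V"
  proof (intro equalityI subsetI)
    fix y assume "y \<in> p ` ?S"
    then obtain u v where "y = p (u + L v)" "u \<in> U" "v \<in> V" by blast
    then show "y \<in> (p \<circ> L) ` V" using pS by (simp only: comp_apply image_eqI)
  next
    fix y assume "y \<in> (p \<circ> L) ` V"
    then obtain v where v: "v \<in> V" "y = p (L v)" by (simp only: comp_apply image_iff) blast
    then show "y \<in> p ` ?S"
      using mem[OF subspace_0[OF U(2)] v(1)] by (simp only: add_0 imageI)
  qed
  moreover have "{v \<in> V. (p \<circ> L) v = 0} = {v \<in> V. L v \<in> U}"
    by (simp only: comp_apply p(2))
  ultimately show ?thesis
    using rank_nullity[OF p(1) fd sub] rank_nullity[OF pL V] by (simp only: add_ac)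
qed

subsection \<open>Functionals and bilinear forms\<close>

definition functional :: "('b \<Rightarrow> 'a) \<Rightarrow> bool" where
  "functional l \<longleftrightarrow> (\<forall>x y. l (x + y) = l x + l y) \<and> (\<forall>c x. l (scale c x) = c * l x)"

lemma functional_diff_scale:
  assumes "functional l" shows "l (x - scale c y) = l x - c * l y"
proof -
  have "x - scale c y = x + scale (- c) y" by simp
  then have "l (x - scale c y) = l x + (- c) * l y"
    using assms unfolding functional_def by metis
  then show ?thesis by simp
qed

lemma functional_zero: "functional l \<Longrightarrow> l 0 = 0"
  unfolding functional_def by (metis add_cancel_right_right)

lemma subspace_functional_kernel:
  assumes "functional l" "subspace V" shows "subspace {x \<in> V. l x = 0}"
  using assms functional_zero[OF assms(1)] by (auto simp: subspace_def functional_def)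

lemma dim_functional_kernel:
  assumes l: "functional l" and V: "fin_dim V" "subspace V"
  shows "dim V \<le> dim {x \<in> V. l x = 0} + 1"
    and "x0 \<in> V \<Longrightarrow> l x0 \<noteq> 0 \<Longrightarrow> dim V = dim {x \<in> V. l x = 0} + 1"
proof -
  let ?U = "{x \<in> V. l x = 0}"
  have U: "subspace ?U" using subspace_functional_kernel[OF l V(2)] .
  show *: "dim V = dim ?U + 1" if x0: "x0 \<in> V" "l x0 \<noteq> 0" for x0
  proof -
    obtain B where B: "B \<subseteq> ?U" "independent B" "span B = ?U" "finite B" "card B = dim ?U"
      by (rule finite_basis[OF fin_dim_mono[OF V(1)] U]) auto
    have nin: "x0 \<notin> span B" using x0 B by auto
    then have "independent (insert x0 B)" using B independent_insertI by blast
    moreover have "V \<subseteq> span (insert x0 B)"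
    proof
      fix x assume "x \<in> V"
      then have "x - scale (l x / l x0) x0 \<in> ?U"
        using x0 V(2) functional_diff_scale[OF l] by (auto simp: subspace_diff subspace_scale)
      then show "x \<in> span (insert x0 B)" using B(3) span_breakdown_eq by blast
    qed
    moreover have "insert x0 B \<subseteq> V" using x0 B by auto
    ultimately have "card (insert x0 B) = dim V" using basis_card_eq_dim by blast
    moreover have "x0 \<notin> B" using nin span_base by blast
    ultimately show ?thesis using B by simp
  qed
  show "dim V \<le> dim ?U + 1"
  proof (cases "\<exists>x\<in>V. l x \<noteq> 0")
    case True
    then show ?thesis using * by auto
  next
    case False
    then have "?U = V" by auto
    then show ?thesis by simp
  qed
qed

lemma dim_le_functionals:
  assumes V: "fin_dim V" "subspace V" and "finite I" and l: "\<And>i. i \<in> I \<Longrightarrow> functional (l i)"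
  shows "subspace {x \<in> V. \<forall>i\<in>I. l i x = 0} \<and> dim V \<le> dim {x \<in> V. \<forall>i\<in>I. l i x = 0} + card I"
  using \<open>finite I\<close> l
proof (induction I rule: finite_induct)
  case empty
  then show ?case using V by simp
next
  case (insert c I)
  let ?U = "{x \<in> V. \<forall>i\<in>I. l i x = 0}"
  have eq: "{x \<in> V. \<forall>i\<in>insert c I. l i x = 0} = {x \<in> ?U. l c x = 0}" by auto
  have fd: "fin_dim ?U" using fin_dim_mono[OF V(1)] by auto
  have U: "subspace ?U" "dim V \<le> dim ?U + card I" using insert by auto
  then show ?case
    unfolding eq using insert dim_functional_kernel(1)[of "l c", OF _ fd U(1)]
      subspace_functional_kernel[of "l c", OF _ U(1)] by fastforce
qed

text \<open>Along a dual system each further functional is nonzero on the common kernel of the earlier ones, so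
  that it lowers the dimension by exactly one.\<close>

lemma dim_dual_functionals:
  assumes V: "fin_dim V" "subspace V" and "finite I" and l: "\<And>i. i \<in> I \<Longrightarrow> functional (l i)"
    and v: "\<And>i. i \<in> I \<Longrightarrow> v i \<in> V" "\<And>i j. i \<in> I \<Longrightarrow> j \<in> I \<Longrightarrow> l i (v j) = (if i = j then 1 else 0)"
  shows "dim V = dim {x \<in> V. \<forall>i\<in>I. l i x = 0} + card I"
  using \<open>finite I\<close> l v
proof (induction I rule: finite_induct)
  case empty
  then show ?case by simp
next
  case (insert c I)
  let ?U = "{x \<in> V. \<forall>i\<in>I. l i x = 0}"
  have eq: "{x \<in> V. \<forall>i\<in>insert c I. l i x = 0} = {x \<in> ?U. l c x = 0}" by auto
  have fd: "fin_dim ?U" using fin_dim_mono[OF V(1)] by auto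
  have "subspace ?U" using dim_le_functionals[OF V insert.hyps(1), of l] insert.prems by auto
  moreover have "dim V = dim ?U + card I" using insert by auto
  moreover have "v c \<in> ?U" using insert by auto
  ultimately show ?case
    unfolding eq using insert dim_functional_kernel(2)[of "l c" ?U "v c"] fd by simp
qed

text \<open>Row rank equals column rank: a complement of the right radical in \<open>W\<close> supplies as many
  functionals as its dimension, and these cut out the left radical in \<open>V\<close>.\<close>

lemma codim_left_radical_le:
  assumes V: "fin_dim V" "subspace V" and W: "fin_dim W" "subspace W"
    and b: "\<And>y. functional (\<lambda>x. b x y)" "\<And>x. functional (b x)"
  shows "dim V + dim {y \<in> W. \<forall>x\<in>V. b x y = 0} \<le> dim {x \<in> V. \<forall>y\<in>W. b x y = 0} + dim W"
proof -
  let ?R = "{y \<in> W. \<forall>x\<in>V. b x y = 0}"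
  have R: "subspace ?R"
    using W(2) b(2) functional_zero[OF b(2)] by (auto simp: subspace_def functional_def)
  obtain A where A: "A \<subseteq> ?R" "independent A" "card A = dim ?R"
    by (rule finite_basis[OF fin_dim_mono[OF W(1)] R]) auto
  obtain B where B: "A \<subseteq> B" "B \<subseteq> W" "span B = W" "finite B" "card B = dim W"
    by (rule extend_to_basis[OF W, of A]) (use A in auto)
  have "{x \<in> V. \<forall>y\<in>B - A. b x y = 0} \<subseteq> {x \<in> V. \<forall>y\<in>W. b x y = 0}"
  proof safe
    fix x y assume x: "x \<in> V" "\<forall>y\<in>B - A. b x y = 0" "y \<in> W"
    have "B \<subseteq> {y \<in> W. b x y = 0}" using A B x by auto
    then have "span B \<subseteq> {y \<in> W. b x y = 0}"
      using subspace_functional_kernel[OF b(2) W(2)] span_minimal by blast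
    then show "b x y = 0" using B x by auto
  qed
  then have "{x \<in> V. \<forall>y\<in>B - A. b x y = 0} = {x \<in> V. \<forall>y\<in>W. b x y = 0}" using B by auto
  then have "dim V \<le> dim {x \<in> V. \<forall>y\<in>W. b x y = 0} + card (B - A)"
    using dim_le_functionals[OF V, of "B - A" "\<lambda>y x. b x y"] b(1) B by auto
  moreover have "card (B - A) + card A = card B"
    using B card_Diff_subset[of A B] finite_subset card_mono by (metis le_add_diff_inverse2)
  ultimately show ?thesis using A B by simp
qed

lemma codim_radicals_eq:
  assumes V: "fin_dim V" "subspace V" and W: "fin_dim W" "subspace W"
    and b: "\<And>y. functional (\<lambda>x. b x y)" "\<And>x. functional (b x)"
  shows "dim V + dim {y \<in> W. \<forall>x\<in>V. b x y = 0} = dim {x \<in> V. \<forall>y\<in>W. b x y = 0} + dim W"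
  using codim_left_radical_le[OF V W b] codim_left_radical_le[OF W V, of "\<lambda>y x. b x y"] b by simp

end

section \<open>Signs and the Koszul operators\<close>

definition sg :: "'n::finite \<Rightarrow> 'n set \<Rightarrow> 'r::comm_ring_1" where
  "sg j T = (-1) ^ card {i \<in> T. to_nat i < to_nat j}"

lemma sg_insert:
  assumes "j \<notin> T"
  shows "sg k (insert j T) = (if to_nat j < to_nat k then - sg k T else sg k T)"
proof -
  have "{i \<in> insert j T. to_nat i < to_nat k} =
      (if to_nat j < to_nat k then insert j {i \<in> T. to_nat i < to_nat k} else {i \<in> T. to_nat i < to_nat k})"
    by auto
  then show ?thesis using assms by (simp add: sg_def)
qed

lemma sg_mult_self: "sg j T * sg j T = 1"
  by (simp add: sg_def flip: power_add mult_2)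

lemma sg_mult_self_left: "sg j T * (sg j T * x) = x"
  by (simp add: sg_mult_self flip: mult.assoc)

text \<open>\<open>sg j T\<close> is the sign in \<open>e\<^sub>j \<and> e\<^sub>T\<close>; inserting two elements in either order gives opposite signs.\<close>

lemma sg_swap:
  assumes "j \<notin> T" "k \<notin> T" "j \<noteq> k"
  shows "sg j T * sg k (insert j T) = - (sg k T * sg j (insert k T))"
    and "sg j (insert k T) * sg k (insert j T) = - (sg k T * sg j T)"
proof -
  have "to_nat j \<noteq> to_nat k" using assms(3) by simp
  then show "sg j T * sg k (insert j T) = - (sg k T * sg j (insert k T))"
    and "sg j (insert k T) * sg k (insert j T) = - (sg k T * sg j T)"
    using assms by (auto simp: sg_insert)
qed

lemma sum_antisymmetric:
  fixes G :: "'a \<Rightarrow> 'a \<Rightarrow> 'r::ab_group_add"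
  assumes "finite S" "\<And>j. G j j = 0" "\<And>j k. j \<in> S \<Longrightarrow> k \<in> S \<Longrightarrow> j \<noteq> k \<Longrightarrow> G j k = - G k j"
  shows "(\<Sum>j\<in>S. \<Sum>k\<in>S. G j k) = 0"
  using assms(1,3)
proof (induction S rule: finite_induct)
  case (insert x S)
  have IH: "(\<Sum>j\<in>S. \<Sum>k\<in>S. G j k) = 0" by (rule insert.IH) (rule insert.prems, auto)
  have "(\<Sum>j\<in>S. G j x) = (\<Sum>j\<in>S. - G x j)"
    by (intro sum.cong refl insert.prems) (use insert.hyps in auto)
  then show ?case using insert.hyps assms(2) IH by (simp add: sum.distrib sum_negf)
qed simp

text \<open>For operators \<open>X j\<close> these are the Koszul differential and, for operators \<open>D j\<close>, the exterior
  multiplication by \<open>\<Sum>\<^sub>j D j e\<^sub>j\<close>. A family \<open>f\<close> stands for \<open>\<Sum>\<^sub>T f T e\<^sub>T\<close>. Multiplication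
  by variables, multiplication by scalars and differentiation all occur as the operators.\<close>

definition contract :: "('n::finite \<Rightarrow> 'r \<Rightarrow> 'r) \<Rightarrow> ('n set \<Rightarrow> 'r) \<Rightarrow> 'n set \<Rightarrow> 'r::comm_ring_1" where
  "contract X f T = (\<Sum>j\<in>-T. sg j T * X j (f (insert j T)))"

definition wedge :: "('n::finite \<Rightarrow> 'r \<Rightarrow> 'r) \<Rightarrow> ('n set \<Rightarrow> 'r) \<Rightarrow> 'n set \<Rightarrow> 'r::comm_ring_1" where
  "wedge D f T = (\<Sum>j\<in>T. sg j (T - {j}) * D j (f (T - {j})))"

lemma additive_sg:
  assumes "additive X" shows "X (sg j T * p) = sg j T * X p"
proof -
  interpret additive X by (rule assms)
  show ?thesis by (cases "even (card {i \<in> T. to_nat i < to_nat j})") (simp_all add: sg_def minus)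
qed

text \<open>The terms for \<open>(j, k)\<close> and for \<open>(k, j)\<close> cancel.\<close>

lemma contract_contract:
  assumes "\<And>j. additive (X j)" and comm: "\<And>i j p. X i (X j p) = X j (X i p)"
  shows "contract X (contract X f) T = 0"
proof -
  define G where "G j k = (if j = k then 0 else
    sg j T * (sg k (insert j T) * X j (X k (f (insert k (insert j T))))))" for j k
  have "contract X (contract X f) T = (\<Sum>j\<in>-T. \<Sum>k\<in>-T. G j k)"
  proof -
    have "sg j T * X j (contract X f (insert j T)) = (\<Sum>k\<in>-T. G j k)" if "j \<in> - T" for j
    proof -
      have "- T = insert j (- insert j T)" using that by auto
      then have "(\<Sum>k\<in>-T. G j k) = (\<Sum>k\<in>- insert j T. G j k)"
        by (simp add: G_def)
      also have "\<dots> = (\<Sum>k\<in>- insert j T. sg j T * X j (sg k (insert j T) * X k (f (insert k (insert j T)))))"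
        by (intro sum.cong refl) (auto simp: G_def additive_sg[OF assms(1)])
      finally show ?thesis
        by (simp add: contract_def additive.sum[OF assms(1)] sum_distrib_left)
    qed
    then show ?thesis by (simp add: contract_def[of X "contract X f"])
  qed
  also have "\<dots> = 0"
  proof (rule sum_antisymmetric)
    fix j k assume jk: "j \<in> - T" "k \<in> - T" "j \<noteq> k"
    define y where "y = X k (X j (f (insert j (insert k T))))"
    have "G j k = sg j T * sg k (insert j T) * y"
      using jk by (simp add: G_def y_def comm[of j k] insert_commute[of k j] mult.assoc)
    also have "\<dots> = - (sg k T * sg j (insert k T)) * y"
      using jk by (subst sg_swap(1)) auto
    also have "\<dots> = - G k j"
      using jk by (simp add: G_def y_def mult.assoc)
    finally show "G j k = - G k j" .
  qed (simp_all add: G_def)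
  finally show ?thesis .
qed

text \<open>Cartan's formula: only the diagonal terms of the two compositions survive.\<close>

lemma contract_wedge:
  assumes X: "\<And>j. additive (X j)" and D: "\<And>j. additive (D j)"
    and comm: "\<And>j k p. j \<noteq> k \<Longrightarrow> X j (D k p) = D k (X j p)"
  shows "contract X (wedge D f) T + wedge D (contract X f) T =
    (\<Sum>j\<in>-T. X j (D j (f T))) + (\<Sum>j\<in>T. D j (X j (f T)))"
proof -
  define G where "G j k = sg k (T - {k}) * (sg j (T - {k}) * X j (D k (f (insert j (T - {k})))))" for j k
  have "sg j T * X j (wedge D f (insert j T)) = X j (D j (f T)) - (\<Sum>k\<in>T. G j k)" if j: "j \<in> - T" for j
  proof -
    have "sg j T * X j (wedge D f (insert j T)) =
        (\<Sum>k\<in>insert j T. sg j T * (sg k (insert j T - {k}) * X j (D k (f (insert j T - {k})))))"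
      by (simp add: wedge_def additive.sum[OF X] additive_sg[OF X] sum_distrib_left)
    also have "\<dots> = X j (D j (f T)) + (\<Sum>k\<in>T. sg j T * (sg k (insert j T - {k}) * X j (D k (f (insert j T - {k})))))"
      using j by (simp add: sg_mult_self_left)
    also have "(\<Sum>k\<in>T. sg j T * (sg k (insert j T - {k}) * X j (D k (f (insert j T - {k}))))) = (\<Sum>k\<in>T. - G j k)"
    proof (rule sum.cong[OF refl])
      fix k assume k: "k \<in> T"
      then have i: "insert j T - {k} = insert j (T - {k})" "insert k (T - {k}) = T" "j \<noteq> k" using j by auto
      have "sg j T * sg k (insert j (T - {k})) = - (sg k (T - {k}) * sg j (T - {k}) :: 'b)"
        using sg_swap(2)[of j "T - {k}" k, where 'c = 'b] j i(2,3) by simp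
      then show "sg j T * (sg k (insert j T - {k}) * X j (D k (f (insert j T - {k})))) = - G j k"
        unfolding i(1) G_def by (simp only: mult.assoc[symmetric] mult_minus_left)
    qed
    finally show ?thesis by (simp add: sum_negf)
  qed
  then have 1: "contract X (wedge D f) T = (\<Sum>j\<in>-T. X j (D j (f T))) - (\<Sum>j\<in>-T. \<Sum>k\<in>T. G j k)"
    by (simp add: contract_def sum_subtractf)
  have "sg k (T - {k}) * D k (contract X f (T - {k})) = D k (X k (f T)) + (\<Sum>j\<in>-T. G j k)" if k: "k \<in> T" for k
  proof -
    have c: "- (T - {k}) = insert k (- T)" using k by auto
    have "sg k (T - {k}) * D k (contract X f (T - {k})) =
        (\<Sum>j\<in>insert k (-T). sg k (T - {k}) * (sg j (T - {k}) * D k (X j (f (insert j (T - {k}))))))"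
      by (simp add: contract_def c additive.sum[OF D] additive_sg[OF D] sum_distrib_left)
    also have "\<dots> = D k (X k (f T)) + (\<Sum>j\<in>-T. sg k (T - {k}) * (sg j (T - {k}) * D k (X j (f (insert j (T - {k}))))))"
      using k by (simp add: sg_mult_self_left insert_absorb)
    also have "(\<Sum>j\<in>-T. sg k (T - {k}) * (sg j (T - {k}) * D k (X j (f (insert j (T - {k})))))) = (\<Sum>j\<in>-T. G j k)"
    proof (rule sum.cong[OF refl])
      fix j assume "j \<in> - T"
      then have "j \<noteq> k" using k by auto
      then show "sg k (T - {k}) * (sg j (T - {k}) * D k (X j (f (insert j (T - {k}))))) = G j k"
        by (simp add: G_def comm)
    qed
    finally show ?thesis .
  qed
  then have 2: "wedge D (contract X f) T = (\<Sum>j\<in>T. D j (X j (f T))) + (\<Sum>k\<in>T. \<Sum>j\<in>-T. G j k)"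
    by (simp add: wedge_def sum.distrib)
  show ?thesis unfolding 1 2 by (simp add: sum.swap[of _ "-T" T])
qed

section \<open>Polynomials\<close>

lemma sum_monomials: "(\<Sum>m\<in>Poly_Mapping.keys p. Poly_Mapping.single m (Poly_Mapping.lookup p m)) = p"
proof (rule poly_mapping_eqI)
  fix k
  have "Poly_Mapping.lookup (\<Sum>m\<in>Poly_Mapping.keys p. Poly_Mapping.single m (Poly_Mapping.lookup p m)) k =
      (\<Sum>m\<in>Poly_Mapping.keys p. if m = k then Poly_Mapping.lookup p m else 0)"
    by (simp add: lookup_sum lookup_single when_def)
  then show "Poly_Mapping.lookup (\<Sum>m\<in>Poly_Mapping.keys p. Poly_Mapping.single m (Poly_Mapping.lookup p m)) k
      = Poly_Mapping.lookup p k"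
    by (simp add: in_keys_iff)
qed

lemma mpoly_induct [case_names single add]:
  fixes p :: "('v, 'k::comm_ring_1) mpoly"
  assumes "\<And>m c. P (Poly_Mapping.single m c)" "\<And>p q. P p \<Longrightarrow> P q \<Longrightarrow> P (p + q)"
  shows "P p"
proof -
  have "P (\<Sum>m\<in>A. Poly_Mapping.single m (Poly_Mapping.lookup p m))" if "finite A" for A
    using that
  proof (induction A rule: finite_induct)
    case empty
    show ?case using assms(1)[of 0 0] by simp
  qed (simp add: assms)
  from this[of "Poly_Mapping.keys p"] show ?thesis
    by (simp add: sum_monomials)
qed

lemma lookup_pvar_mult:
  "Poly_Mapping.lookup (pvar j * p) k =
     (if Poly_Mapping.lookup k j = 0 then 0 else Poly_Mapping.lookup p (k - Poly_Mapping.single j 1))"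
proof (induction p rule: mpoly_induct)
  case (single m c)
  let ?e = "Poly_Mapping.single j (1::nat)"
  have "?e + m = k \<longleftrightarrow> Poly_Mapping.lookup k j \<noteq> 0 \<and> m = k - ?e"
  proof
    assume "Poly_Mapping.lookup k j \<noteq> 0 \<and> m = k - ?e"
    then show "?e + m = k"
      by (intro poly_mapping_eqI) (auto simp: lookup_add lookup_minus lookup_single when_def)
  qed (auto simp: lookup_add lookup_single)
  then show ?case
    by (auto simp: pvar_def mult_single lookup_single when_def)
qed (simp add: distrib_left lookup_add)

lemma lookup_pconst_mult: "Poly_Mapping.lookup (pconst c * p) k = c * Poly_Mapping.lookup p k"
proof (induction p rule: mpoly_induct)
  case (single m c)
  then show ?case by (simp add: pconst_def mult_single lookup_single mult_when)
qed (simp add: distrib_left lookup_add)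

lemma pconst_simps:
  "pconst 0 = 0" "pconst 1 = 1" "pconst (a + b) = pconst a + pconst b"
  "pconst (a * b) = pconst a * pconst b"
  by (simp_all add: pconst_def single_add mult_single)

lemma pconst_of_int: "pconst (of_int z) = of_int z"
  by (simp add: pconst_def)

subsection \<open>Evaluation\<close>

definition mono_eval :: "('v::finite \<Rightarrow> 'k::comm_ring_1) \<Rightarrow> ('v \<Rightarrow>\<^sub>0 nat) \<Rightarrow> 'k" where
  "mono_eval a m = (\<Prod>j\<in>UNIV. a j ^ Poly_Mapping.lookup m j)"

lemma mono_eval_add: "mono_eval a (m + m') = mono_eval a m * mono_eval a m'"
  by (simp add: mono_eval_def lookup_add power_add prod.distrib)

lemma mono_eval_0 [simp]: "mono_eval a 0 = 1"
  by (simp add: mono_eval_def)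

lemma mono_eval_scale: "mono_eval (\<lambda>j. c * a j) m = c ^ mdeg m * mono_eval a m"
  by (simp add: mono_eval_def mdeg_def power_mult_distrib prod.distrib power_sum)

lemma peval_superset:
  assumes "finite A" "Poly_Mapping.keys p \<subseteq> A"
  shows "peval p a = (\<Sum>m\<in>A. Poly_Mapping.lookup p m * mono_eval a m)"
  unfolding peval_def mono_eval_def using assms
  by (intro sum.mono_neutral_left) (auto simp: in_keys_iff)

lemma peval_single [simp]: "peval (Poly_Mapping.single m c) a = c * mono_eval a m"
  by (simp add: peval_def mono_eval_def)

lemma peval_add [simp]: "peval (p + q) a = peval p a + peval q a"
proof -
  let ?A = "Poly_Mapping.keys p \<union> Poly_Mapping.keys q"
  show ?thesis
    using keys_add[of p q]
    by (simp add: peval_superset[of ?A] lookup_add distrib_right sum.distrib)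
qed

lemma peval_0 [simp]: "peval 0 a = 0"
  by (simp add: peval_def)

lemma peval_mult [simp]: "peval (p * q) a = peval p a * peval q a"
proof (induction p rule: mpoly_induct)
  case (single m c)
  show ?case
  proof (induction q rule: mpoly_induct)
    case (single m' c')
    then show ?case by (simp add: mult_single mono_eval_add mult_ac)
  qed (simp add: distrib_left)
qed (simp add: distrib_right)

lemma peval_pconst [simp]: "peval (pconst c) a = c"
  by (simp add: pconst_def)

lemma peval_1 [simp]: "peval 1 a = 1"
  using peval_pconst[of 1 a] by (simp only: pconst_simps)

lemma mono_eval_single: "mono_eval a (Poly_Mapping.single j n) = a j ^ n"
proof -
  have "mono_eval a (Poly_Mapping.single j n) = (\<Prod>i\<in>UNIV. if i = j then a j ^ n else 1)"
    unfolding mono_eval_def by (intro prod.cong) (auto simp: lookup_single when_def)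
  then show ?thesis by simp
qed

lemma peval_pvar [simp]: "peval (pvar j) a = a j"
  by (simp add: pvar_def mono_eval_single)

lemma peval_sum [simp]: "peval (sum f A) a = (\<Sum>x\<in>A. peval (f x) a)"
  by (induction A rule: infinite_finite_induct) simp_all

lemma peval_prod [simp]: "peval (prod f A) a = (\<Prod>x\<in>A. peval (f x) a)"
  by (induction A rule: infinite_finite_induct) simp_all

lemma peval_power [simp]: "peval (p ^ n) a = peval p a ^ n"
  by (induction n) simp_all

lemma peval_uminus [simp]: "peval (- p) a = - peval p a"
  using peval_add[of p "- p" a] by (simp add: eq_neg_iff_add_eq_0 add.commute)

lemma peval_of_int [simp]: "peval (of_int z) a = of_int z"
proof -
  have "peval (of_nat n) a = of_nat n" for n by (induction n) simp_all
  then show ?thesis by (cases z rule: int_cases2) simp_all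
qed

lemma peval_sg [simp]: "peval (sg j T) a = sg j T"
  by (simp add: sg_def)

lemma homog_peval_scale:
  assumes "homog (int t) p"
  shows "peval p (\<lambda>j. c * a j) = c ^ t * peval p a"
  unfolding peval_superset[OF finite_keys order_refl] sum_distrib_left
  using assms by (intro sum.cong refl) (simp add: mono_eval_scale homog_def)

subsection \<open>Homogeneous components\<close>

lemma mdeg_0 [simp]: "mdeg 0 = 0"
  by (simp add: mdeg_def)

lemma mdeg_add: "mdeg (m + m') = mdeg m + mdeg m'"
  by (simp add: mdeg_def lookup_add sum.distrib)

lemma mdeg_single [simp]: "mdeg (Poly_Mapping.single j n) = n"
proof -
  have "mdeg (Poly_Mapping.single j n) = (\<Sum>i\<in>UNIV. if i = j then n else 0)"
    unfolding mdeg_def by (intro sum.cong) (auto simp: lookup_single when_def)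
  then show ?thesis by simp
qed

lemma mdeg_eq_0: "mdeg m = 0 \<longleftrightarrow> m = 0"
  by (auto simp: mdeg_def poly_mapping_eq_iff fun_eq_iff)

lemma lookup_le_mdeg: "Poly_Mapping.lookup m j \<le> mdeg m"
  unfolding mdeg_def by (rule member_le_sum) auto

lemma finite_mdeg: "finite {m :: 'v::finite \<Rightarrow>\<^sub>0 nat. mdeg m = t}"
proof (rule finite_imageD)
  show "finite (Poly_Mapping.lookup ` {m :: 'v \<Rightarrow>\<^sub>0 nat. mdeg m = t})"
  proof (rule finite_subset)
    show "Poly_Mapping.lookup ` {m :: 'v \<Rightarrow>\<^sub>0 nat. mdeg m = t} \<subseteq> (UNIV :: 'v set) \<rightarrow>\<^sub>E {..t}"
      using lookup_le_mdeg by (auto simp: PiE_def Pi_def)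
  qed (simp add: finite_PiE)
  show "inj_on Poly_Mapping.lookup {m :: 'v \<Rightarrow>\<^sub>0 nat. mdeg m = t}"
    by (rule inj_onI) (simp add: lookup_inject)
qed

lemma homog_iff: "homog t p \<longleftrightarrow> (\<forall>m. Poly_Mapping.lookup p m \<noteq> 0 \<longrightarrow> int (mdeg m) = t)"
  by (auto simp: homog_def in_keys_iff)

lemma homog_0 [simp]: "homog t 0"
  by (simp add: homog_def)

lemma homog_add: "homog t p \<Longrightarrow> homog t q \<Longrightarrow> homog t (p + q)"
  by (simp add: homog_iff lookup_add) (metis add_0)

lemma homog_uminus: "homog t p \<Longrightarrow> homog t (- p)"
  by (simp add: homog_iff)

lemma homog_single: "int (mdeg m) = t \<Longrightarrow> homog t (Poly_Mapping.single m c)"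
  by (simp add: homog_iff lookup_single when_def)

lemma homog_pvar: "homog 1 (pvar j)"
  by (simp add: pvar_def homog_single)

lemma homog_pconst: "homog 0 (pconst c)"
  by (simp add: pconst_def homog_single)

lemma homog_pconst_mult: "homog t p \<Longrightarrow> homog t (pconst c * p)"
  using homog_mult[OF homog_pconst] by fastforce

lemma homog_sg_mult: "homog t p \<Longrightarrow> homog t (sg j T * p)"
  by (cases "even (card {i \<in> T. to_nat i < to_nat j})") (simp_all add: sg_def homog_uminus)

lemma homog_neg: "homog t p \<Longrightarrow> t < 0 \<Longrightarrow> p = 0"
  by (rule poly_mapping_eqI) (auto simp: homog_iff)

lemma homog_0_pconst:
  assumes "homog 0 p" shows "p = pconst (Poly_Mapping.lookup p 0)"
  by (rule poly_mapping_eqI)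
     (use assms in \<open>auto simp: homog_iff pconst_def lookup_single when_def mdeg_eq_0\<close>)

definition hcomp :: "int \<Rightarrow> ('v::finite, 'k::comm_ring_1) mpoly \<Rightarrow> ('v, 'k) mpoly" where
  "hcomp t p = (\<Sum>m\<in>{m \<in> Poly_Mapping.keys p. int (mdeg m) = t}. Poly_Mapping.single m (Poly_Mapping.lookup p m))"

lemma lookup_hcomp: "Poly_Mapping.lookup (hcomp t p) m = (Poly_Mapping.lookup p m when int (mdeg m) = t)"
proof -
  let ?S = "{m \<in> Poly_Mapping.keys p. int (mdeg m) = t}"
  have "Poly_Mapping.lookup (hcomp t p) m = (\<Sum>m'\<in>?S. if m' = m then Poly_Mapping.lookup p m' else 0)"
    by (simp add: hcomp_def lookup_sum lookup_single when_def)
  also have "\<dots> = (if m \<in> ?S then Poly_Mapping.lookup p m else 0)" by (rule sum.delta) simp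
  finally show ?thesis by (auto simp: when_def in_keys_iff)
qed

lemma homog_hcomp: "homog t (hcomp t p)"
  by (simp add: homog_iff lookup_hcomp when_def)

lemma hcomp_homog: "homog t p \<Longrightarrow> hcomp u p = (if u = t then p else 0)"
  by (auto intro!: poly_mapping_eqI simp: homog_iff lookup_hcomp when_def)

lemma hcomp_add: "hcomp t (p + q) = hcomp t p + hcomp t q"
  by (auto intro!: poly_mapping_eqI simp: lookup_hcomp lookup_add when_def)

lemma hcomp_0 [simp]: "hcomp t 0 = 0"
  by (auto intro!: poly_mapping_eqI simp: lookup_hcomp when_def)

lemma hcomp_sum: "hcomp t (sum f A) = (\<Sum>x\<in>A. hcomp t (f x))"
  by (induction A rule: infinite_finite_induct) (simp_all add: hcomp_add)

definition degs :: "('v::finite, 'k::comm_ring_1) mpoly \<Rightarrow> int set" where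
  "degs p = (\<lambda>m. int (mdeg m)) ` Poly_Mapping.keys p"

lemma finite_degs [simp]: "finite (degs p)"
  by (simp add: degs_def)

lemma sum_hcomp:
  assumes "finite A" "degs p \<subseteq> A" shows "(\<Sum>t\<in>A. hcomp t p) = p"
proof (rule poly_mapping_eqI)
  fix m
  have "Poly_Mapping.lookup (\<Sum>t\<in>A. hcomp t p) m = (\<Sum>t\<in>A. if int (mdeg m) = t then Poly_Mapping.lookup p m else 0)"
    by (simp add: lookup_sum lookup_hcomp when_def)
  also have "\<dots> = Poly_Mapping.lookup p m"
    using assms by (auto simp: degs_def image_subset_iff in_keys_iff)
  finally show "Poly_Mapping.lookup (\<Sum>t\<in>A. hcomp t p) m = Poly_Mapping.lookup p m" .
qed

subsection \<open>Derivatives\<close>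

lemma partial_add: "partial j (p + q) = partial j p + partial j q"
  by (rule poly_mapping_eqI) (simp add: lookup_partial lookup_add distrib_left)

lemma homog_partial:
  assumes "homog t p" shows "homog (t - 1) (partial j p)"
proof -
  have "int (mdeg m) = t - 1" if "Poly_Mapping.lookup (partial j p) m \<noteq> 0" for m
  proof -
    have "Poly_Mapping.lookup p (m + Poly_Mapping.single j 1) \<noteq> 0"
      using that by (auto simp: lookup_partial)
    then have "int (mdeg (m + Poly_Mapping.single j 1)) = t" using assms homog_iff by blast
    then show ?thesis by (simp add: mdeg_add)
  qed
  then show ?thesis by (simp add: homog_iff)
qed

lemma minus_single_add:
  assumes "Poly_Mapping.lookup k j \<noteq> (0::nat)"
  shows "k - Poly_Mapping.single j 1 + Poly_Mapping.single j 1 = k"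
  using assms by (intro poly_mapping_eqI) (auto simp: lookup_add lookup_minus lookup_single when_def)

lemma partial_pvar_mult:
  "partial j (pvar j * p) = p + pvar j * partial j p"
  "i \<noteq> j \<Longrightarrow> partial i (pvar j * p) = pvar j * partial i p"
proof -
  show "partial j (pvar j * p) = p + pvar j * partial j p"
  proof (rule poly_mapping_eqI)
    fix k
    show "Poly_Mapping.lookup (partial j (pvar j * p)) k = Poly_Mapping.lookup (p + pvar j * partial j p) k"
      using minus_single_add[of k j] by (cases "Poly_Mapping.lookup k j")
         (simp_all add: lookup_partial lookup_pvar_mult lookup_add lookup_minus distrib_right)
  qed
  assume ij: "i \<noteq> j"
  show "partial i (pvar j * p) = pvar j * partial i p"
  proof (rule poly_mapping_eqI)
    fix k :: "'a \<Rightarrow>\<^sub>0 nat"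
    have "k + Poly_Mapping.single i 1 - Poly_Mapping.single j 1 = k - Poly_Mapping.single j 1 + Poly_Mapping.single i 1"
      using ij by (intro poly_mapping_eqI) (auto simp: lookup_add lookup_minus lookup_single when_def)
    then show "Poly_Mapping.lookup (partial i (pvar j * p)) k = Poly_Mapping.lookup (pvar j * partial i p) k"
      using ij by (simp add: lookup_partial lookup_pvar_mult lookup_add lookup_minus lookup_single when_def)
  qed
qed

lemma euler_formula:
  assumes "homog t p" shows "(\<Sum>j\<in>UNIV. pvar j * partial j p) = of_int t * p"
proof (rule poly_mapping_eqI)
  fix k
  have "Poly_Mapping.lookup (pvar j * partial j p) k = of_nat (Poly_Mapping.lookup k j) * Poly_Mapping.lookup p k" for j
    using minus_single_add[of k j] by (cases "Poly_Mapping.lookup k j") (simp_all add: lookup_partial lookup_pvar_mult lookup_minus)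
  then have "Poly_Mapping.lookup (\<Sum>j\<in>UNIV. pvar j * partial j p) k = of_nat (mdeg k) * Poly_Mapping.lookup p k"
    by (simp add: lookup_sum mdeg_def sum_distrib_right)
  also have "\<dots> = of_int t * Poly_Mapping.lookup p k"
  proof (cases "Poly_Mapping.lookup p k = 0")
    case False
    then have "t = int (mdeg k)" using assms homog_iff by metis
    then show ?thesis by simp
  qed simp
  also have "\<dots> = Poly_Mapping.lookup (of_int t * p) k"
    using lookup_pconst_mult[of "of_int t" p k] by (simp add: pconst_def)
  finally show "Poly_Mapping.lookup (\<Sum>j\<in>UNIV. pvar j * partial j p) k = Poly_Mapping.lookup (of_int t * p) k" .
qed

section \<open>Koszul homology of graded submodules of free modules\<close>

subsection \<open>Submodules and their graded pieces\<close>

definition smult :: "('n, 'k) mpoly \<Rightarrow> (nat \<Rightarrow> ('n, 'k::comm_ring_1) mpoly) \<Rightarrow> nat \<Rightarrow> ('n, 'k) mpoly" where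
  "smult p v = (\<lambda>k. p * v k)"

lemma smult_apply [simp]: "smult p v k = p * v k"
  by (simp add: smult_def)

definition submodule :: "int list \<Rightarrow> (nat \<Rightarrow> ('n::finite, 'k::comm_ring_1) mpoly) set \<Rightarrow> bool" where
  "submodule a M \<longleftrightarrow> M \<subseteq> free_mod a \<and> 0 \<in> M \<and> (\<forall>v\<in>M. \<forall>w\<in>M. v + w \<in> M) \<and> (\<forall>p. \<forall>v\<in>M. smult p v \<in> M)"

lemma submoduleD:
  assumes "submodule a M"
  shows "M \<subseteq> free_mod a" "0 \<in> M" "v \<in> M \<Longrightarrow> w \<in> M \<Longrightarrow> v + w \<in> M" "v \<in> M \<Longrightarrow> smult p v \<in> M"
  using assms by (simp_all add: submodule_def)

lemma submodule_sum: "submodule a M \<Longrightarrow> (\<And>i. i \<in> I \<Longrightarrow> f i \<in> M) \<Longrightarrow> sum f I \<in> M"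
  by (induction I rule: infinite_finite_induct) (simp_all add: submoduleD)

lemma smult_0 [simp]: "smult p 0 = 0"
  by (simp add: fun_eq_iff)

lemma submodule_free_mod: "submodule a (free_mod a)"
  by (simp add: submodule_def free_mod_def)

lemma free_mod_nth: "v \<in> free_mod a \<Longrightarrow> \<not> k < length a \<Longrightarrow> v k = 0"
  by (simp add: free_mod_def)

lemma grade_subset: "grade a t \<subseteq> free_mod a"
  by (auto simp: grade_def)

lemma grade_nth: "v \<in> grade a t \<Longrightarrow> homog (t - a ! k) (v k)"
  by (cases "k < length a") (auto simp: grade_def free_mod_def)

lemma gradeI: "(\<And>k. homog (t - a ! k) (v k)) \<Longrightarrow> v \<in> free_mod a \<Longrightarrow> v \<in> grade a t"
  by (simp add: grade_def)

lemma grade_0: "0 \<in> grade a t"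
  by (simp add: grade_def free_mod_def)

lemma grade_add: "v \<in> grade a t \<Longrightarrow> w \<in> grade a t \<Longrightarrow> v + w \<in> grade a t"
  by (simp add: grade_def free_mod_def homog_add)

lemma grade_sum: "(\<And>i. i \<in> I \<Longrightarrow> f i \<in> grade a t) \<Longrightarrow> sum f I \<in> grade a t"
  by (induction I rule: infinite_finite_induct) (simp_all add: grade_0 grade_add)

lemma grade_smult: "homog u p \<Longrightarrow> v \<in> grade a t \<Longrightarrow> smult p v \<in> grade a (u + t)"
  using homog_mult[of u p "t - a ! _" "v _"] by (auto simp: grade_def free_mod_def add_diff_eq)

subsection \<open>The complex\<close>

text \<open>A family \<open>f\<close> stands for the element \<open>\<Sum>\<^sub>T e\<^sub>T \<otimes> f T\<close> of the exterior algebra tensored with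
  sequences of polynomials. All complexes and all maps between them live in this one vector space,
  so that no quotient space ever has to be formed.\<close>

type_synonym ('n, 'k) family = "'n set \<Rightarrow> nat \<Rightarrow> ('n, 'k) mpoly"

definition scl :: "'k \<Rightarrow> ('n, 'k::field) family \<Rightarrow> ('n, 'k) family" where
  "scl c f = (\<lambda>T k. pconst c * f T k)"

lemma scl_apply [simp]: "scl c f T k = pconst c * f T k"
  by (simp add: scl_def)

lemma scl_smult: "scl c f T = smult (pconst c) (f T)"
  by (simp add: scl_def smult_def)

global_interpretation fam: abstract_vector_space "scl :: 'k \<Rightarrow> ('n, 'k::field) family \<Rightarrow> ('n, 'k) family"
  by unfold_locales (simp_all add: fun_eq_iff pconst_simps distrib_left distrib_right mult.assoc)

text \<open>The Koszul differential of the variables, coordinate by coordinate.\<close>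

definition kd :: "('n::finite, 'k::field) family \<Rightarrow> ('n, 'k) family" where
  "kd f T k = contract (\<lambda>j. (*) (pvar j)) (\<lambda>T. f T k) T"

lemma kd_apply: "kd f T k = (\<Sum>j\<in>-T. sg j T * (pvar j * f (insert j T) k))"
  by (simp add: kd_def contract_def)

lemma sum_fun_apply: "sum F A x = (\<Sum>i\<in>A. F i x)"
  by (induction A rule: infinite_finite_induct) simp_all

lemma kd_sum: "kd f T = (\<Sum>j\<in>-T. smult (sg j T * pvar j) (f (insert j T)))"
  by (simp add: fun_eq_iff kd_apply sum_fun_apply mult.assoc)

lemma additive_mult: "additive ((*) (p :: 'r::ring))"
  by unfold_locales (rule distrib_left)

lemma kd_kd [simp]: "kd (kd f) = 0"
proof (intro ext)
  show "kd (kd f) T k = 0 T k" for T k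
    unfolding kd_def using additive_mult
    by (subst contract_contract) (simp_all add: mult.left_commute)
qed

lemma linear_kd: "Vector_Spaces.linear scl scl (kd :: ('n::finite, 'k::field) family \<Rightarrow> _)"
  unfolding Vector_Spaces.linear_iff
  by (simp add: fam.vector_space_axioms fun_eq_iff kd_apply distrib_left sum.distrib
      sum_distrib_left mult.left_commute)

lemmas kd_add = module_hom.add[OF linear_kd[THEN linear_iff_module_hom[THEN iffD1]]]
  and kd_zero = module_hom.zero[OF linear_kd[THEN linear_iff_module_hom[THEN iffD1]]]

text \<open>The part of \<open>\<Lambda>\<^sup>i K\<^sup>n \<otimes> M\<close> of internal degree \<open>j\<close>, where \<open>e\<^sub>T\<close> has degree \<open>card T\<close>.\<close>

definition chains :: "int list \<Rightarrow> (nat \<Rightarrow> ('n::finite, 'k::field) mpoly) set \<Rightarrow> nat \<Rightarrow> int \<Rightarrow> ('n, 'k) family set" where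
  "chains a M i j = {f. \<forall>T. (card T = i \<longrightarrow> f T \<in> M \<inter> grade a (j - int i)) \<and> (card T \<noteq> i \<longrightarrow> f T = 0)}"

lemma chains_homog: "f \<in> chains a M i j \<Longrightarrow> homog (j - int i - a ! k) (f T k)"
  by (cases "card T = i") (auto simp: chains_def grade_nth)

lemma chains_mono: "M \<subseteq> N \<Longrightarrow> chains a M i j \<subseteq> chains a N i j"
  by (auto simp: chains_def)

lemma chains_free: "submodule a M \<Longrightarrow> chains a M i j \<subseteq> chains a (free_mod a) i j"
  using chains_mono submoduleD(1) .

lemma chains_mem: "submodule a M \<Longrightarrow> f \<in> chains a M i j \<Longrightarrow> f T \<in> M"
  by (cases "card T = i") (auto simp: chains_def submoduleD)

lemma subspace_chains: "submodule a M \<Longrightarrow> fam.subspace (chains a M i j)"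
  by (auto simp: fam.subspace_def chains_def submoduleD grade_0 grade_add scl_smult
      grade_smult[OF homog_pconst, simplified])

lemma kd_chains:
  assumes M: "submodule a M" and f: "f \<in> chains a M (Suc i) j"
  shows "kd f \<in> chains a M i j"
proof -
  have "kd f T \<in> M \<inter> grade a (j - int i)" if T: "card T = i" for T
  proof -
    have *: "smult (sg l T * pvar l) (f (insert l T)) \<in> grade a (j - int i)" if "l \<in> - T" for l
    proof -
      have "f (insert l T) \<in> grade a (j - int (Suc i))" using f that T by (simp add: chains_def)
      from grade_smult[OF homog_sg_mult[OF homog_pvar] this, of l T l] show ?thesis by simp
    qed
    have **: "smult (sg l T * pvar l) (f (insert l T)) \<in> M" if "l \<in> - T" for l
      using f that T submoduleD(4)[OF M] by (simp add: chains_def)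
    then show ?thesis unfolding kd_sum by (intro IntI submodule_sum[OF M] grade_sum * **)
  qed
  moreover have "kd f T = 0" if T: "card T \<noteq> i" for T
  proof -
    have "f (insert l T) = 0" if "l \<in> - T" for l using f that T by (simp add: chains_def)
    then show ?thesis by (simp add: fun_eq_iff kd_apply)
  qed
  ultimately show ?thesis by (simp add: chains_def)
qed

lemma kd_chains_0: "f \<in> chains a M 0 j \<Longrightarrow> kd f = 0"
  by (auto simp: chains_def fun_eq_iff kd_apply)

text \<open>The chains with a single monomial as entry span.\<close>

lemma fin_dim_chains:
  assumes "submodule a (M :: (nat \<Rightarrow> ('n::finite, 'k::field) mpoly) set)"
  shows "fam.fin_dim (chains a M i j)"
proof -
  define u :: "'n set \<times> nat \<times> ('n \<Rightarrow>\<^sub>0 nat) \<Rightarrow> ('n, 'k) family" where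
    "u = (\<lambda>(T, k, m) T' k'. if T' = T \<and> k' = k then Poly_Mapping.single m 1 else 0)"
  let ?I = "(UNIV :: 'n set set) \<times> (SIGMA k:{..<length a}. {m :: 'n \<Rightarrow>\<^sub>0 nat. int (mdeg m) = j - int i - a ! k})"
  have "finite {m :: 'n \<Rightarrow>\<^sub>0 nat. int (mdeg m) = t}" for t
    using finite_mdeg[of "nat t"] by (rule finite_subset[rotated]) auto
  then have fin: "finite ?I" by (intro finite_SigmaI) auto
  have "f \<in> fam.span (u ` ?I)" if f: "f \<in> chains a M i j" for f
  proof -
    have "f = (\<Sum>T\<in>UNIV. \<Sum>k<length a. \<Sum>m\<in>Poly_Mapping.keys (f T k).
        scl (Poly_Mapping.lookup (f T k) m) (u (T, k, m)))" (is "f = ?s")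
    proof (intro ext)
      fix T k
      have "?s T k = (\<Sum>T'\<in>UNIV. \<Sum>k'<length a. if T' = T \<and> k' = k
          then (\<Sum>m\<in>Poly_Mapping.keys (f T' k'). Poly_Mapping.single m (Poly_Mapping.lookup (f T' k') m)) else 0)"
        unfolding sum_fun_apply
      proof (intro sum.cong refl)
        fix T' k'
        show "(\<Sum>m\<in>Poly_Mapping.keys (f T' k'). scl (Poly_Mapping.lookup (f T' k') m) (u (T', k', m)) T k) =
          (if T' = T \<and> k' = k
           then (\<Sum>m\<in>Poly_Mapping.keys (f T' k'). Poly_Mapping.single m (Poly_Mapping.lookup (f T' k') m)) else 0)"
        proof (cases "T = T' \<and> k = k'")
          case False
          then have "u (T', k', m) T k = 0" for m by (simp add: u_def del: de_Morgan_conj)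
          then show ?thesis using False by auto
        qed (simp add: u_def pconst_def mult_single)
      qed
      also have "\<dots> = (\<Sum>T'\<in>UNIV. if T' = T then (\<Sum>k'<length a. if k' = k then f T' k' else 0) else 0)"
        unfolding sum_monomials by (intro sum.cong refl) auto
      also have "\<dots> = (if k < length a then f T k else 0)" by simp
      also have "\<dots> = f T k"
        using chains_mem[OF submodule_free_mod] f chains_free[OF assms] free_mod_nth by (metis subsetD)
      finally show "f T k = ?s T k" by simp
    qed
    moreover have "scl (Poly_Mapping.lookup (f T k) m) (u (T, k, m)) \<in> fam.span (u ` ?I)"
      if "k < length a" "m \<in> Poly_Mapping.keys (f T k)" for T k m
      using that chains_homog[OF f] by (intro fam.span_scale fam.span_base imageI) (auto simp: homog_def)
    ultimately show ?thesis
      by (metis (no_types, lifting) fam.span_sum lessThan_iff)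
  qed
  then show ?thesis unfolding fam.fin_dim_def using fin by blast
qed

definition cycles :: "int list \<Rightarrow> (nat \<Rightarrow> ('n::finite, 'k::field) mpoly) set \<Rightarrow> nat \<Rightarrow> int \<Rightarrow> ('n, 'k) family set" where
  "cycles a M i j = {f \<in> chains a M i j. kd f = 0}"

definition boundaries :: "int list \<Rightarrow> (nat \<Rightarrow> ('n::finite, 'k::field) mpoly) set \<Rightarrow> nat \<Rightarrow> int \<Rightarrow> ('n, 'k) family set" where
  "boundaries a M i j = kd ` chains a M (Suc i) j"

text \<open>The dimension of \<open>Tor\<^sub>i(M, K)\<^sub>j\<close>. It is an integer so that subtraction is never truncated.\<close>

definition kh :: "int list \<Rightarrow> (nat \<Rightarrow> ('n::finite, 'k::field) mpoly) set \<Rightarrow> nat \<Rightarrow> int \<Rightarrow> int" where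
  "kh a M i j = int (fam.dim (cycles a M i j)) - int (fam.dim (boundaries a M i j))"

subsection \<open>Exactness for free modules\<close>

text \<open>In characteristic 0 the de Rham differential is a contracting homotopy up to the internal
  degree, by Cartan's formula together with Euler's formula.\<close>

definition de_rham :: "('n::finite, 'k::field) family \<Rightarrow> ('n, 'k) family" where
  "de_rham f T k = wedge partial (\<lambda>T. f T k) T"

lemma additive_partial: "additive (partial j)"
  by unfold_locales (rule partial_add)

lemma kd_de_rham:
  assumes f: "f \<in> chains a M i j"
  shows "kd (de_rham f) T k + de_rham (kd f) T k = of_int (j - a ! k) * f T k"
proof -
  have "kd (de_rham f) T k + de_rham (kd f) T k =
      (\<Sum>l\<in>-T. pvar l * partial l (f T k)) + (\<Sum>l\<in>T. partial l (pvar l * f T k))"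
    unfolding kd_def de_rham_def
    by (rule contract_wedge) (simp_all add: additive_mult additive_partial partial_pvar_mult)
  also have "(\<Sum>l\<in>T. partial l (pvar l * f T k)) = of_nat (card T) * f T k + (\<Sum>l\<in>T. pvar l * partial l (f T k))"
    by (simp add: partial_pvar_mult sum.distrib)
  also have "(\<Sum>l\<in>-T. pvar l * partial l (f T k)) + (of_nat (card T) * f T k + (\<Sum>l\<in>T. pvar l * partial l (f T k)))
      = of_nat (card T) * f T k + (\<Sum>l\<in>UNIV. pvar l * partial l (f T k))"
    using sum.union_disjoint[of "-T" T "\<lambda>l. pvar l * partial l (f T k)"] by (simp add: Compl_partition2)
  also have "\<dots> = of_nat (card T) * f T k + of_int (j - int i - a ! k) * f T k"
    using euler_formula[OF chains_homog[OF f]] by simp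
  also have "\<dots> = of_int (j - a ! k) * f T k"
  proof (cases "card T = i")
    case False
    then show ?thesis using f by (simp add: chains_def)
  qed (simp add: algebra_simps)
  finally show ?thesis .
qed

text \<open>The homotopy has to be divided by \<open>j - a ! k\<close> in coordinate \<open>k\<close>, which is why the coordinates where this
  number is zero must be assumed to vanish.\<close>

lemma free_cycle_is_boundary:
  fixes f :: "('n::finite, 'k::field_char_0) family"
  assumes f: "f \<in> cycles a (free_mod a) i j" and 0: "\<And>T k. k < length a \<Longrightarrow> j = a ! k \<Longrightarrow> f T k = 0"
  shows "f \<in> boundaries a (free_mod a) i j"
proof -
  define c :: "nat \<Rightarrow> 'k" where "c k = 1 / of_int (j - a ! k)" for k
  define g where "g = (\<lambda>T k. pconst (c k) * de_rham f T k)"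
  have fc: "f \<in> chains a (free_mod a) i j" and "kd f = 0" using f by (auto simp: cycles_def)
  then have hom: "kd (de_rham f) T k = of_int (j - a ! k) * f T k" for T k
    using kd_de_rham[OF fc, of T k] by (simp add: de_rham_def wedge_def additive.zero[OF additive_partial])
  have oob: "f T k = 0" if "\<not> k < length a" for T k
    using chains_mem[OF submodule_free_mod fc] that by (rule free_mod_nth)
  have "kd g T k = f T k" for T k
  proof -
    have "kd g T k = pconst (c k) * kd (de_rham f) T k"
      by (simp add: g_def kd_apply sum_distrib_left mult.left_commute)
    also have "\<dots> = pconst (c k * of_int (j - a ! k)) * f T k"
      by (simp only: hom pconst_simps(4) pconst_of_int mult.assoc)
    also have "\<dots> = f T k"
      using 0[of k T] oob[of k T] by (cases "j = a ! k \<or> \<not> k < length a") (auto simp: c_def pconst_simps)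
    finally show ?thesis .
  qed
  then have "kd g = f" by (simp add: fun_eq_iff)
  moreover have "g \<in> chains a (free_mod a) (Suc i) j"
  proof -
    have "g T = 0" if "card T \<noteq> Suc i" for T
    proof -
      have "f (T - {l}) = 0" if "l \<in> T" for l
      proof -
        have "card T = Suc (card (T - {l}))" using that card.remove[of T l] by auto
        then show ?thesis using fc \<open>card T \<noteq> Suc i\<close> by (auto simp: chains_def)
      qed
      then show ?thesis by (simp add: fun_eq_iff g_def de_rham_def wedge_def additive.zero[OF additive_partial])
    qed
    moreover have "g T \<in> free_mod a" for T
      using oob by (simp add: free_mod_def g_def de_rham_def wedge_def additive.zero[OF additive_partial])
    moreover have "homog (j - int (Suc i) - a ! k) (g T k)" for T k
    proof -
      have "homog (j - int (Suc i) - a ! k) (partial l (f (T - {l}) k))" for l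
        using homog_partial[OF chains_homog[OF fc, of k "T - {l}"], of l] by (simp add: algebra_simps)
      then show ?thesis
        unfolding g_def de_rham_def wedge_def by (intro homog_pconst_mult homog_sum homog_sg_mult)
    qed
    ultimately show ?thesis unfolding chains_def by (auto intro: gradeI)
  qed
  ultimately show ?thesis unfolding boundaries_def by blast
qed

lemma free_cycle_is_boundary_pos:
  fixes f :: "('n::finite, 'k::field_char_0) family"
  assumes "f \<in> cycles a (free_mod a) (Suc i) j"
  shows "f \<in> boundaries a (free_mod a) (Suc i) j"
proof (rule free_cycle_is_boundary[OF assms])
  fix T k assume "j = a ! k"
  then show "f T k = 0"
    using chains_homog[of f a "free_mod a" "Suc i" j k T] assms by (intro homog_neg) (auto simp: cycles_def)
qed

subsection \<open>Dimension shifting\<close>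

text \<open>\<open>zig b N i j\<close> consists of the free chains that are cycles modulo \<open>N\<close>, and \<open>zag b N i j\<close> of the
  trivial ones among them, so that the quotient is the homology of \<open>free_mod b / N\<close> in homological
  degree \<open>i\<close>. For \<open>i = 0\<close> the truncated difference \<open>i - 1\<close> does no harm, as the differential is zero there.\<close>

definition zig :: "int list \<Rightarrow> (nat \<Rightarrow> ('n::finite, 'k::field) mpoly) set \<Rightarrow> nat \<Rightarrow> int \<Rightarrow> ('n, 'k) family set" where
  "zig b N i j = {f \<in> chains b (free_mod b) i j. kd f \<in> chains b N (i - 1) j}"

definition zag :: "int list \<Rightarrow> (nat \<Rightarrow> ('n::finite, 'k::field) mpoly) set \<Rightarrow> nat \<Rightarrow> int \<Rightarrow> ('n, 'k) family set" where
  "zag b N i j = {u + kd g | u g. u \<in> chains b N i j \<and> g \<in> chains b (free_mod b) (Suc i) j}"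

lemma subspace_zig:
  assumes N: "submodule b N" shows "fam.subspace (zig b N i j)"
proof -
  have "fam.subspace {f. kd f \<in> chains b N (i - 1) j}"
    using module_hom.subspace_linear_preimage[OF linear_kd[THEN linear_iff_module_hom[THEN iffD1]]]
      subspace_chains[OF N] by blast
  then have "fam.subspace (chains b (free_mod b) i j \<inter> {f. kd f \<in> chains b N (i - 1) j})"
    using fam.subspace_inter subspace_chains[OF submodule_free_mod] by blast
  then show ?thesis by (simp add: zig_def Int_def)
qed

lemma fin_dim_zig: "fam.fin_dim (zig b N i j)"
  by (rule fam.fin_dim_mono[OF fin_dim_chains[OF submodule_free_mod]]) (auto simp: zig_def)

lemma subspace_boundaries: "submodule a M \<Longrightarrow> fam.subspace (boundaries a M i j)"
  unfolding boundaries_def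
  using module_hom.subspace_image[OF linear_kd[THEN linear_iff_module_hom[THEN iffD1]]] subspace_chains
  by blast

lemma subspace_zag: "submodule b N \<Longrightarrow> fam.subspace (zag b N i j)"
proof -
  assume N: "submodule b N"
  have "zag b N i j = {x + y | x y. x \<in> chains b N i j \<and> y \<in> boundaries b (free_mod b) i j}"
    unfolding zag_def boundaries_def by blast
  then show ?thesis
    using fam.subspace_sums[OF subspace_chains[OF N] subspace_boundaries[OF submodule_free_mod]] by simp
qed

lemma chains_0: "submodule a M \<Longrightarrow> 0 \<in> chains a M i j"
  using fam.subspace_0 subspace_chains by blast

lemma chains_add: "submodule a M \<Longrightarrow> f \<in> chains a M i j \<Longrightarrow> g \<in> chains a M i j \<Longrightarrow> f + g \<in> chains a M i j"
  using fam.subspace_add subspace_chains by blast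

lemma zag_subset_zig:
  assumes N: "submodule b N" shows "zag b N (Suc i) j \<subseteq> zig b N (Suc i) j"
proof
  fix f assume "f \<in> zag b N (Suc i) j"
  then obtain u g where f: "f = u + kd g" "u \<in> chains b N (Suc i) j" "g \<in> chains b (free_mod b) (Suc (Suc i)) j"
    unfolding zag_def by blast
  have "kd f \<in> chains b N i j" using kd_chains[OF N f(2)] f(1) by (simp add: kd_add)
  moreover have "f \<in> chains b (free_mod b) (Suc i) j"
    unfolding f(1) using chains_free[OF N] f kd_chains[OF submodule_free_mod f(3)]
    by (intro chains_add submodule_free_mod) auto
  ultimately show "f \<in> zig b N (Suc i) j" by (simp add: zig_def)
qed

lemma chains_subset_zag: "submodule b N \<Longrightarrow> chains b N i j \<subseteq> zag b N i j"
  unfolding zag_def using chains_0[OF submodule_free_mod] kd_zero by (smt (verit) add.right_neutral mem_Collect_eq subsetI)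

lemma boundaries_subset_zag: "submodule b N \<Longrightarrow> boundaries b (free_mod b) i j \<subseteq> zag b N i j"
  unfolding zag_def boundaries_def using chains_0 by (smt (verit) add.left_neutral image_subset_iff mem_Collect_eq)

text \<open>Being contained in the irrelevant ideal times the free module: for the kernel of a cover this is
  minimality of the cover.\<close>

definition no_const :: "(nat \<Rightarrow> ('n, 'k::zero) mpoly) set \<Rightarrow> bool" where
  "no_const N \<longleftrightarrow> (\<forall>v\<in>N. \<forall>k. Poly_Mapping.lookup (v k) 0 = 0)"

lemma no_const_cycle_is_boundary:
  fixes N :: "(nat \<Rightarrow> ('n::finite, 'k::field_char_0) mpoly) set"
  assumes N: "submodule b N" and nc: "no_const N" and z: "z \<in> cycles b N i j"
  shows "z \<in> boundaries b (free_mod b) i j"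
proof (rule free_cycle_is_boundary)
  show "z \<in> cycles b (free_mod b) i j" using z chains_free[OF N] by (auto simp: cycles_def)
  fix T k assume k: "j = b ! k"
  have zc: "z \<in> chains b N i j" using z by (simp add: cycles_def)
  show "z T k = 0"
  proof (cases "i = 0")
    case True
    then have "z T k = pconst (Poly_Mapping.lookup (z T k) 0)"
      using homog_0_pconst chains_homog[OF zc, of k T] k by auto
    then show ?thesis using nc chains_mem[OF N zc] by (simp add: no_const_def pconst_simps)
  next
    case False
    then show ?thesis using chains_homog[OF zc, of k T] k homog_neg by fastforce
  qed
qed

text \<open>The differential itself is the connecting homomorphism: it maps \<open>zig\<close> onto the cycles of \<open>N\<close>, because
  these are boundaries in the free module.\<close>

lemma kh_submodule_eq_zigzag:
  fixes N :: "(nat \<Rightarrow> ('n::finite, 'k::field_char_0) mpoly) set"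
  assumes N: "submodule b N" and nc: "no_const N"
  shows "kh b N i j = int (fam.dim (zig b N (Suc i) j)) - int (fam.dim (zag b N (Suc i) j))"
proof -
  have "kd ` zig b N (Suc i) j = cycles b N i j"
  proof (intro equalityI subsetI)
    fix z assume z: "z \<in> cycles b N i j"
    then obtain g where "g \<in> chains b (free_mod b) (Suc i) j" "kd g = z"
      using no_const_cycle_is_boundary[OF N nc] unfolding boundaries_def by blast
    then show "z \<in> kd ` zig b N (Suc i) j" using z by (auto simp: zig_def cycles_def)
  qed (auto simp: zig_def cycles_def)
  moreover have "kd ` zag b N (Suc i) j = boundaries b N i j"
  proof (intro equalityI subsetI)
    fix y assume "y \<in> kd ` zag b N (Suc i) j"
    then show "y \<in> boundaries b N i j"
      by (auto simp: zag_def boundaries_def kd_add)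
  next
    fix y assume "y \<in> boundaries b N i j"
    then show "y \<in> kd ` zag b N (Suc i) j"
      using chains_subset_zag[OF N] by (auto simp: boundaries_def)
  qed
  moreover have "f \<in> zag b N (Suc i) j" if "f \<in> zig b N (Suc i) j" "kd f = 0" for f
    using that free_cycle_is_boundary_pos[of f b i j] boundaries_subset_zag[OF N]
    by (auto simp: zig_def cycles_def)
  ultimately show ?thesis
    using fam.dim_quotient_image[OF linear_kd fin_dim_zig subspace_zig[OF N] subspace_zag[OF N] zag_subset_zig[OF N]]
    by (simp add: kh_def)
qed

subsection \<open>Homogeneous components of vectors\<close>

definition vcomp :: "int list \<Rightarrow> int \<Rightarrow> (nat \<Rightarrow> ('n::finite, 'k::comm_ring_1) mpoly) \<Rightarrow> nat \<Rightarrow> ('n, 'k) mpoly" where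
  "vcomp a t v = (\<lambda>k. if k < length a then hcomp (t - a ! k) (v k) else 0)"

lemma vcomp_grade: "vcomp a t v \<in> grade a t"
  by (simp add: vcomp_def grade_def free_mod_def homog_hcomp)

lemma vcomp_homog: "v \<in> grade a u \<Longrightarrow> vcomp a t v = (if t = u then v else 0)"
  using hcomp_homog[of "u - a ! _" "v _"]
  by (auto simp: vcomp_def grade_def free_mod_def fun_eq_iff)

lemma sum_vcomp:
  assumes v: "v \<in> free_mod b"
  shows "\<exists>A. finite A \<and> t \<in> A \<and> v = (\<Sum>u\<in>A. vcomp b u v)"
proof -
  define A where "A = insert t (\<Union>k<length b. (\<lambda>u. u + b ! k) ` degs (v k))"
  have fin: "finite A" by (simp add: A_def)
  have "v = (\<Sum>u\<in>A. vcomp b u v)"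
  proof
    fix k
    show "v k = (\<Sum>u\<in>A. vcomp b u v) k"
    proof (cases "k < length b")
      case True
      have "(\<Sum>u\<in>A. vcomp b u v) k = (\<Sum>u\<in>A. hcomp (u - b ! k) (v k))"
        using True by (simp add: sum_fun_apply vcomp_def)
      also have "\<dots> = (\<Sum>u\<in>(\<lambda>u. u - b ! k) ` A. hcomp u (v k))"
        by (subst sum.reindex) (auto simp: inj_on_def)
      also have "\<dots> = v k"
      proof (rule sum_hcomp)
        show "degs (v k) \<subseteq> (\<lambda>u. u - b ! k) ` A"
        proof
          fix u assume "u \<in> degs (v k)"
          then have "u + b ! k \<in> A" using True by (auto simp: A_def)
          then show "u \<in> (\<lambda>u. u - b ! k) ` A" by (metis add_diff_cancel_right' image_eqI)
        qed
      qed (use fin in simp)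
      finally show ?thesis by simp
    qed (use v in \<open>simp add: sum_fun_apply vcomp_def free_mod_def\<close>)
  qed
  moreover have "t \<in> A" by (simp add: A_def)
  ultimately show ?thesis using fin by blast
qed

subsection \<open>Graded homomorphisms\<close>

locale graded_map =
  fixes b a :: "int list" and \<phi> :: "(nat \<Rightarrow> ('n::finite, 'k::field_char_0) mpoly) \<Rightarrow> (nat \<Rightarrow> ('n, 'k) mpoly)"
  assumes hom: "graded_hom b a \<phi>"
begin

definition im :: "(nat \<Rightarrow> ('n, 'k) mpoly) set" where "im = \<phi> ` free_mod b"

definition ker :: "(nat \<Rightarrow> ('n, 'k) mpoly) set" where "ker = {v \<in> free_mod b. \<phi> v = (\<lambda>_. 0)}"

lemma map_free: "v \<in> free_mod b \<Longrightarrow> \<phi> v \<in> free_mod a"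
  and map_add: "v \<in> free_mod b \<Longrightarrow> w \<in> free_mod b \<Longrightarrow> \<phi> (v + w) = \<phi> v + \<phi> w"
  and map_smult: "v \<in> free_mod b \<Longrightarrow> \<phi> (smult p v) = smult p (\<phi> v)"
  and map_grade: "v \<in> grade b t \<Longrightarrow> \<phi> v \<in> grade a t"
  using hom unfolding graded_hom_def smult_def plus_fun_def by blast+

lemma map_0: "\<phi> 0 = 0"
proof -
  have "\<phi> (smult 0 0) = smult 0 (\<phi> 0)" by (rule map_smult) (simp add: free_mod_def)
  also have "\<dots> = 0" by (simp add: fun_eq_iff)
  finally show ?thesis by simp
qed

lemma map_sum:
  "(\<And>i. i \<in> I \<Longrightarrow> f i \<in> free_mod b) \<Longrightarrow> \<phi> (sum f I) = (\<Sum>i\<in>I. \<phi> (f i))"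
  by (induction I rule: infinite_finite_induct)
     (simp_all add: map_0 map_add submodule_sum[OF submodule_free_mod])

lemma mem_ker: "v \<in> ker \<longleftrightarrow> v \<in> free_mod b \<and> \<phi> v = 0"
  by (simp add: ker_def zero_fun_def)

lemma submodule_im: "submodule a im"
proof -
  have "0 \<in> im" unfolding im_def using map_0 submoduleD(2)[OF submodule_free_mod] by (metis imageI)
  moreover have "\<phi> v + \<phi> w \<in> im" if "v \<in> free_mod b" "w \<in> free_mod b" for v w
    unfolding im_def using that map_add submoduleD(3)[OF submodule_free_mod] by (metis imageI)
  moreover have "smult p (\<phi> v) \<in> im" if "v \<in> free_mod b" for p v
    unfolding im_def using that map_smult submoduleD(4)[OF submodule_free_mod] by (metis imageI)
  ultimately show ?thesis
    unfolding submodule_def using map_free by (auto simp: im_def)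
qed

lemma submodule_ker: "submodule b ker"
  unfolding submodule_def using submoduleD[OF submodule_free_mod]
  by (auto simp: mem_ker map_add map_smult map_0)

lemma map_vcomp:
  assumes v: "v \<in> free_mod b"
  shows "\<phi> (vcomp b t v) = vcomp a t (\<phi> v)"
proof
  fix k
  obtain A where A: "finite A" "t \<in> A" "v = (\<Sum>u\<in>A. vcomp b u v)"
    using sum_vcomp[OF v] by metis
  have m: "\<phi> v = (\<Sum>u\<in>A. \<phi> (vcomp b u v))"
    by (subst A(3), rule map_sum) (use vcomp_grade grade_subset in blast)
  have "vcomp a t (\<phi> v) k = (\<Sum>u\<in>A. vcomp a t (\<phi> (vcomp b u v)) k)"
    by (subst m) (simp add: vcomp_def sum_fun_apply hcomp_sum)
  also have "\<dots> = (\<Sum>u\<in>A. if u = t then \<phi> (vcomp b t v) k else 0)"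
  proof (rule sum.cong[OF refl])
    fix u
    have "\<phi> (vcomp b u v) \<in> grade a u" using map_grade vcomp_grade by blast
    then show "vcomp a t (\<phi> (vcomp b u v)) k = (if u = t then \<phi> (vcomp b t v) k else 0)"
      by (auto simp: vcomp_homog)
  qed
  also have "\<dots> = \<phi> (vcomp b t v) k" using A by simp
  finally show "\<phi> (vcomp b t v) k = vcomp a t (\<phi> v) k" by simp
qed

text \<open>Take the component of the right degree of any preimage.\<close>

lemma grade_im:
  assumes "m \<in> im" "m \<in> grade a t"
  shows "\<exists>v\<in>grade b t. \<phi> v = m"
proof -
  obtain v where v: "v \<in> free_mod b" "m = \<phi> v" using assms(1) im_def by auto
  have "\<phi> (vcomp b t v) = m" using map_vcomp[OF v(1)] vcomp_homog[OF assms(2)] v(2) by simp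
  then show ?thesis using vcomp_grade by blast
qed

text \<open>\<open>\<phi>\<close> applied to each member of a family, made linear on all families by cutting off the
  coordinates that do not belong to \<open>free_mod b\<close>.\<close>

definition cut :: "(nat \<Rightarrow> ('n, 'k) mpoly) \<Rightarrow> nat \<Rightarrow> ('n, 'k) mpoly" where
  "cut v = (\<lambda>k. if k < length b then v k else 0)"

definition lift :: "('n, 'k) family \<Rightarrow> ('n, 'k) family" where
  "lift f = (\<lambda>T. \<phi> (cut (f T)))"

lemma cut_free: "cut v \<in> free_mod b"
  by (simp add: cut_def free_mod_def)

lemma cut_id: "v \<in> free_mod b \<Longrightarrow> cut v = v"
  by (auto simp: cut_def free_mod_def)

lemma lift_apply: "f T \<in> free_mod b \<Longrightarrow> lift f T = \<phi> (f T)"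
  by (simp add: lift_def cut_id)

lemma linear_lift: "Vector_Spaces.linear scl scl lift"
proof -
  have "cut (v + w) = cut v + cut w" "cut (smult p v) = smult p (cut v)" for v w p
    by (auto simp: cut_def)
  then have "lift (f + g) = lift f + lift g" "lift (scl c f) = scl c (lift f)" for f g c
    by (auto simp: lift_def scl_smult map_add map_smult cut_free)
  then show ?thesis unfolding Vector_Spaces.linear_iff by (simp add: fam.vector_space_axioms)
qed

lemma lift_add: "lift (f + g) = lift f + lift g"
  using module_hom.add[OF linear_lift[THEN linear_iff_module_hom[THEN iffD1]]] .

lemma kd_lift:
  assumes f: "f \<in> chains b (free_mod b) i j"
  shows "kd (lift f) = lift (kd f)"
proof
  fix T
  have fr: "f T \<in> free_mod b" for T using chains_mem[OF submodule_free_mod f] .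
  have fr': "smult p (f T) \<in> free_mod b" for T p using submoduleD(4)[OF submodule_free_mod fr] .
  have "kd f T \<in> free_mod b" unfolding kd_sum by (intro submodule_sum[OF submodule_free_mod] fr')
  then show "kd (lift f) T = lift (kd f) T"
    by (simp add: lift_apply kd_sum fr map_sum fr' map_smult)
qed

lemma lift_chains:
  assumes f: "f \<in> chains b (free_mod b) i j"
  shows "lift f \<in> chains a im i j"
proof -
  have "lift f T = \<phi> (f T)" "f T \<in> free_mod b" for T
    using chains_mem[OF submodule_free_mod f] lift_apply by auto
  then show ?thesis using f map_grade by (auto simp: chains_def im_def map_0)
qed

lemma lift_surj:
  assumes z: "z \<in> chains a im i j"
  shows "\<exists>f\<in>chains b (free_mod b) i j. lift f = z"
proof -
  have "\<exists>v. (if card T = i then v \<in> grade b (j - int i) else v = 0) \<and> \<phi> v = z T" for T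
    using z grade_im[of "z T" "j - int i"] map_0 by (auto simp: chains_def)
  then obtain f where f: "\<And>T. if card T = i then f T \<in> grade b (j - int i) else f T = 0" "\<And>T. \<phi> (f T) = z T"
    by metis
  have "f \<in> chains b (free_mod b) i j" using f(1) grade_subset unfolding chains_def
    by (smt (verit, best) Int_iff mem_Collect_eq subsetD)
  moreover have "lift f = z"
  proof
    show "lift f T = z T" for T
      using lift_apply[of f T] f(2) chains_mem[OF submodule_free_mod calculation] by simp
  qed
  ultimately show ?thesis by blast
qed

lemma lift_eq_0_iff:
  assumes f: "f \<in> chains b (free_mod b) i j"
  shows "lift f = 0 \<longleftrightarrow> f \<in> chains b ker i j"
proof -
  have fr: "f T \<in> free_mod b" for T using chains_mem[OF submodule_free_mod f] .
  have "lift f = 0 \<longleftrightarrow> (\<forall>T. f T \<in> ker)" by (auto simp: fun_eq_iff[of "lift f"] lift_apply fr mem_ker)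
  also have "\<dots> \<longleftrightarrow> f \<in> chains b ker i j"
    using f submoduleD(2)[OF submodule_ker] chains_mem[OF submodule_ker, of f i j] by (auto simp: chains_def)
  finally show ?thesis .
qed

text \<open>The image is \<open>free_mod b\<close> modulo the kernel, and \<open>lift\<close> carries out this identification on chains.\<close>

lemma kh_im_Suc:
  "kh a im (Suc i) j = int (fam.dim (zig b ker (Suc i) j)) - int (fam.dim (zag b ker (Suc i) j))"
proof -
  have zigD: "f \<in> chains b (free_mod b) (Suc i) j" "kd f \<in> chains b ker i j" if "f \<in> zig b ker (Suc i) j" for f
    using that by (simp_all add: zig_def)
  have kdf: "kd f \<in> chains b (free_mod b) i j" if "f \<in> chains b (free_mod b) (Suc i) j" for f i
    using kd_chains[OF submodule_free_mod that] .
  have "lift ` zig b ker (Suc i) j = cycles a im (Suc i) j"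
  proof (intro equalityI subsetI)
    fix y assume "y \<in> lift ` zig b ker (Suc i) j"
    then show "y \<in> cycles a im (Suc i) j"
      using zigD lift_chains kd_lift lift_eq_0_iff kdf by (fastforce simp: cycles_def)
  next
    fix z assume "z \<in> cycles a im (Suc i) j"
    then obtain f where f: "f \<in> chains b (free_mod b) (Suc i) j" "z = lift f" "kd (lift f) = 0"
      using lift_surj unfolding cycles_def by blast
    then have "f \<in> zig b ker (Suc i) j"
      using kd_lift[OF f(1)] lift_eq_0_iff[OF kdf[OF f(1)]] by (simp add: zig_def)
    then show "z \<in> lift ` zig b ker (Suc i) j" using f by blast
  qed
  moreover have "lift ` zag b ker (Suc i) j = boundaries a im (Suc i) j"
  proof (intro equalityI subsetI)
    fix y assume "y \<in> lift ` zag b ker (Suc i) j"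
    then obtain u g where y: "y = lift (u + kd g)" "u \<in> chains b ker (Suc i) j"
      "g \<in> chains b (free_mod b) (Suc (Suc i)) j" by (auto simp: zag_def)
    have "lift u = 0" using y(2) chains_free[OF submodule_ker] lift_eq_0_iff by blast
    then have "y = kd (lift g)" using y kd_lift by (simp add: lift_add)
    then show "y \<in> boundaries a im (Suc i) j" using lift_chains[OF y(3)] by (simp add: boundaries_def)
  next
    fix y assume "y \<in> boundaries a im (Suc i) j"
    then obtain g where "y = kd (lift g)" and g: "g \<in> chains b (free_mod b) (Suc (Suc i)) j"
      using lift_surj unfolding boundaries_def by blast
    then have "y = lift (kd g)" using kd_lift by simp
    moreover have "kd g \<in> zag b ker (Suc i) j"
      using boundaries_subset_zag[OF submodule_ker] g by (auto simp: boundaries_def)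
    ultimately show "y \<in> lift ` zag b ker (Suc i) j" by blast
  qed
  moreover have "f \<in> zag b ker (Suc i) j" if "f \<in> zig b ker (Suc i) j" "lift f = 0" for f
    using that zigD lift_eq_0_iff chains_subset_zag[OF submodule_ker] by blast
  ultimately show ?thesis
    using fam.dim_quotient_image[OF linear_lift fin_dim_zig subspace_zig[OF submodule_ker]
        subspace_zag[OF submodule_ker] zag_subset_zig[OF submodule_ker]]
    by (simp add: kh_def)
qed

text \<open>Both sides are the homology of the same zigzag. This replaces the long exact sequence of Tor for
  \<open>0 \<rightarrow> ker \<rightarrow> free_mod b \<rightarrow> im \<rightarrow> 0\<close>.\<close>

lemma kh_shift:
  assumes "no_const ker"
  shows "kh a im (Suc i) j = kh b ker i j"
  using kh_im_Suc kh_submodule_eq_zigzag[OF submodule_ker assms] by simp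

text \<open>In homological degree 0 the homology counts minimal generators, and the basis of
  \<open>free_mod b\<close> maps to such generators.\<close>

lemma kh_im_0:
  assumes nc: "no_const ker"
  shows "kh a im 0 j = int (count (mset b) j)"
proof -
  let ?V = "chains b (free_mod b) 0 j :: ('n, 'k) family set"
    and ?B = "boundaries b (free_mod b) 0 j :: ('n, 'k) family set"
  have sub: "?B \<subseteq> ?V" using kd_chains[OF submodule_free_mod] by (auto simp: boundaries_def)
  have "lift ` ?V = cycles a im 0 j"
    using lift_surj lift_chains kd_chains_0 by (fastforce simp: cycles_def)
  moreover have "lift ` ?B = boundaries a im 0 j"
  proof (intro equalityI subsetI)
    fix y assume "y \<in> lift ` ?B"
    then obtain g where "y = lift (kd g)" and g: "g \<in> chains b (free_mod b) (Suc 0) j"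
      by (auto simp: boundaries_def)
    then show "y \<in> boundaries a im 0 j" using lift_chains[OF g] kd_lift[OF g] unfolding boundaries_def by (metis imageI)
  next
    fix y assume "y \<in> boundaries a im 0 j"
    then obtain g where "y = kd (lift g)" and g: "g \<in> chains b (free_mod b) (Suc 0) j"
      using lift_surj unfolding boundaries_def by blast
    then show "y \<in> lift ` ?B" using kd_lift[OF g] by (auto simp: boundaries_def)
  qed
  moreover have "f \<in> ?B" if "f \<in> ?V" "lift f = 0" for f
  proof -
    have "f \<in> cycles b ker 0 j"
      using that lift_eq_0_iff[OF that(1)] kd_chains_0[OF that(1)] by (simp add: cycles_def)
    then show ?thesis by (rule no_const_cycle_is_boundary[OF submodule_ker nc])
  qed
  ultimately have "kh a im 0 j = int (fam.dim ?V) - int (fam.dim ?B)"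
    using fam.dim_quotient_image[OF linear_lift fin_dim_chains[OF submodule_free_mod]
        subspace_chains[OF submodule_free_mod] subspace_boundaries[OF submodule_free_mod] sub]
    by (simp add: kh_def)
  also have "fam.dim ?V = fam.dim ?B + count (mset b) j"
  proof -
    let ?I = "{k. k < length b \<and> b ! k = j}"
    define l where "l k f = Poly_Mapping.lookup (f {} k) 0" for k and f :: "('n, 'k) family"
    define e :: "nat \<Rightarrow> ('n, 'k) family" where "e k = (\<lambda>T k'. if T = {} \<and> k' = k then 1 else 0)" for k
    have "homog 0 (1 :: ('n, 'k) mpoly)" using homog_pconst[of 1] by (simp add: pconst_simps)
    then have e: "e k \<in> ?V" if "k \<in> ?I" for k
      using that by (auto simp: chains_def grade_def free_mod_def e_def card_eq_0_iff)
    have "?B = {f \<in> ?V. \<forall>k\<in>?I. l k f = 0}"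
    proof (intro equalityI subsetI)
      fix y assume y: "y \<in> ?B"
      then obtain g where "y = kd g" by (auto simp: boundaries_def)
      then have "l k y = 0" for k
        by (cases "\<exists>j. True") (auto simp: l_def kd_apply lookup_sum mult.left_commute[of "sg _ _"] lookup_pvar_mult)
      then show "y \<in> {f \<in> ?V. \<forall>k\<in>?I. l k f = 0}" using y sub by auto
    next
      fix f assume f: "f \<in> {f \<in> ?V. \<forall>k\<in>?I. l k f = 0}"
      show "f \<in> ?B"
      proof (rule free_cycle_is_boundary)
        show "f \<in> cycles b (free_mod b) 0 j" using f kd_chains_0 by (auto simp: cycles_def)
        fix T k assume k: "k < length b" "j = b ! k"
        show "f T k = 0"
        proof (cases "T = {}")
          case True
          have "homog 0 (f {} k)" using f chains_homog[of f b "free_mod b" 0 j k "{}"] k by auto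
          from homog_0_pconst[OF this] show ?thesis using True f k by (simp add: l_def pconst_simps)
        qed (use f in \<open>auto simp: chains_def card_eq_0_iff\<close>)
      qed
    qed
    moreover have "fam.dim ?V = fam.dim {f \<in> ?V. \<forall>k\<in>?I. l k f = 0} + card ?I"
    proof (rule fam.dim_dual_functionals[OF fin_dim_chains[OF submodule_free_mod] subspace_chains[OF submodule_free_mod], where v = e])
      show "fam.functional (l k)" for k
        by (simp add: fam.functional_def l_def lookup_add lookup_pconst_mult)
      show "l k (e k') = (if k = k' then 1 else 0)" for k k'
        by (simp add: l_def e_def)
    qed (use e in auto)
    moreover have "count (mset b) j = card ?I"
      unfolding count_mset count_list_eq_length_filter length_filter_conv_card
      by (rule arg_cong[where f = card]) auto
    ultimately show ?thesis by (simp only:)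
  qed
  finally show ?thesis by linarith
qed

end

section \<open>Minimal graded free resolutions\<close>

subsection \<open>Graded Betti numbers are Koszul homology\<close>

text \<open>Syzygies of \<open>R/I\<close> start with \<open>I\<close>, seen as a submodule of \<open>R\<close>. So homological degree \<open>i\<close> for \<open>I\<close> is
  homological degree \<open>i + 1\<close> for \<open>R/I\<close>.\<close>

definition as_submodule :: "('n::finite, 'k::comm_ring_1) mpoly set \<Rightarrow> (nat \<Rightarrow> ('n, 'k) mpoly) set" where
  "as_submodule I = {v \<in> free_mod [0]. v 0 \<in> I}"

text \<open>Shift from each syzygy module to the next until homological degree 0 is reached, where the homology
  counts the generators.\<close>

theorem betti_eq_kh:
  fixes I :: "('n::finite, 'k::field_char_0) mpoly set"
  assumes res: "min_graded_free_res I F \<phi>"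
  shows "int (count (mset (F (Suc i))) j) = kh [0] (as_submodule I) i j"
proof -
  define M where "M k = \<phi> k ` free_mod (F (Suc k))" for k
  have gm: "graded_map (F (Suc k)) (F k) (\<phi> k)" for k
    using res by (simp add: min_graded_free_res_def graded_map_def)
  have im: "graded_map.im (F (Suc k)) (\<phi> k) = M k" for k
    using graded_map.im_def[OF gm] by (simp add: M_def)
  have ker: "graded_map.ker (F (Suc k)) (\<phi> k) = M (Suc k)" for k
    using graded_map.ker_def[OF gm] res by (simp add: M_def min_graded_free_res_def)
  have nc: "no_const (M (Suc k))" for k
  proof -
    have "Poly_Mapping.lookup (\<phi> (Suc k) v l) 0 = 0" if v: "v \<in> free_mod (F (Suc (Suc k)))" for v l
    proof (cases "l < length (F (Suc k))")
      case True
      then show ?thesis using res v by (simp add: min_graded_free_res_def)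
    next
      case False
      then show ?thesis
        using graded_map.map_free[OF gm v] free_mod_nth by fastforce
    qed
    then show ?thesis by (auto simp: no_const_def M_def)
  qed
  have "kh (F k) (M k) i j = int (count (mset (F (Suc (k + i)))) j)" for k
  proof (induction i arbitrary: k)
    case 0
    show ?case using graded_map.kh_im_0[OF gm, of k] nc[of k] by (simp add: im ker)
  next
    case (Suc i)
    have "kh (F k) (M k) (Suc i) j = kh (F (Suc k)) (M (Suc k)) i j"
      using graded_map.kh_shift[OF gm, of k] nc[of k] by (simp add: im ker)
    then show ?case using Suc[of "Suc k"] by simp
  qed
  from this[of 0] show ?thesis
    using res by (simp add: min_graded_free_res_def M_def as_submodule_def)
qed

subsection \<open>Existence\<close>

definition graded_submodule :: "int list \<Rightarrow> (nat \<Rightarrow> ('n::finite, 'k::comm_ring_1) mpoly) set \<Rightarrow> bool" where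
  "graded_submodule a M \<longleftrightarrow> submodule a M \<and> (\<forall>v\<in>M. \<forall>t. vcomp a t v \<in> M)"

text \<open>The chain of homological degree 0 that is given by the vector \<open>v\<close>.\<close>

definition at_empty :: "(nat \<Rightarrow> ('n, 'k::zero) mpoly) \<Rightarrow> ('n, 'k) family" where
  "at_empty v = (\<lambda>T. if T = {} then v else (\<lambda>_. 0))"

lemma at_empty_chains: "submodule a M \<Longrightarrow> at_empty v \<in> chains a M 0 j \<longleftrightarrow> v \<in> M \<inter> grade a j"
  by (auto simp: at_empty_def chains_def zero_fun_def card_eq_0_iff)

lemma chains_0_at_empty: "f \<in> chains a M 0 j \<Longrightarrow> f = at_empty (f {})"
  by (auto simp: at_empty_def chains_def zero_fun_def fun_eq_iff card_eq_0_iff)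

lemma at_empty_add: "at_empty (v + w) = at_empty v + at_empty w"
  by (auto simp: at_empty_def fun_eq_iff)

lemma at_empty_0: "at_empty 0 = 0"
  by (auto simp: at_empty_def fun_eq_iff)

lemma at_empty_sum: "at_empty (sum f I) = (\<Sum>i\<in>I. at_empty (f i))"
proof (intro ext)
  show "at_empty (sum f I) T k = (\<Sum>i\<in>I. at_empty (f i)) T k" for T k
    by (simp add: sum_fun_apply at_empty_def)
qed

lemma at_empty_scl: "at_empty (smult (pconst c) v) = scl c (at_empty v)"
  by (auto simp: at_empty_def fun_eq_iff)

lemma sg_empty [simp]: "sg l {} = 1"
  by (simp add: sg_def)

text \<open>By Euler's formula a form of nonzero degree is a combination of the variables, so that it
  multiplies \<open>M\<close> into the boundaries.\<close>

lemma smult_in_boundaries: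
  fixes M :: "(nat \<Rightarrow> ('n::finite, 'k::field_char_0) mpoly) set"
  assumes M: "submodule a M" and p: "homog e p" "e \<noteq> 0" and g: "g \<in> M" "g \<in> grade a t"
  shows "at_empty (smult p g) \<in> boundaries a M 0 (e + t)"
proof -
  define q where "q l = pconst (1 / of_int e) * partial l p" for l
  define h where "h T = (if card T = 1 then smult (q (the_elem T)) g else 0)" for T :: "'n set"
  have qh: "homog (e - 1) (q l)" for l
    unfolding q_def by (intro homog_pconst_mult homog_partial p)
  have "smult (q l) g \<in> M \<inter> grade a (e - 1 + t)" for l
    using submoduleD(4)[OF M g(1)] grade_smult[OF qh g(2)] by blast
  then have "h \<in> chains a M (Suc 0) (e + t)"
    by (auto simp: chains_def h_def algebra_simps)
  moreover have "kd h = at_empty (smult p g)"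
  proof (intro ext)
    fix T k
    show "kd h T k = at_empty (smult p g) T k"
    proof (cases "T = {}")
      case True
      have "kd h {} k = (\<Sum>l\<in>UNIV. pvar l * q l) * g k"
        by (simp add: kd_apply h_def sum_distrib_right mult.assoc)
      also have "(\<Sum>l\<in>UNIV. pvar l * q l) = pconst (1 / of_int e) * (\<Sum>l\<in>UNIV. pvar l * partial l p)"
        by (simp add: q_def sum_distrib_left mult.left_commute)
      also have "\<dots> = pconst (1 / of_int e * of_int e) * p"
        unfolding euler_formula[OF p(1)] by (simp only: pconst_simps(4) pconst_of_int mult.assoc)
      finally show ?thesis using True p(2) by (simp add: at_empty_def pconst_simps)
    next
      case False
      have "h (insert l T) k = 0" if "l \<in> - T" for l
        using that False by (auto simp: h_def card_eq_0_iff)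
      then show ?thesis using False by (simp add: kd_apply at_empty_def)
    qed
  qed
  ultimately show ?thesis unfolding boundaries_def by (metis imageI)
qed

lemma grade_below:
  assumes "v \<in> grade a t" "\<And>k. k < length a \<Longrightarrow> t < a ! k"
  shows "v = 0"
proof
  fix k
  show "v k = 0 k"
    using grade_nth[OF assms(1), of k] assms homog_neg[of "t - a ! k" "v k"]
    by (cases "k < length a") (auto simp: grade_def free_mod_def)
qed

text \<open>Graded Nakayama: lifts of a basis of \<open>M / \<mm> M\<close> generate \<open>M\<close>, and a relation between them has
  no constant coefficients. The vanishing of the homology makes the basis finite.\<close>

lemma exists_minimal_cover:
  fixes M :: "(nat \<Rightarrow> ('n::finite, 'k::field_char_0) mpoly) set"
  assumes M: "graded_submodule a M" and N: "\<And>j. j > N \<Longrightarrow> kh a M 0 j = 0"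
  shows "\<exists>b \<phi>. graded_hom b a \<phi> \<and> \<phi> ` free_mod b = M \<and> no_const {v \<in> free_mod b. \<phi> v = (\<lambda>_. 0)}"
proof -
  have sM: "submodule a M" and gM: "\<And>v t. v \<in> M \<Longrightarrow> vcomp a t v \<in> M"
    using M by (auto simp: graded_submodule_def)
  define lo where "lo = Min (insert 0 (set a))"
  have lo: "lo \<le> a ! k" if "k < length a" for k
    unfolding lo_def using that by (intro Min_le) auto
  let ?C = "chains a M 0" and ?D = "boundaries a M 0"
  have cyc: "cycles a M 0 j = ?C j" for j using kd_chains_0 by (auto simp: cycles_def)
  have DC: "?D j \<subseteq> ?C j" for j using kd_chains[OF sM] by (auto simp: boundaries_def)
  have fdC: "fam.fin_dim (?C j)" and sC: "fam.subspace (?C j)" and sD: "fam.subspace (?D j)" for j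
    using fin_dim_chains[OF sM] subspace_chains[OF sM] subspace_boundaries[OF sM] by blast+
  have "\<exists>A B. A \<subseteq> B \<and> fam.independent B \<and> fam.span A = ?D j \<and> fam.span B = ?C j \<and> finite B
      \<and> (j > N \<longrightarrow> A = B)" for j
  proof -
    obtain A where A: "A \<subseteq> ?D j" "fam.independent A" "fam.span A = ?D j" "card A = fam.dim (?D j)"
      by (rule fam.finite_basis[OF fam.fin_dim_mono[OF fdC DC] sD])
    obtain B where B: "A \<subseteq> B" "fam.independent B" "fam.span B = ?C j" "finite B" "card B = fam.dim (?C j)"
      by (rule fam.extend_to_basis[OF fdC sC, of A]) (use A DC[of j] in auto)
    have "A = B" if "j > N"
      using N[OF that] A(4) B card_subset_eq[of B A] by (simp add: kh_def cyc)
    then show ?thesis using A B by blast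
  qed
  then obtain A B where AB: "\<And>j. A j \<subseteq> B j" "\<And>j. fam.independent (B j)" "\<And>j. fam.span (A j) = ?D j"
    "\<And>j. fam.span (B j) = ?C j" "\<And>j. finite (B j)" "\<And>j. j > N \<Longrightarrow> A j = B j"
    by metis
  have low: "?C j = {0}" if "j < lo" for j
  proof -
    have "f = 0" if f: "f \<in> ?C j" for f
    proof
      fix T
      show "f T = 0 T"
        using f grade_below[of "f T" a j] lo \<open>j < lo\<close> by (cases "card T = 0") (force simp: chains_def)+
    qed
    then show ?thesis using chains_0[OF sM] by blast
  qed
  have lowB: "B j - A j = {}" if "j < lo" for j
  proof -
    have "B j \<subseteq> {0}" using fam.span_superset[of "B j"] unfolding AB(4) low[OF that] .
    moreover have "0 \<notin> B j" using fam.dependent_zero AB(2)[of j] by blast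
    ultimately show ?thesis by blast
  qed
  define G where "G = (SIGMA j:{lo..N}. B j - A j)"
  have finG: "finite G" unfolding G_def using AB(5) by auto
  then obtain gl where gl: "set gl = G" "distinct gl" using finite_distinct_list by blast
  have memG: "(j, f) \<in> G \<longleftrightarrow> f \<in> B j - A j" for j f
    using lowB[of j] AB(6)[of j] by (cases "j < lo"; cases "N < j") (auto simp: G_def)
  define b where "b = map fst gl"
  define g where "g k = snd (gl ! k)" for k
  have lenb: "length b = length gl" by (simp add: b_def)
  have gk: "g k \<in> B (b ! k) - A (b ! k)" if "k < length b" for k
    using that memG[of "b ! k" "g k"] nth_mem[of k gl] gl(1) by (simp add: lenb b_def g_def)
  then have gC: "g k \<in> ?C (b ! k)" if "k < length b" for k
    using that AB(4) fam.span_superset by blast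
  then have gM: "g k {} \<in> M" "g k {} \<in> grade a (b ! k)" if "k < length b" for k
    using that by (auto simp: chains_def)
  define \<phi> where "\<phi> v = (\<Sum>k<length b. smult (v k) (g k {}))" for v :: "nat \<Rightarrow> ('n, 'k) mpoly"
  have \<phi>_apply: "\<phi> v l = (\<Sum>k<length b. v k * g k {} l)" for v l
    by (simp add: \<phi>_def sum_fun_apply)
  have \<phi>M: "\<phi> v \<in> M" for v
    unfolding \<phi>_def using gM by (intro submodule_sum[OF sM] submoduleD(4)[OF sM]) auto
  have \<phi>_grade: "\<phi> v \<in> grade a t" if "v \<in> grade b t" for v t
    unfolding \<phi>_def
  proof (rule grade_sum)
    fix k assume "k \<in> {..<length b}"
    then show "smult (v k) (g k {}) \<in> grade a t"
      using grade_smult[OF grade_nth[OF that] gM(2), of k k] by simp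
  qed
  have hom: "graded_hom b a \<phi>"
    unfolding graded_hom_def
  proof (intro conjI ballI allI)
    show "\<phi> v \<in> free_mod a" for v using \<phi>M submoduleD(1)[OF sM] by blast
  qed (auto simp: \<phi>_grade \<phi>_apply fun_eq_iff distrib_right sum.distrib sum_distrib_left mult.assoc)
  then interpret \<phi>: graded_map b a \<phi> by unfold_locales
  have unit: "\<exists>v\<in>free_mod b. \<phi> v = g k {}" if k: "k < length b" for k
  proof
    show "(\<lambda>i. if i = k then 1 else 0) \<in> free_mod b" using k by (auto simp: free_mod_def)
    show "\<phi> (\<lambda>i. if i = k then 1 else 0) = g k {}"
      using k by (auto simp: fun_eq_iff \<phi>_apply if_distrib[of "\<lambda>x. x * _"] cong: if_cong)
  qed
  \<comment> \<open>Modulo the chosen generators a vector of degree \<open>t\<close> is a boundary, which is a combination of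
    vectors of degree \<open>t - 1\<close>; below \<open>lo\<close> there is nothing.\<close>
  have gen: "v \<in> \<phi>.im" if "v \<in> M" "v \<in> grade a t" for v t
    using that
  proof (induction "nat (t - lo)" arbitrary: v t rule: less_induct)
    case less
    show ?case
    proof (cases "t < lo")
      case True
      then have "v = 0" using grade_below[OF less.prems(2)] lo by force
      then show ?thesis using submoduleD(2)[OF \<phi>.submodule_im] by simp
    next
      case False
      have "at_empty v \<in> ?C t" using less.prems at_empty_chains[OF sM] by blast
      then have "at_empty v \<in> fam.span (A t \<union> (B t - A t))" using AB(1,4)[of t] by (simp add: Un_absorb1)
      then obtain x y where xy: "at_empty v = x + y" "x \<in> ?D t" "y \<in> fam.span (B t - A t)"
        unfolding fam.span_Un AB(3) by blast
      obtain h where h: "x = kd h" "h \<in> chains a M (Suc 0) t" using xy(2) by (auto simp: boundaries_def)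
      have "h {l} \<in> \<phi>.im" for l
      proof -
        have hl: "h {l} \<in> M \<inter> grade a (t - 1)" using h(2) by (simp add: chains_def)
        show ?thesis
        proof (cases "t - 1 < lo")
          case True
          then have "h {l} = 0" using grade_below[of "h {l}" a "t - 1"] hl lo by force
          then show ?thesis using submoduleD(2)[OF \<phi>.submodule_im] by simp
        next
          case False
          then show ?thesis using less.hyps[of "t - 1" "h {l}"] hl by auto
        qed
      qed
      then have x: "x {} \<in> \<phi>.im"
        unfolding h(1) kd_sum by (intro submodule_sum[OF \<phi>.submodule_im] submoduleD(4)[OF \<phi>.submodule_im])
      have "y {} \<in> \<phi>.im"
        using xy(3)
      proof (induction rule: fam.span_induct_alt)
        case base
        then show ?case using submoduleD(2)[OF \<phi>.submodule_im] by (simp add: zero_fun_def)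
      next
        case (step c f z)
        then have "(t, f) \<in> set gl" using memG gl(1) by simp
        then obtain k where "k < length b" "g k = f" by (metis in_set_conv_nth lenb g_def snd_conv)
        then have "f {} \<in> \<phi>.im" using unit \<phi>.im_def by (metis imageI)
        moreover have "(scl c f + z) {} = smult (pconst c) (f {}) + z {}" by (simp add: fun_eq_iff)
        ultimately show ?case using step.IH submoduleD(3,4)[OF \<phi>.submodule_im] by metis
      qed
      moreover have "v = x {} + y {}" using fun_cong[OF xy(1), of "{}"] by (simp add: at_empty_def)
      ultimately show ?thesis using x submoduleD(3)[OF \<phi>.submodule_im] by simp
    qed
  qed
  have "M \<subseteq> \<phi>.im"
  proof
    fix v assume v: "v \<in> M"
    then obtain S where S: "finite S" "v = (\<Sum>u\<in>S. vcomp a u v)"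
      using sum_vcomp[of v a] submoduleD(1)[OF sM] by blast
    have "vcomp a u v \<in> \<phi>.im" for u using gen vcomp_grade M v by (metis graded_submodule_def)
    then show "v \<in> \<phi>.im" using submodule_sum[OF \<phi>.submodule_im] S(2) by metis
  qed
  then have im: "\<phi> ` free_mod b = M" using \<phi>M unfolding \<phi>.im_def by blast
  \<comment> \<open>A relation splits into its part with constant coefficients, in the degree of the \<open>l\<close>-th generator,
    and a boundary. As the generators are independent modulo boundaries, the constants are zero.\<close>
  have "Poly_Mapping.lookup (v l) 0 = 0" if v: "v \<in> \<phi>.ker" for v l
  proof (cases "l < length b")
    case False
    then show ?thesis using v by (simp add: \<phi>.mem_ker free_mod_def)
  next
    case l: True
    define t where "t = b ! l"
    define w where "w = vcomp b t v"
    have wg: "w \<in> grade b t" unfolding w_def by (rule vcomp_grade)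
    have "\<phi> w = 0"
      unfolding w_def using \<phi>.map_vcomp v by (simp add: \<phi>.mem_ker vcomp_def fun_eq_iff)
    let ?K = "{k. k < length b \<and> b ! k = t}" and ?K' = "{k. k < length b \<and> b ! k \<noteq> t}"
    have K: "{..<length b} = ?K \<union> ?K'" "?K \<inter> ?K' = {}" by auto
    define c where "c k = Poly_Mapping.lookup (w k) 0" for k
    have c: "w k = pconst (c k)" if "k \<in> ?K" for k
      unfolding c_def by (rule homog_0_pconst) (use grade_nth[OF wg, of k] that in auto)
    have ge: "g k = at_empty (g k {})" if "k < length b" for k
      using chains_0_at_empty gC[OF that] .
    define x where "x = (\<Sum>k\<in>?K. scl (c k) (g k))"
    have "0 = at_empty (\<phi> w)" using \<open>\<phi> w = 0\<close> by (simp add: at_empty_0)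
    also have "\<phi> w = (\<Sum>k\<in>?K. smult (w k) (g k {})) + (\<Sum>k\<in>?K'. smult (w k) (g k {}))"
      unfolding \<phi>_def K(1) by (rule sum.union_disjoint) auto
    also have "at_empty \<dots> = x + (\<Sum>k\<in>?K'. at_empty (smult (w k) (g k {})))"
    proof -
      have "at_empty (smult (w k) (g k {})) = scl (c k) (g k)" if "k \<in> ?K" for k
        using c[OF that] ge[of k] that by (simp add: at_empty_scl)
      then show ?thesis by (simp add: at_empty_add at_empty_sum x_def)
    qed
    finally have "x = - (\<Sum>k\<in>?K'. at_empty (smult (w k) (g k {})))"
      unfolding eq_neg_iff_add_eq_0 by (rule sym)
    moreover have "at_empty (smult (w k) (g k {})) \<in> ?D t" if "k \<in> ?K'" for k
      using smult_in_boundaries[OF sM grade_nth[OF wg, of k], of "g k {}" "b ! k"] gM that by auto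
    ultimately have xD: "x \<in> fam.span (A t)"
      using fam.subspace_neg[OF sD] fam.subspace_sum[OF sD] AB(3) by (metis (no_types, lifting))
    have gi: "g k \<in> B t - A t" if "k \<in> ?K" for k using gk[of k] that by auto
    then have "x \<in> fam.span (B t - A t)"
      unfolding x_def by (intro fam.span_sum fam.span_scale fam.span_base)
    then have x0: "x = 0" using fam.independent_Diff_span_Int[OF AB(2,1) xD] by blast
    have inj: "inj_on g ?K"
    proof (rule inj_onI)
      fix k k' assume k: "k \<in> ?K" "k' \<in> ?K" "g k = g k'"
      then have "gl ! k = gl ! k'" by (auto simp: g_def b_def prod_eq_iff lenb)
      then show "k = k'" using k gl(2) by (simp add: nth_eq_iff_index_eq lenb)
    qed
    have "(\<Sum>f\<in>g ` ?K. scl (c (the_inv_into ?K g f)) f) = x"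
      unfolding x_def by (subst sum.reindex[OF inj]) (simp add: the_inv_into_f_f[OF inj])
    then have "c (the_inv_into ?K g (g l)) = 0"
      using fam.independentD[OF AB(2)[of t], of "g ` ?K" "\<lambda>f. c (the_inv_into ?K g f)" "g l"] gi x0 l
      by (auto simp: t_def)
    then have "c l = 0" using the_inv_into_f_f[OF inj] l by (simp add: t_def)
    then show ?thesis using l by (simp add: c_def w_def vcomp_def t_def lookup_hcomp)
  qed
  then have "no_const {v \<in> free_mod b. \<phi> v = (\<lambda>_. 0)}"
    by (simp add: no_const_def \<phi>.ker_def)
  then show ?thesis using hom im by blast
qed

text \<open>Cover the ideal, then the kernel of the cover, and so on. The vanishing of the homology in large
  degrees passes to the kernels by dimension shifting, so that every cover is by a module of finite rank.\<close>

theorem exists_min_graded_free_res: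
  fixes I :: "('n::finite, 'k::field_char_0) mpoly set"
  assumes I: "graded_submodule [0] (as_submodule I)" "no_const (as_submodule I)"
    and fin: "\<And>i. \<exists>N. \<forall>j>N. kh [0] (as_submodule I) i j = 0"
  shows "\<exists>G \<psi>. min_graded_free_res I G \<psi>"
proof -
  define P where "P x \<longleftrightarrow> graded_submodule (fst x) (snd x) \<and> no_const (snd x) \<and>
      (\<forall>i. \<exists>N. \<forall>j>N. kh (fst x) (snd x) i j = 0)"
    for x :: "int list \<times> (nat \<Rightarrow> ('n, 'k) mpoly) set"
  define Q where "Q x y \<longleftrightarrow> (\<exists>\<phi>. graded_hom (fst y) (fst x) \<phi> \<and> \<phi> ` free_mod (fst y) = snd x \<and>
      snd y = {v \<in> free_mod (fst y). \<phi> v = (\<lambda>_. 0)})"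
    for x y :: "int list \<times> (nat \<Rightarrow> ('n, 'k) mpoly) set"
  have step: "\<exists>y. P y \<and> Q x y" if x: "P x" for x
  proof -
    obtain a M where [simp]: "x = (a, M)" by (cases x)
    have xM: "graded_submodule a M" "no_const M" "\<And>i. \<exists>N. \<forall>j>N. kh a M i j = 0"
      using x by (simp_all add: P_def)
    obtain N where "\<And>j. j > N \<Longrightarrow> kh a M 0 j = 0" using xM(3) by blast
    then obtain b \<phi> where \<phi>: "graded_hom b a \<phi>" "\<phi> ` free_mod b = M" "no_const {v \<in> free_mod b. \<phi> v = (\<lambda>_. 0)}"
      using exists_minimal_cover[OF xM(1)] by blast
    interpret graded_map b a \<phi> using \<phi>(1) by unfold_locales
    have im: "im = M" using \<phi>(2) by (simp add: im_def)
    have nc: "no_const ker" using \<phi>(3) by (simp add: ker_def)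
    have "vcomp b t v \<in> ker" if v: "v \<in> ker" for t v
    proof -
      have "\<phi> (vcomp b t v) = 0"
        using map_vcomp[of v t] v by (simp add: mem_ker vcomp_def fun_eq_iff)
      moreover have "vcomp b t v \<in> free_mod b" using vcomp_grade grade_subset by blast
      ultimately show ?thesis by (simp add: mem_ker)
    qed
    then have "graded_submodule b ker" using submodule_ker by (simp add: graded_submodule_def)
    moreover have "\<exists>N. \<forall>j>N. kh b ker i j = 0" for i
      using xM(3)[of "Suc i"] kh_shift[OF nc] by (simp add: im)
    ultimately have "P (b, ker)" using nc by (simp add: P_def)
    moreover have "Q x (b, ker)" using \<phi> by (auto simp: Q_def ker_def)
    ultimately show ?thesis by blast
  qed
  have "\<exists>f. \<forall>n. (P (f n) \<and> (n = 0 \<longrightarrow> f n = ([0], as_submodule I))) \<and> Q (f n) (f (Suc n))"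
  proof (rule dependent_nat_choice)
    have "P ([0], as_submodule I)" using I fin by (simp add: P_def)
    then show "\<exists>x. P x \<and> ((0::nat) = 0 \<longrightarrow> x = ([0], as_submodule I))" by blast
    show "\<exists>y. (P y \<and> (Suc n = 0 \<longrightarrow> y = ([0], as_submodule I))) \<and> Q x y"
      if "P x \<and> (n = 0 \<longrightarrow> x = ([0], as_submodule I))" for x n
      using step that by blast
  qed
  then obtain f where f: "f 0 = ([0], as_submodule I)" "\<And>n. P (f n)" "\<And>n. Q (f n) (f (Suc n))"
    by blast
  define G where "G n = fst (f n)" for n
  have "\<exists>\<phi>. graded_hom (G (Suc n)) (G n) \<phi> \<and> \<phi> ` free_mod (G (Suc n)) = snd (f n) \<and>
      snd (f (Suc n)) = {v \<in> free_mod (G (Suc n)). \<phi> v = (\<lambda>_. 0)}" for n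
    using f(3)[of n] by (simp add: G_def Q_def)
  then have "\<exists>\<psi>. \<forall>n. graded_hom (G (Suc n)) (G n) (\<psi> n) \<and> \<psi> n ` free_mod (G (Suc n)) = snd (f n) \<and>
      snd (f (Suc n)) = {v \<in> free_mod (G (Suc n)). \<psi> n v = (\<lambda>_. 0)}"
    by (intro choice allI)
  then obtain \<psi> where \<psi>: "\<forall>n. graded_hom (G (Suc n)) (G n) (\<psi> n) \<and> \<psi> n ` free_mod (G (Suc n)) = snd (f n) \<and>
      snd (f (Suc n)) = {v \<in> free_mod (G (Suc n)). \<psi> n v = (\<lambda>_. 0)}"
    by (rule exE)
  have \<psi>: "graded_hom (G (Suc n)) (G n) (\<psi> n)" "\<psi> n ` free_mod (G (Suc n)) = snd (f n)"
    "snd (f (Suc n)) = {v \<in> free_mod (G (Suc n)). \<psi> n v = (\<lambda>_. 0)}" for n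
    using \<psi>[rule_format, of n] by (simp_all only:)
  have "no_const (snd (f n))" for n using f(2)[of n] by (simp add: P_def)
  then have "Poly_Mapping.lookup (\<psi> n v k) 0 = 0" if "v \<in> free_mod (G (Suc n))" for n v k
    using \<psi>(2)[of n] that unfolding no_const_def by (metis imageI)
  moreover have "\<psi> 0 ` free_mod (G (Suc 0)) = as_submodule I" using \<psi>(2)[of 0] f(1) by simp
  ultimately have "min_graded_free_res I G \<psi>"
    unfolding min_graded_free_res_def using \<psi> f(1) by (simp add: G_def as_submodule_def)
  then show ?thesis by blast
qed

section \<open>The annihilator of a sum of powers\<close>

definition mfact :: "('v::finite \<Rightarrow>\<^sub>0 nat) \<Rightarrow> 'k::field_char_0" where
  "mfact m = (\<Prod>j\<in>UNIV. fact (Poly_Mapping.lookup m j))"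

lemma mfact_nonzero: "mfact m \<noteq> 0"
  by (simp add: mfact_def)

lemma lookup_partial_funpow:
  fixes F :: "('v, 'k::field_char_0) mpoly"
  shows "Poly_Mapping.lookup ((partial j ^^ n) F) k =
    fact (Poly_Mapping.lookup k j + n) / fact (Poly_Mapping.lookup k j) *
    Poly_Mapping.lookup F (k + Poly_Mapping.single j n)"
proof (induction n arbitrary: k)
  case (Suc n)
  have "k + Poly_Mapping.single j 1 + Poly_Mapping.single j n = k + Poly_Mapping.single j (Suc n)"
    by (simp add: add.assoc flip: single_add)
  then have "Poly_Mapping.lookup ((partial j ^^ Suc n) F) k =
     of_nat (Suc (Poly_Mapping.lookup k j)) *
     (fact (Poly_Mapping.lookup k j + 1 + n) / fact (Poly_Mapping.lookup k j + 1) *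
     Poly_Mapping.lookup F (k + Poly_Mapping.single j (Suc n)))"
    by (simp add: lookup_partial Suc lookup_add)
  moreover have "c * (A / (c * f) * L) = A / f * L" if "c \<noteq> 0" for c A f L :: 'k
    using that by simp
  from this[of "of_nat (Suc (Poly_Mapping.lookup k j))"]
  have "of_nat (Suc (Poly_Mapping.lookup k j)) * (A / fact (Poly_Mapping.lookup k j + 1) * L) =
      A / fact (Poly_Mapping.lookup k j) * L" for A L :: 'k
    by (simp only: of_nat_eq_0_iff Suc_not_Zero not_False_eq_True Suc_eq_plus1[symmetric] fact_Suc)
  ultimately show ?case by simp
qed simp

text \<open>By induction over the variables: derivatives in different variables change different exponents.\<close>

lemma lookup_iter_partial:
  fixes F :: "('v::finite, 'k::field_char_0) mpoly"
  shows "Poly_Mapping.lookup (iter_partial m F) k = mfact (k + m) / mfact k * Poly_Mapping.lookup F (k + m)"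
proof -
  interpret comp_fun_commute "\<lambda>j. partial j ^^ Poly_Mapping.lookup m j :: ('v, 'k) mpoly \<Rightarrow> _"
    by (rule comp_fun_commute_partial)
  have "Poly_Mapping.lookup (Finite_Set.fold (\<lambda>j. partial j ^^ Poly_Mapping.lookup m j) F S) k =
      (\<Prod>j\<in>S. fact (Poly_Mapping.lookup k j + Poly_Mapping.lookup m j) / fact (Poly_Mapping.lookup k j)) *
      Poly_Mapping.lookup F (k + (\<Sum>j\<in>S. Poly_Mapping.single j (Poly_Mapping.lookup m j)))"
    if "finite S" for S
    using that
  proof (induction S arbitrary: k rule: finite_induct)
    case (insert x S)
    have "(\<Prod>j\<in>S. fact (Poly_Mapping.lookup (k + Poly_Mapping.single x (Poly_Mapping.lookup m x)) j + Poly_Mapping.lookup m j) /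
          fact (Poly_Mapping.lookup (k + Poly_Mapping.single x (Poly_Mapping.lookup m x)) j) :: 'k) =
        (\<Prod>j\<in>S. fact (Poly_Mapping.lookup k j + Poly_Mapping.lookup m j) / fact (Poly_Mapping.lookup k j))"
      using insert.hyps by (intro prod.cong refl) (auto simp: lookup_add lookup_single when_def)
    then show ?case using insert by (simp add: lookup_partial_funpow add.assoc)
  qed simp
  from this[of UNIV] have "Poly_Mapping.lookup (iter_partial m F) k =
      (\<Prod>j\<in>UNIV. fact (Poly_Mapping.lookup k j + Poly_Mapping.lookup m j) / fact (Poly_Mapping.lookup k j)) *
      Poly_Mapping.lookup F (k + (\<Sum>j\<in>UNIV. Poly_Mapping.single j (Poly_Mapping.lookup m j)))"
    by (simp add: iter_partial_def)
  moreover have "(\<Sum>j\<in>UNIV. Poly_Mapping.single j (Poly_Mapping.lookup m j)) = m"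
    by (rule poly_mapping_eqI) (simp add: lookup_sum lookup_single when_def)
  ultimately show ?thesis by (simp add: mfact_def lookup_add prod_dividef)
qed

text \<open>The multinomial theorem.\<close>

lemma lookup_linear_form_power:
  fixes a :: "'n::finite \<Rightarrow> 'k::field_char_0"
  shows "Poly_Mapping.lookup (linear_form a ^ d) k =
    (if mdeg k = d then fact d / mfact k * mono_eval a k else 0)"
proof (induction d arbitrary: k)
  case 0
  show ?case by (auto simp: lookup_one when_def mdeg_eq_0 mfact_def)
next
  case (Suc d)
  have summand: "Poly_Mapping.lookup (pconst (a j) * (pvar j * linear_form a ^ d)) k =
      (if mdeg k = Suc d then of_nat (Poly_Mapping.lookup k j) * (fact d / mfact k * mono_eval a k) else 0)" for j
  proof (cases "Poly_Mapping.lookup k j = 0")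
    case False
    define k' where "k' = k - Poly_Mapping.single j 1"
    have k: "k = k' + Poly_Mapping.single j 1"
      using minus_single_add[OF False] by (simp add: k'_def)
    have "(mfact k :: 'k) = of_nat (Poly_Mapping.lookup k j) * mfact k'"
    proof -
      have "(mfact k :: 'k) = fact (Poly_Mapping.lookup k j) * (\<Prod>i\<in>UNIV - {j}. fact (Poly_Mapping.lookup k i))"
        unfolding mfact_def by (subst prod.remove[of UNIV j]) auto
      also have "(\<Prod>i\<in>UNIV - {j}. fact (Poly_Mapping.lookup k i)) = (\<Prod>i\<in>UNIV - {j}. fact (Poly_Mapping.lookup k' i) :: 'k)"
        by (intro prod.cong refl) (auto simp: k lookup_add lookup_single when_def)
      also have "fact (Poly_Mapping.lookup k j) = of_nat (Poly_Mapping.lookup k j) * (fact (Poly_Mapping.lookup k' j) :: 'k)"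
        by (simp add: k lookup_add)
      also have "of_nat (Poly_Mapping.lookup k j) * (fact (Poly_Mapping.lookup k' j) :: 'k) *
          (\<Prod>i\<in>UNIV - {j}. fact (Poly_Mapping.lookup k' i)) = of_nat (Poly_Mapping.lookup k j) * mfact k'"
        unfolding mfact_def using prod.remove[of UNIV j "\<lambda>i. fact (Poly_Mapping.lookup k' i) :: 'k"]
        by (simp add: mult.assoc)
      finally show ?thesis .
    qed
    moreover have "mono_eval a k = mono_eval a k' * a j"
      unfolding k by (simp add: mono_eval_add mono_eval_single)
    moreover have "mdeg k = Suc (mdeg k')" unfolding k by (simp add: mdeg_add)
    moreover have "Poly_Mapping.lookup (pconst (a j) * (pvar j * linear_form a ^ d)) k =
        a j * (if mdeg k' = d then fact d / mfact k' * mono_eval a k' else 0)"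
      using False by (simp add: lookup_pconst_mult lookup_pvar_mult Suc k'_def)
    moreover have "(of_nat (Poly_Mapping.lookup k j) :: 'k) \<noteq> 0" using False by simp
    ultimately show ?thesis by simp
  qed (simp add: lookup_pconst_mult lookup_pvar_mult)
  have "Poly_Mapping.lookup (linear_form a ^ Suc d) k =
      (\<Sum>j\<in>UNIV. Poly_Mapping.lookup (pconst (a j) * (pvar j * linear_form a ^ d)) k)"
    by (simp add: linear_form_def[of a] sum_distrib_right lookup_sum mult.assoc)
  also have "\<dots> = (if mdeg k = Suc d then of_nat (mdeg k) * (fact d / mfact k * mono_eval a k) else 0)"
  proof (cases "mdeg k = Suc d")
    case True
    have "of_nat (mdeg k) = (\<Sum>j\<in>UNIV. of_nat (Poly_Mapping.lookup k j) :: 'k)"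
      by (simp add: mdeg_def)
    then show ?thesis unfolding summand if_P[OF True] by (simp only: sum_distrib_right)
  qed (simp add: summand)
  finally show ?case by simp
qed

lemma peval_hcomp:
  "peval (hcomp t p) a = (\<Sum>m\<in>Poly_Mapping.keys p. if int (mdeg m) = t then Poly_Mapping.lookup p m * mono_eval a m else 0)"
proof -
  have "Poly_Mapping.keys (hcomp t p) \<subseteq> Poly_Mapping.keys p"
    by (auto simp: in_keys_iff lookup_hcomp)
  then have "peval (hcomp t p) a = (\<Sum>m\<in>Poly_Mapping.keys p. Poly_Mapping.lookup (hcomp t p) m * mono_eval a m)"
    by (intro peval_superset) auto
  then show ?thesis by (simp add: lookup_hcomp when_def if_distrib[of "\<lambda>x. x * _"] cong: if_cong)
qed

text \<open>Differentiating a power of a linear form evaluates the operator at the dual point.\<close>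

lemma lookup_diff_act_power_sum:
  fixes a :: "'s::finite \<times> 'n::finite \<Rightarrow> 'k::field_char_0"
  shows "Poly_Mapping.lookup (diff_act p (power_sum_form d a)) k = fact d / mfact k *
    (\<Sum>i\<in>UNIV. mono_eval (\<lambda>j. a (i, j)) k * peval (hcomp (int d - int (mdeg k)) p) (\<lambda>j. a (i, j)))"
proof -
  let ?a = "\<lambda>i j. a (i, j)"
  have *: "Poly_Mapping.lookup p m * (mfact (k + m) / mfact k * Poly_Mapping.lookup (power_sum_form d a) (k + m)) =
      fact d / mfact k * (\<Sum>i\<in>UNIV. mono_eval (?a i) k * (if int (mdeg m) = int d - int (mdeg k) then Poly_Mapping.lookup p m * mono_eval (?a i) m else 0))" for m
  proof (cases "mdeg (k + m) = d")
    case True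
    then have "int (mdeg m) = int d - int (mdeg k)" by (simp add: mdeg_add)
    moreover have "Poly_Mapping.lookup (power_sum_form d a) (k + m) = (\<Sum>i\<in>UNIV. fact d / mfact (k + m) * mono_eval (?a i) (k + m))"
      using True by (simp add: power_sum_form_def lookup_sum lookup_linear_form_power)
    moreover have "mfact (k + m) \<noteq> (0 :: 'k)" by (rule mfact_nonzero)
    ultimately show ?thesis
      by (simp add: mono_eval_add sum_distrib_left mult_ac)
  next
    case False
    then have "int (mdeg m) \<noteq> int d - int (mdeg k)" by (simp add: mdeg_add)
    then show ?thesis using False by (simp add: power_sum_form_def lookup_sum lookup_linear_form_power)
  qed
  have "Poly_Mapping.lookup (diff_act p (power_sum_form d a)) k = (\<Sum>m\<in>Poly_Mapping.keys p.
      fact d / mfact k * (\<Sum>i\<in>UNIV. mono_eval (?a i) k * (if int (mdeg m) = int d - int (mdeg k) then Poly_Mapping.lookup p m * mono_eval (?a i) m else 0)))"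
    by (simp only: diff_act_def lookup_sum lookup_pconst_mult lookup_iter_partial *)
  also have "\<dots> = fact d / mfact k * (\<Sum>i\<in>UNIV. \<Sum>m\<in>Poly_Mapping.keys p.
      mono_eval (?a i) k * (if int (mdeg m) = int d - int (mdeg k) then Poly_Mapping.lookup p m * mono_eval (?a i) m else 0))"
    by (subst sum.swap) (simp only: sum_distrib_left)
  finally show ?thesis by (simp only: peval_hcomp sum_distrib_left)
qed

lemma Ann_power_sum_iff:
  fixes a :: "'s::finite \<times> 'n::finite \<Rightarrow> 'k::field_char_0"
  shows "p \<in> Ann (power_sum_form d a) \<longleftrightarrow> (\<forall>k.
    (\<Sum>i\<in>UNIV. mono_eval (\<lambda>j. a (i, j)) k * peval (hcomp (int d - int (mdeg k)) p) (\<lambda>j. a (i, j))) = 0)"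
  by (simp add: Ann_def poly_mapping_eq_iff fun_eq_iff lookup_diff_act_power_sum mfact_nonzero)

lemma hcomp_single_mult: "hcomp t (Poly_Mapping.single m c * p) = Poly_Mapping.single m c * hcomp (t - int (mdeg m)) p"
proof (induction p rule: mpoly_induct)
  case (single m' c')
  have "homog (int (mdeg m') ) (Poly_Mapping.single m' c')" "homog (int (mdeg (m + m'))) (Poly_Mapping.single (m + m') (c * c'))"
    by (simp_all add: homog_single)
  then show ?case by (auto simp: hcomp_homog mult_single mdeg_add)
qed (simp add: distrib_left hcomp_add)

text \<open>Every polynomial is a sum of monomials, so closure under multiplication by these is enough.\<close>

lemma graded_submodule_as_submodule:
  fixes I :: "('n::finite, 'k::comm_ring_1) mpoly set"
  assumes "0 \<in> I" "\<And>p q. p \<in> I \<Longrightarrow> q \<in> I \<Longrightarrow> p + q \<in> I"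
    and mon: "\<And>m c p. p \<in> I \<Longrightarrow> Poly_Mapping.single m c * p \<in> I"
    and comp: "\<And>t p. p \<in> I \<Longrightarrow> hcomp t p \<in> I"
  shows "graded_submodule [0] (as_submodule I)"
proof -
  have "q * p \<in> I" if "p \<in> I" for p q
    by (induction q rule: mpoly_induct) (simp_all add: mon that distrib_right assms(2))
  then show ?thesis
    using assms by (auto simp: graded_submodule_def submodule_def as_submodule_def free_mod_def vcomp_def)
qed

lemma no_const_as_submodule:
  assumes "\<And>c t p. p \<in> I \<Longrightarrow> hcomp t p \<in> I" "\<And>c. pconst c \<in> I \<Longrightarrow> c = 0"
  shows "no_const (as_submodule I)"
proof -
  have "Poly_Mapping.lookup p 0 = 0" if "p \<in> I" for p
  proof -
    have "pconst (Poly_Mapping.lookup (hcomp 0 p) 0) \<in> I"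
      using assms(1)[OF that, of 0] homog_0_pconst[OF homog_hcomp[of 0 p]] by simp
    then show ?thesis using assms(2) by (simp add: lookup_hcomp)
  qed
  then have "Poly_Mapping.lookup (v k) 0 = 0" if "v \<in> as_submodule I" for v k
    using that by (cases k) (auto simp: as_submodule_def free_mod_def)
  then show ?thesis by (simp add: no_const_def)
qed

section \<open>Ranks of the Koszul differentials of a quotient of the polynomial ring\<close>

abbreviation ring_chains :: "nat \<Rightarrow> int \<Rightarrow> ('n::finite, 'k::field) family set" where
  "ring_chains i j \<equiv> chains [0] (free_mod [0]) i j"

lemma chains_as_submodule_iff:
  "f \<in> chains [0] (as_submodule I) i j \<longleftrightarrow> f \<in> ring_chains i j \<and> (\<forall>T. card T = i \<longrightarrow> f T 0 \<in> I)"
  by (auto simp: chains_def as_submodule_def)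

lemma chains_as_submodule_cong:
  assumes "\<And>p. homog (j - int i) p \<Longrightarrow> p \<in> I \<longleftrightarrow> p \<in> I'"
  shows "chains [0] (as_submodule I) i j = chains [0] (as_submodule I') i j"
proof -
  have "f T 0 \<in> I \<longleftrightarrow> f T 0 \<in> I'" if "f \<in> ring_chains i j" for f T
    using assms chains_homog[OF that, of 0 T] by simp
  then show ?thesis by (intro set_eqI) (simp add: chains_as_submodule_iff cong: conj_cong)
qed

definition single_family :: "'n set \<Rightarrow> ('n, 'k::zero) mpoly \<Rightarrow> ('n, 'k) family" where
  "single_family T p = (\<lambda>T' k. if T' = T \<and> k = 0 then p else 0)"

lemma single_family_chains:
  "card T = i \<Longrightarrow> homog (j - int i) p \<Longrightarrow> single_family T p \<in> ring_chains i j"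
  by (auto simp: single_family_def chains_def grade_def free_mod_def fun_eq_iff)

lemma chains_above:
  assumes "i > CARD('n)" "submodule a M"
  shows "chains a M i j = {0 :: ('n::finite, 'k::field) family}"
proof -
  have "card T \<noteq> i" for T :: "'n set" using card_mono[of UNIV T] assms(1) by auto
  then show ?thesis using chains_0[OF assms(2)] by (auto simp: chains_def)
qed

text \<open>Dimension of \<open>\<Lambda>\<^sup>i K\<^sup>n \<otimes> (R/I)\<close> in internal degree \<open>j\<close>, and rank of the differential that
  leaves it, where \<open>M\<close> is \<open>I\<close> as a submodule.\<close>

definition quot_dim :: "(nat \<Rightarrow> ('n::finite, 'k::field) mpoly) set \<Rightarrow> nat \<Rightarrow> int \<Rightarrow> int" where
  "quot_dim M i j = int (fam.dim (ring_chains i j :: ('n, 'k) family set)) - int (fam.dim (chains [0] M i j))"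

definition quot_rank :: "(nat \<Rightarrow> ('n::finite, 'k::field) mpoly) set \<Rightarrow> nat \<Rightarrow> int \<Rightarrow> int" where
  "quot_rank M i j = int (fam.dim (ring_chains i j :: ('n, 'k) family set)) - int (fam.dim (zig [0] M i j))"

text \<open>\<open>zig\<close> in homological degree \<open>i + 1\<close> is the kernel of the differential into the chains modulo \<open>M\<close>.\<close>

lemma dim_zag:
  assumes M: "submodule [0] M"
  shows "int (fam.dim (zag [0] M i j)) = int (fam.dim (chains [0] M i j)) + quot_rank M (Suc i) j"
proof -
  have "{g \<in> ring_chains (Suc i) j. kd g \<in> chains [0] M i j} = zig [0] M (Suc i) j"
    by (simp add: zig_def)
  then show ?thesis
    using fam.dim_sum_image[OF linear_kd fin_dim_chains[OF M] subspace_chains[OF M, of i j]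
        fin_dim_chains[OF submodule_free_mod] subspace_chains[OF submodule_free_mod, of "[0]" "Suc i" j]]
    by (simp add: zag_def quot_rank_def)
qed

lemma zig_0:
  assumes "submodule [0] M" shows "zig [0] M 0 j = ring_chains 0 j"
proof -
  have "kd f \<in> chains [0] M 0 j" if "f \<in> ring_chains 0 j" for f
    using kd_chains_0[OF that] chains_0[OF assms] by simp
  then show ?thesis by (auto simp: zig_def)
qed

text \<open>The homology of a complex from the dimension of its term and the ranks of the two differentials.\<close>

lemma kh_eq_ranks:
  fixes M :: "(nat \<Rightarrow> ('n::finite, 'k::field_char_0) mpoly) set"
  assumes M: "submodule [0] M" "no_const M"
  shows "kh [0] M i j = quot_dim M (Suc i) j - quot_rank M (Suc i) j - quot_rank M (Suc (Suc i)) j"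
  using kh_submodule_eq_zigzag[OF M] dim_zag[OF M(1), of "Suc i" j] by (simp add: quot_dim_def quot_rank_def)

lemma quot_above:
  fixes M :: "(nat \<Rightarrow> ('n::finite, 'k::field) mpoly) set"
  assumes "i > CARD('n)" "submodule [0] M"
  shows "quot_dim M i j = 0" "quot_rank M i j = 0"
proof -
  have "chains [0] M i j = {0}" "(ring_chains i j :: ('n, 'k) family set) = {0}"
    using chains_above[OF assms(1)] assms(2) submodule_free_mod by blast+
  moreover from this have "zig [0] M i j = {0}"
    using fam.subspace_0[OF subspace_zig[OF assms(2)]] by (auto simp: zig_def)
  ultimately show "quot_dim M i j = 0" "quot_rank M i j = 0"
    by (simp_all only: quot_dim_def quot_rank_def diff_self)
qed

lemma dim_ring_chains_0:
  "int (fam.dim (ring_chains 0 j :: ('n::finite, 'k::field_char_0) family set)) -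
    int (fam.dim (boundaries [0] (free_mod [0]) 0 j :: ('n, 'k) family set)) = (if j = 0 then 1 else 0)"
proof -
  let ?id = "\<lambda>v :: nat \<Rightarrow> ('n, 'k) mpoly. v"
  interpret graded_map "[0]" "[0]" ?id by unfold_locales (simp add: graded_hom_def)
  have "no_const ker" by (auto simp: no_const_def mem_ker)
  then have "kh [0] (free_mod [0] :: (nat \<Rightarrow> ('n, 'k) mpoly) set) 0 j = int (count (mset [0]) j)"
    using kh_im_0[of j] by (simp add: im_def)
  moreover have "cycles [0] (free_mod [0]) 0 j = (ring_chains 0 j :: ('n, 'k) family set)"
    using kd_chains_0 by (auto simp: cycles_def)
  ultimately show ?thesis by (simp add: kh_def)
qed

text \<open>The quotient by the irrelevant ideal is \<open>K\<close> in degree 0.\<close>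

lemma quot_dim_0_minus_rank_1:
  fixes M :: "(nat \<Rightarrow> ('n::finite, 'k::field_char_0) mpoly) set"
  assumes M: "submodule [0] M" "no_const M"
  shows "quot_dim M 0 j - quot_rank M 1 j = (if j = 0 then 1 else 0)"
proof -
  have "quot_dim M 0 j - quot_rank M 1 j = int (fam.dim (ring_chains 0 j :: ('n, 'k) family set)) - int (fam.dim (zag [0] M 0 j))"
    using dim_zag[OF M(1), of 0 j] by (simp add: quot_dim_def)
  moreover have "zag [0] M 0 j = boundaries [0] (free_mod [0]) 0 j"
  proof (intro equalityI subsetI)
    fix f assume "f \<in> zag [0] M 0 j"
    then obtain u g where f: "f = u + kd g" "u \<in> chains [0] M 0 j" "g \<in> ring_chains (Suc 0) j"
      unfolding zag_def by blast
    have "u \<in> boundaries [0] (free_mod [0]) 0 j"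
      using no_const_cycle_is_boundary[OF M] f(2) kd_chains_0[OF f(2)] by (simp add: cycles_def)
    moreover have "kd g \<in> boundaries [0] (free_mod [0]) 0 j" using f(3) unfolding boundaries_def by blast
    ultimately show "f \<in> boundaries [0] (free_mod [0]) 0 j"
      unfolding f(1) using fam.subspace_add[OF subspace_boundaries[OF submodule_free_mod]] by blast
  next
    show "f \<in> zag [0] M 0 j" if "f \<in> boundaries [0] (free_mod [0]) 0 j" for f
      using that boundaries_subset_zag[OF M(1)] by blast
  qed
  ultimately show ?thesis using dim_ring_chains_0[of j, where 'n = 'n and 'k = 'k] by simp
qed

section \<open>Points that impose independent conditions on forms of degree \<open>r\<close>\<close>

lemma homog_power:
  assumes "homog t p" shows "homog (int m * t) (p ^ m)"
proof (induction m)
  case 0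
  show ?case using homog_pconst[of 1] by (simp add: pconst_simps)
next
  case (Suc m)
  then show ?case using homog_mult[OF assms Suc] by (simp add: algebra_simps)
qed

locale independent_points =
  fixes pt :: "'s::finite \<Rightarrow> 'n::finite \<Rightarrow> 'k::field_char_0" and r :: nat
  assumes nonzero: "\<exists>j. pt i j \<noteq> 0"
    and separated: "\<exists>p. homog (int r) p \<and> (\<forall>i'. peval p (pt i') = (if i' = i then 1 else 0))"
begin

text \<open>The separating form of a point stays one when it is multiplied by a power of a coordinate that does
  not vanish at the point, up to a scalar.\<close>

lemma interpolation:
  assumes "int r \<le> t" shows "\<exists>p. homog t p \<and> (\<forall>i. peval p (pt i) = c i)"
proof -
  obtain l where l: "\<And>i. pt i (l i) \<noteq> 0" using nonzero by metis
  obtain q where q: "\<And>i. homog (int r) (q i)" "\<And>i i'. peval (q i) (pt i') = (if i' = i then 1 else 0)"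
    using separated by metis
  define e where "e = nat (t - int r)"
  define p where "p = (\<Sum>i\<in>UNIV. pconst (c i / pt i (l i) ^ e) * (pvar (l i) ^ e * q i))"
  have "homog t (pvar (l i) ^ e * q i)" for i
    using homog_mult[OF homog_power[OF homog_pvar] q(1), of e] assms by (simp add: e_def)
  then have "homog t p" unfolding p_def by (intro homog_sum homog_pconst_mult)
  moreover have "peval p (pt i) = c i" for i
  proof -
    have "peval p (pt i) = (\<Sum>i'\<in>UNIV. if i = i' then c i' / pt i' (l i') ^ e * pt i' (l i') ^ e else 0)"
      unfolding p_def peval_sum by (intro sum.cong refl) (simp add: q(2))
    then show ?thesis using l by simp
  qed
  ultimately show ?thesis by blast
qed

text \<open>The condition is put on the homogeneous components: the set of all polynomials that vanish at the chosen
  coordinate vectors of the points would not be a homogeneous ideal.\<close>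

definition vanishing :: "('n, 'k) mpoly set" where
  "vanishing = {p. \<forall>t i. peval (hcomp t p) (pt i) = 0}"

lemma vanishing_homog: "homog t p \<Longrightarrow> p \<in> vanishing \<longleftrightarrow> (\<forall>i. peval p (pt i) = 0)"
  by (auto simp: vanishing_def hcomp_homog)

lemma graded_vanishing: "graded_submodule [0] (as_submodule vanishing)"
  by (rule graded_submodule_as_submodule)
     (auto simp: vanishing_def hcomp_add hcomp_single_mult hcomp_homog[OF homog_hcomp])

lemma submodule_vanishing: "submodule [0] (as_submodule vanishing)"
  using graded_vanishing by (simp add: graded_submodule_def)

lemma no_const_vanishing: "no_const (as_submodule vanishing)"
proof (rule no_const_as_submodule)
  show "c = 0" if "pconst c \<in> vanishing" for c
    using that vanishing_homog[OF homog_pconst] by simp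
qed (auto simp: vanishing_def hcomp_homog[OF homog_hcomp])

text \<open>Evaluation at the points identifies \<open>R/I(Z)\<close> with \<open>K\<^sup>s\<close> in degrees at least \<open>r\<close>.\<close>

lemma quot_dim_vanishing:
  assumes "int r \<le> j - int i"
  shows "quot_dim (as_submodule vanishing) i j = int (CARD('s) * (CARD('n) choose i))"
proof -
  let ?I = "{T :: 'n set. card T = i} \<times> (UNIV :: 's set)"
  let ?V = "ring_chains i j :: ('n, 'k) family set"
  define l where "l x f = peval (f (fst x) 0) (pt (snd x))" for x and f :: "('n, 'k) family"
  obtain q where q: "\<And>k. homog (j - int i) (q k)" "\<And>k k'. peval (q k) (pt k') = (if k' = k then 1 else 0)"
  proof -
    have "\<forall>k. \<exists>p. homog (j - int i) p \<and> (\<forall>k'. peval p (pt k') = (if k' = k then 1 else 0))"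
      by (intro allI) (rule interpolation[OF assms])
    then show thesis using that by metis
  qed
  have "fam.dim ?V = fam.dim {f \<in> ?V. \<forall>x\<in>?I. l x f = 0} + card ?I"
  proof (rule fam.dim_dual_functionals[where v = "\<lambda>x. single_family (fst x) (q (snd x))"])
    show "fam.fin_dim ?V" "fam.subspace ?V"
      by (rule fin_dim_chains[OF submodule_free_mod], rule subspace_chains[OF submodule_free_mod])
    show "fam.functional (l x)" for x by (simp add: fam.functional_def l_def)
    show "single_family (fst x) (q (snd x)) \<in> ?V" if "x \<in> ?I" for x
      by (rule single_family_chains) (use that q(1) in auto)
    show "l x (single_family (fst y) (q (snd y))) = (if x = y then 1 else 0)" for x y
      by (cases x; cases y) (auto simp: l_def single_family_def q)
  qed simp
  moreover have "{f \<in> ?V. \<forall>x\<in>?I. l x f = 0} = chains [0] (as_submodule vanishing) i j"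
  proof -
    have "f T 0 \<in> vanishing \<longleftrightarrow> (\<forall>k. peval (f T 0) (pt k) = 0)" if "f \<in> ?V" for f T
      using vanishing_homog chains_homog[OF that, of 0 T] by simp
    then show ?thesis
      by (intro set_eqI) (auto simp: chains_as_submodule_iff l_def)
  qed
  moreover have "card ?I = CARD('s) * (CARD('n) choose i)"
    using n_subsets[of "UNIV :: 'n set" i] by (simp add: card_cartesian_product)
  ultimately show ?thesis by (simp add: quot_dim_def)
qed

text \<open>Castelnuovo--Mumford regularity. At each point a cycle modulo \<open>I(Z)\<close> becomes a cycle for the
  contraction by a nonzero vector, hence a boundary; boundaries at the finitely many points are
  interpolated by forms.\<close>

lemma regularity:
  assumes "int r < j - int i"
  shows "zig [0] (as_submodule vanishing) i j \<subseteq> zag [0] (as_submodule vanishing) i j"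
proof
  fix f :: "('n, 'k) family" assume f: "f \<in> zig [0] (as_submodule vanishing) i j"
  then have fc: "f \<in> ring_chains i j" and kf: "kd f \<in> chains [0] (as_submodule vanishing) (i - 1) j"
    by (simp_all add: zig_def)
  define ev where "ev g k T = peval (g T 0) (pt k)" for g :: "('n, 'k) family" and k and T :: "'n set"
  have ev_kd: "ev (kd g) k T = contract (\<lambda>l. (*) (pt k l)) (ev g k) T" for g k T
    by (simp add: ev_def kd_apply contract_def)
  have kf0: "ev (kd f) k T = 0" for k T
  proof (cases "card T = i - 1")
    case True
    then have "kd f T 0 \<in> vanishing" using kf by (simp add: chains_as_submodule_iff)
    moreover have "homog (j - int (i - 1)) (kd f T 0)"
      using kf chains_homog[of "kd f" "[0]" "free_mod [0]" "i - 1" j 0 T] by (simp add: chains_as_submodule_iff)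
    ultimately show ?thesis using vanishing_homog by (auto simp: ev_def)
  next
    case False
    then show ?thesis using kf by (simp add: chains_def ev_def)
  qed
  obtain l where l: "\<And>k. pt k (l k) \<noteq> 0" using nonzero by metis
  define D where "D k m = (*) (if m = l k then 1 / pt k (l k) else 0)" for k and m :: 'n
  define G where "G k = wedge (D k) (ev f k)" for k
  have G: "contract (\<lambda>m. (*) (pt k m)) (G k) T = ev f k T" for k T
  proof -
    have D0: "wedge (D k) (\<lambda>_. 0) T = 0" by (simp add: wedge_def D_def)
    have "contract (\<lambda>m. (*) (pt k m)) (G k) T + wedge (D k) (contract (\<lambda>m. (*) (pt k m)) (ev f k)) T =
        (\<Sum>m\<in>-T. pt k m * D k m (ev f k T)) + (\<Sum>m\<in>T. D k m (pt k m * ev f k T))"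
      unfolding G_def by (rule contract_wedge) (simp_all add: D_def additive_mult)
    also have "contract (\<lambda>m. (*) (pt k m)) (ev f k) = (\<lambda>_. 0)" using kf0 ev_kd by (simp add: fun_eq_iff)
    also have "(\<Sum>m\<in>-T. pt k m * D k m (ev f k T)) + (\<Sum>m\<in>T. D k m (pt k m * ev f k T)) =
        (\<Sum>m\<in>UNIV. if m = l k then ev f k T else 0)"
    proof -
      have "pt k m * D k m (ev f k T) = (if m = l k then ev f k T else 0)"
        "D k m (pt k m * ev f k T) = (if m = l k then ev f k T else 0)" for m
        using l[of k] by (auto simp: D_def)
      then show ?thesis
        using sum.union_disjoint[of "-T" T "\<lambda>m. if m = l k then ev f k T else 0"]
        by (simp only: Compl_partition2) simp
    qed
    finally show ?thesis by (simp add: D0)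
  qed
  have "int r \<le> j - int (Suc i)" using assms by simp
  then obtain q where q: "\<And>T. homog (j - int (Suc i)) (q T)" "\<And>T k. peval (q T) (pt k) = G k T"
  proof -
    have "\<forall>T. \<exists>p. homog (j - int (Suc i)) p \<and> (\<forall>k. peval p (pt k) = G k T)"
      by (intro allI) (rule interpolation[OF \<open>int r \<le> j - int (Suc i)\<close>])
    then show thesis using that by metis
  qed
  define g :: "('n, 'k) family" where
    "g = (\<lambda>T. if card T = Suc i then (\<lambda>k. if k = 0 then q T else 0) else 0)"
  have gc: "g \<in> ring_chains (Suc i) j"
    using q(1) by (auto simp: g_def chains_def grade_def free_mod_def)
  have "ev g k T = G k T" for k T
  proof (cases "card T = Suc i")
    case False
    have "ev f k (T - {m}) = 0" if "m \<in> T" for m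
    proof -
      have "card T = Suc (card (T - {m}))" using that card.remove[of T m] by auto
      then show ?thesis using fc False by (auto simp: chains_def ev_def)
    qed
    then have "G k T = 0" by (simp add: G_def wedge_def D_def)
    then show ?thesis using False by (simp add: ev_def g_def)
  qed (simp add: ev_def g_def q)
  then have "ev g k = G k" for k by (simp add: fun_eq_iff)
  then have eq: "ev (kd g) k T = ev f k T" for k T by (simp add: ev_kd G)
  have uc: "f - kd g \<in> ring_chains i j"
    using fam.subspace_diff[OF subspace_chains[OF submodule_free_mod] fc kd_chains[OF submodule_free_mod gc]] .
  have "(f - kd g) T 0 \<in> vanishing" for T
    using vanishing_homog[OF chains_homog[OF uc, of 0 T, simplified]] eq
    using peval_add[of "f T 0" "- kd g T 0"] by (simp add: ev_def)
  then have "f - kd g \<in> chains [0] (as_submodule vanishing) i j"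
    using uc by (simp only: chains_as_submodule_iff) blast
  moreover have "f = (f - kd g) + kd g" by simp
  ultimately show "f \<in> zag [0] (as_submodule vanishing) i j" unfolding zag_def using gc by blast
qed

lemma zag_eq_zig_vanishing:
  assumes "int r < j - int i"
  shows "zag [0] (as_submodule vanishing) i j = zig [0] (as_submodule vanishing) i j"
proof (cases i)
  case 0
  have "f \<in> zig [0] (as_submodule vanishing) 0 j" if f0: "f \<in> zag [0] (as_submodule vanishing) 0 j" for f
  proof -
    obtain u g where f: "f = u + kd g" "u \<in> chains [0] (as_submodule vanishing) 0 j" "g \<in> ring_chains (Suc 0) j"
      using f0 unfolding zag_def by blast
    have "f \<in> ring_chains 0 j"
      unfolding f(1) using chains_free[OF submodule_vanishing] f kd_chains[OF submodule_free_mod f(3)]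
      by (intro chains_add submodule_free_mod) auto
    then show ?thesis using zig_0[OF submodule_vanishing] by simp
  qed
  then show ?thesis using regularity[OF assms] 0 by blast
next
  case (Suc m)
  then show ?thesis using regularity[OF assms] zag_subset_zig[OF submodule_vanishing] by blast
qed

lemma quot_rank_vanishing_Suc:
  assumes "int r < j - int i"
  shows "quot_rank (as_submodule vanishing) (Suc i) j =
    quot_dim (as_submodule vanishing) i j - quot_rank (as_submodule vanishing) i j"
  using dim_zag[OF submodule_vanishing, of i j]
  by (simp add: zag_eq_zig_vanishing[OF assms] quot_dim_def quot_rank_def)

lemma kh_vanishing_0:
  assumes "int r < j - int (Suc i)"
  shows "kh [0] (as_submodule vanishing) i j = 0"
  using quot_rank_vanishing_Suc[OF assms] kh_eq_ranks[OF submodule_vanishing no_const_vanishing, of i j] by simp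

text \<open>By regularity two consecutive ranks add up to a multiple of a binomial coefficient of \<open>n\<close>, so that
  Pascal's rule gives the ranks.\<close>

lemma quot_rank_vanishing:
  assumes "int r \<le> t"
  shows "quot_rank (as_submodule vanishing) (Suc i) (int (Suc i) + t) = int (CARD('s) * ((CARD('n) - 1) choose i))"
  using assms
proof (induction i arbitrary: t)
  case 0
  have "zig [0] (as_submodule vanishing) 0 j = ring_chains 0 j" for j
    by (rule zig_0[OF submodule_vanishing])
  then have "quot_rank (as_submodule vanishing) 0 j = 0" for j by (simp add: quot_rank_def)
  then show ?case
    using 0 quot_rank_vanishing_Suc[where i = 0 and j = "1 + t"] quot_dim_vanishing[where i = 0 and j = "1 + t"] by simp
next
  case (Suc i)
  have "quot_rank (as_submodule vanishing) (Suc (Suc i)) (int (Suc (Suc i)) + t) =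
      int (CARD('s) * (CARD('n) choose Suc i)) - int (CARD('s) * ((CARD('n) - 1) choose i))"
    using quot_rank_vanishing_Suc[where i = "Suc i" and j = "int (Suc (Suc i)) + t"] Suc.IH[of "1 + t"] Suc.prems
      quot_dim_vanishing[where i = "Suc i" and j = "int (Suc (Suc i)) + t"] by (simp add: algebra_simps)
  moreover have "CARD('n) choose Suc i = ((CARD('n) - 1) choose i) + ((CARD('n) - 1) choose Suc i)"
    using choose_reduce_nat[of "CARD('n)" "Suc i"] by (simp add: zero_less_card_finite)
  ultimately show ?case by (simp add: algebra_simps)
qed

end

section \<open>Gorenstein duality\<close>

lemma homog_family: "f \<in> ring_chains i j \<Longrightarrow> homog (j - int i) (f T 0)"
  using chains_homog[of f "[0]" "free_mod [0]" i j 0 T] by simp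

locale power_sum = independent_points pt r
  for pt :: "'s::finite \<Rightarrow> 'n::finite \<Rightarrow> 'k::field_char_0" and r :: nat +
  fixes d :: nat
  assumes r_le: "2 * r \<le> d"
begin

text \<open>The annihilator of the power sum, by \<open>Ann_power_sum_iff\<close>.\<close>

definition apolar :: "('n, 'k) mpoly set" where
  "apolar = {p. \<forall>k. (\<Sum>i\<in>UNIV. mono_eval (pt i) k * peval (hcomp (int d - int (mdeg k)) p) (pt i)) = 0}"

text \<open>The conditions in the definition are the instances for monomials \<open>q\<close>. So \<open>apolar\<close> is the radical of
  a pairing of complementary degrees, which is therefore perfect on the quotient.\<close>

lemma apolar_iff:
  assumes p: "homog t p"
  shows "p \<in> apolar \<longleftrightarrow> (\<forall>q. homog (int d - t) q \<longrightarrow> (\<Sum>i\<in>UNIV. peval q (pt i) * peval p (pt i)) = 0)"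
proof (intro iffI allI impI)
  fix q :: "('n, 'k) mpoly" assume A: "p \<in> apolar" and q: "homog (int d - t) q"
  have "(\<Sum>i\<in>UNIV. peval q (pt i) * peval p (pt i)) =
      (\<Sum>m\<in>Poly_Mapping.keys q. Poly_Mapping.lookup q m * (\<Sum>i\<in>UNIV. mono_eval (pt i) m * peval p (pt i)))"
    unfolding peval_superset[OF finite_keys order_refl, of q] sum_distrib_right sum_distrib_left
    by (subst sum.swap) (simp only: mult.assoc)
  also have "\<dots> = 0"
  proof (rule sum.neutral, intro ballI)
    fix m assume "m \<in> Poly_Mapping.keys q"
    then have "int d - int (mdeg m) = t" using q by (auto simp: homog_def)
    then show "Poly_Mapping.lookup q m * (\<Sum>i\<in>UNIV. mono_eval (pt i) m * peval p (pt i)) = 0"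
      using A hcomp_homog[OF p, of t] unfolding apolar_def by (auto dest: spec[of _ m])
  qed
  finally show "(\<Sum>i\<in>UNIV. peval q (pt i) * peval p (pt i)) = 0" .
next
  assume *: "\<forall>q. homog (int d - t) q \<longrightarrow> (\<Sum>i\<in>UNIV. peval q (pt i) * peval p (pt i)) = 0"
  have "(\<Sum>i\<in>UNIV. mono_eval (pt i) k * peval (hcomp (int d - int (mdeg k)) p) (pt i)) = 0" for k
  proof (cases "int d - int (mdeg k) = t")
    case True
    then have "homog (int d - t) (Poly_Mapping.single k (1::'k))" by (intro homog_single) simp
    then show ?thesis using *[rule_format, of "Poly_Mapping.single k 1"] True by (simp add: hcomp_homog[OF p])
  qed (simp add: hcomp_homog[OF p])
  then show "p \<in> apolar" by (simp add: apolar_def)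
qed

text \<open>The complementary degree is at least \<open>r\<close>, so that it has forms \<open>q\<close> that single out one point.\<close>

lemma apolar_eq_vanishing:
  assumes "homog t p" "t \<le> int d - int r"
  shows "p \<in> apolar \<longleftrightarrow> p \<in> vanishing"
proof
  assume p: "p \<in> apolar"
  have "peval p (pt i) = 0" for i
  proof -
    obtain q where q: "homog (int d - t) q" "\<And>i'. peval q (pt i') = (if i' = i then 1 else 0)"
      using interpolation[of "int d - t" "\<lambda>i'. if i' = i then 1 else 0"] assms(2) by auto
    have "(\<Sum>i'\<in>UNIV. (if i' = i then 1 else 0) * peval p (pt i')) = 0"
      using p q apolar_iff[OF assms(1)] by auto
    then show ?thesis by (simp add: if_distrib[of "\<lambda>x. x * _"] cong: if_cong)
  qed
  then show "p \<in> vanishing" using vanishing_homog[OF assms(1)] by simp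
next
  assume "p \<in> vanishing"
  then show "p \<in> apolar" using vanishing_homog[OF assms(1)] apolar_iff[OF assms(1)] by simp
qed

text \<open>In negative complementary degree there is no condition, as all forms are zero.\<close>

lemma apolar_above: "homog t p \<Longrightarrow> int d < t \<Longrightarrow> p \<in> apolar"
  using homog_neg by (fastforce simp: apolar_iff)

lemma graded_apolar: "graded_submodule [0] (as_submodule apolar)"
proof (rule graded_submodule_as_submodule)
  fix m c p assume p: "p \<in> apolar"
  have "(\<Sum>i\<in>UNIV. mono_eval (pt i) k * peval (hcomp (int d - int (mdeg k)) (Poly_Mapping.single m c * p)) (pt i)) =
      c * (\<Sum>i\<in>UNIV. mono_eval (pt i) (k + m) * peval (hcomp (int d - int (mdeg (k + m))) p) (pt i))" for k
    unfolding hcomp_single_mult mono_eval_add mdeg_add by (simp add: sum_distrib_left diff_diff_eq mult_ac)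
  then show "Poly_Mapping.single m c * p \<in> apolar" using p by (simp add: apolar_def)
next
  fix t p assume p: "p \<in> apolar"
  have "hcomp u (hcomp t p) = (if u = t then hcomp u p else 0)" for u
    using hcomp_homog[OF homog_hcomp[of t p], of u] by simp
  then show "hcomp t p \<in> apolar" using p by (auto simp: apolar_def)
qed (auto simp: apolar_def hcomp_add distrib_left sum.distrib)

lemma submodule_apolar: "submodule [0] (as_submodule apolar)"
  using graded_apolar by (simp add: graded_submodule_def)

lemma no_const_apolar: "no_const (as_submodule apolar)"
proof (rule no_const_as_submodule)
  show "hcomp t p \<in> apolar" if "p \<in> apolar" for t p
  proof -
    have "hcomp u (hcomp t p) = (if u = t then hcomp u p else 0)" for u
      using hcomp_homog[OF homog_hcomp[of t p], of u] by simp
    then show ?thesis using that by (auto simp: apolar_def)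
  qed
  show "c = 0" if "pconst c \<in> apolar" for c
    using that apolar_eq_vanishing[OF homog_pconst, of c] vanishing_homog[OF homog_pconst, of c] r_le by simp
qed

subsection \<open>The pairing of the Koszul complex with itself\<close>

definition eps :: "'n set \<Rightarrow> 'k" where
  "eps T = (\<Prod>l\<in>T. (-1) ^ card {i :: 'n. to_nat i < to_nat l})"

definition dual_form :: "('n, 'k) family \<Rightarrow> ('n, 'k) family \<Rightarrow> 'k" where
  "dual_form f g = (\<Sum>T\<in>UNIV. eps T * (\<Sum>k\<in>UNIV. peval (f T 0) (pt k) * peval (g (-T) 0) (pt k)))"

lemma eps_nonzero: "eps T \<noteq> 0"
  by (simp add: eps_def)

lemma eps_sg:
  assumes "l \<notin> T" shows "eps T * sg l T = eps (insert l T) * sg l (- insert l T)"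
proof -
  let ?A = "{i \<in> T. to_nat i < to_nat l}" and ?B = "{i \<in> - insert l T. to_nat i < to_nat l}"
  have un: "{i :: 'n. to_nat i < to_nat l} = ?A \<union> ?B" and dis: "?A \<inter> ?B = {}" by auto
  have "card {i :: 'n. to_nat i < to_nat l} = card ?A + card ?B"
    by (subst un, rule card_Un_disjoint[OF _ _ dis]) simp_all
  then have "(-1 :: 'k) ^ card ?A = (-1) ^ card {i :: 'n. to_nat i < to_nat l} * (-1) ^ card ?B"
    by (simp add: power_add mult.assoc flip: power_mult_distrib)
  moreover have "eps (insert l T) = (-1) ^ card {i :: 'n. to_nat i < to_nat l} * eps T"
    using assms by (simp add: eps_def)
  ultimately show ?thesis by (simp add: sg_def mult_ac)
qed

text \<open>The sign \<open>eps\<close> is chosen so that the differential is its own adjoint.\<close>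

lemma dual_form_adjoint: "dual_form (kd f) g = dual_form f (kd g)"
proof -
  let ?F = "\<lambda>T k. peval (f T 0) (pt k)" and ?G = "\<lambda>T k. peval (g T 0) (pt k)"
  have "dual_form (kd f) g = (\<Sum>T\<in>UNIV. \<Sum>l\<in>-T. \<Sum>k\<in>UNIV. eps T * sg l T * (pt k l * ?F (insert l T) k * ?G (-T) k))"
    unfolding dual_form_def kd_apply peval_sum
    by (simp add: sum_distrib_left sum_distrib_right mult_ac) (subst sum.swap, rule refl)
  also have "\<dots> = (\<Sum>(T, l)\<in>(SIGMA T:UNIV. -T). \<Sum>k\<in>UNIV. eps T * sg l T * (pt k l * ?F (insert l T) k * ?G (-T) k))"
    by (rule sum.Sigma) auto
  also have "\<dots> = (\<Sum>(S, l)\<in>(SIGMA S:UNIV. S). \<Sum>k\<in>UNIV. eps S * sg l (-S) * (pt k l * ?F S k * ?G (insert l (-S)) k))"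
  proof (rule sum.reindex_bij_witness[where i = "\<lambda>(S, l). (S - {l}, l)" and j = "\<lambda>(T, l). (insert l T, l)"])
    fix x :: "'n set \<times> 'n" assume "x \<in> (SIGMA T:UNIV. -T)"
    then obtain T l where x: "x = (T, l)" "l \<notin> T" by auto
    then have "insert l (- insert l T) = - T" by auto
    then show "(case case x of (T, l) \<Rightarrow> (insert l T, l) of (S, l) \<Rightarrow>
          \<Sum>k\<in>UNIV. eps S * sg l (-S) * (pt k l * ?F S k * ?G (insert l (-S)) k)) =
        (case x of (T, l) \<Rightarrow> \<Sum>k\<in>UNIV. eps T * sg l T * (pt k l * ?F (insert l T) k * ?G (-T) k))"
      unfolding x(1) prod.case eps_sg[OF x(2)] by simp
  qed auto
  also have "\<dots> = (\<Sum>S\<in>UNIV. \<Sum>l\<in>S. \<Sum>k\<in>UNIV. eps S * sg l (-S) * (pt k l * ?F S k * ?G (insert l (-S)) k))"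
    by (rule sum.Sigma[symmetric]) auto
  also have "\<dots> = dual_form f (kd g)"
    unfolding dual_form_def kd_apply peval_sum
    by (simp add: sum_distrib_left sum_distrib_right mult_ac) (subst sum.swap, rule refl)
  finally show ?thesis .
qed

text \<open>Complementation of the index sets changes all signs \<open>eps\<close> by the same factor.\<close>

lemma dual_form_commute: "dual_form f g = eps UNIV * dual_form g f"
proof -
  have e: "eps (- T) = eps UNIV * eps T" for T
  proof -
    have "eps UNIV = eps T * eps (- T)"
      unfolding eps_def using prod.union_disjoint[of T "- T" "\<lambda>l. (-1) ^ card {i :: 'n. to_nat i < to_nat l} :: 'k"]
      by (simp add: Compl_partition)
    moreover have "eps T * eps T = 1"
      by (simp add: eps_def flip: prod.distrib power_add mult_2)
    ultimately show ?thesis by (simp add: mult.assoc mult.left_commute mult.commute)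
  qed
  have "dual_form f g = (\<Sum>T\<in>UNIV. eps (- T) * (\<Sum>k\<in>UNIV. peval (f (- T) 0) (pt k) * peval (g T 0) (pt k)))"
    unfolding dual_form_def
    by (rule sum.reindex_bij_witness[where i = uminus and j = uminus]) auto
  then show ?thesis unfolding e dual_form_def by (simp add: sum_distrib_left mult_ac)
qed

lemma functional_dual_form:
  "fam.functional (\<lambda>f. dual_form f g)" "fam.functional (dual_form f)"
  "fam.functional (\<lambda>f. dual_form (kd f) g)"
proof -
  show 1: "fam.functional (\<lambda>f. dual_form f g)" for g
    by (simp add: fam.functional_def dual_form_def distrib_right distrib_left sum.distrib sum_distrib_left mult_ac)
  show "fam.functional (dual_form f)"
    by (simp add: fam.functional_def dual_form_def distrib_right distrib_left sum.distrib sum_distrib_left mult_ac)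
  show "fam.functional (\<lambda>f. dual_form (kd f) g)"
    using 1[of "kd g"] by (simp add: dual_form_adjoint)
qed

text \<open>Chains with one nonzero entry, opposite to the entry \<open>f S\<close>, reduce this to the pairing of polynomials.\<close>

lemma dual_form_left_radical:
  assumes i: "i \<le> CARD('n)" and f: "f \<in> ring_chains i j"
  shows "(\<forall>g\<in>ring_chains (CARD('n) - i) (int d + int CARD('n) - j). dual_form f g = 0) \<longleftrightarrow>
    f \<in> chains [0] (as_submodule apolar) i j"
proof
  assume *: "\<forall>g\<in>ring_chains (CARD('n) - i) (int d + int CARD('n) - j). dual_form f g = 0"
  have "f S 0 \<in> apolar" if S: "card S = i" for S
    unfolding apolar_iff[OF homog_family[OF f]]
  proof (intro allI impI)
    fix q :: "('n, 'k) mpoly" assume q: "homog (int d - (j - int i)) q"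
    have "card (- S) = CARD('n) - i" using S card_Diff_subset[of S UNIV] by (simp add: Compl_eq_Diff_UNIV)
    then have "single_family (- S) q \<in> ring_chains (CARD('n) - i) (int d + int CARD('n) - j)"
      using q i by (intro single_family_chains) (simp_all add: of_nat_diff algebra_simps)
    then have "0 = dual_form f (single_family (- S) q)" using * by simp
    also have "\<dots> = (\<Sum>T\<in>UNIV. if T = S then eps S * (\<Sum>k\<in>UNIV. peval (f S 0) (pt k) * peval q (pt k)) else 0)"
      unfolding dual_form_def by (intro sum.cong refl) (auto simp: single_family_def)
    also have "\<dots> = eps S * (\<Sum>k\<in>UNIV. peval q (pt k) * peval (f S 0) (pt k))" by (simp add: mult.commute)
    finally show "(\<Sum>k\<in>UNIV. peval q (pt k) * peval (f S 0) (pt k)) = 0" using eps_nonzero by simp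
  qed
  then show "f \<in> chains [0] (as_submodule apolar) i j" using f by (simp add: chains_as_submodule_iff)
next
  assume A: "f \<in> chains [0] (as_submodule apolar) i j"
  show "\<forall>g\<in>ring_chains (CARD('n) - i) (int d + int CARD('n) - j). dual_form f g = 0"
  proof
    fix g :: "('n, 'k) family" assume g: "g \<in> ring_chains (CARD('n) - i) (int d + int CARD('n) - j)"
    have "(\<Sum>k\<in>UNIV. peval (f T 0) (pt k) * peval (g (- T) 0) (pt k)) = 0" for T
    proof (cases "card T = i")
      case True
      have "homog (int d - (j - int i)) (g (- T) 0)"
        using homog_family[OF g, of "- T"] i by (simp add: of_nat_diff algebra_simps)
      moreover have "f T 0 \<in> apolar" using A True by (simp add: chains_as_submodule_iff)
      ultimately have "(\<Sum>k\<in>UNIV. peval (g (- T) 0) (pt k) * peval (f T 0) (pt k)) = 0"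
        using apolar_iff[OF homog_family[OF f]] by blast
      then show ?thesis by (simp add: mult.commute)
    qed (use f in \<open>simp add: chains_def\<close>)
    then show "dual_form f g = 0" by (simp add: dual_form_def)
  qed
qed

lemma dual_form_right_radical:
  assumes i: "i \<le> CARD('n)" and g: "g \<in> ring_chains (CARD('n) - i) (int d + int CARD('n) - j)"
  shows "(\<forall>f\<in>ring_chains i j. dual_form f g = 0) \<longleftrightarrow>
    g \<in> chains [0] (as_submodule apolar) (CARD('n) - i) (int d + int CARD('n) - j)"
  using dual_form_left_radical[OF diff_le_self g] i eps_nonzero
  by (simp add: dual_form_commute[of _ g])

lemma quot_dim_apolar_dual:
  assumes i: "i \<le> CARD('n)"
  shows "quot_dim (as_submodule apolar) i j = quot_dim (as_submodule apolar) (CARD('n) - i) (int d + int CARD('n) - j)"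
proof -
  let ?V = "ring_chains i j :: ('n, 'k) family set"
  let ?W = "ring_chains (CARD('n) - i) (int d + int CARD('n) - j) :: ('n, 'k) family set"
  note fd = fin_dim_chains[OF submodule_free_mod] and sub = subspace_chains[OF submodule_free_mod]
  have "{f \<in> ?V. \<forall>g\<in>?W. dual_form f g = 0} = chains [0] (as_submodule apolar) i j"
    using dual_form_left_radical[OF i] chains_free[OF submodule_apolar] by blast
  moreover have "{g \<in> ?W. \<forall>f\<in>?V. dual_form f g = 0} =
      chains [0] (as_submodule apolar) (CARD('n) - i) (int d + int CARD('n) - j)"
    using dual_form_right_radical[OF i] chains_free[OF submodule_apolar] by blast
  ultimately show ?thesis
    using fam.codim_radicals_eq[OF fd sub fd sub functional_dual_form(1,2), of "[0]" i j "[0]" "CARD('n) - i" "int d + int CARD('n) - j"]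
    by (simp add: quot_dim_def)
qed

text \<open>The two differentials are transposes of each other, and a matrix and its transpose have equal rank.\<close>

lemma quot_rank_apolar_dual:
  assumes i: "i < CARD('n)"
  shows "quot_rank (as_submodule apolar) (Suc i) j =
    quot_rank (as_submodule apolar) (CARD('n) - i) (int d + int CARD('n) - j)"
proof -
  let ?j = "int d + int CARD('n) - j"
  let ?V = "ring_chains (Suc i) j :: ('n, 'k) family set"
  let ?W = "ring_chains (CARD('n) - i) ?j :: ('n, 'k) family set"
  note fd = fin_dim_chains[OF submodule_free_mod] and sub = subspace_chains[OF submodule_free_mod]
  have "{f \<in> ?V. \<forall>g\<in>?W. dual_form (kd f) g = 0} = zig [0] (as_submodule apolar) (Suc i) j"
  proof -
    have "(\<forall>g\<in>?W. dual_form (kd f) g = 0) \<longleftrightarrow> kd f \<in> chains [0] (as_submodule apolar) i j" if "f \<in> ?V" for f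
      using dual_form_left_radical[OF less_imp_le[OF i] kd_chains[OF submodule_free_mod that]] .
    then show ?thesis by (auto simp: zig_def)
  qed
  moreover have "{g \<in> ?W. \<forall>f\<in>?V. dual_form (kd f) g = 0} = zig [0] (as_submodule apolar) (CARD('n) - i) ?j"
  proof -
    have "kd g \<in> ring_chains (CARD('n) - Suc i) ?j" if "g \<in> ?W" for g
      using kd_chains[OF submodule_free_mod, of g "[0]" "CARD('n) - Suc i" ?j] that i by (simp add: Suc_diff_Suc)
    then show ?thesis
      using dual_form_right_radical[of "Suc i"] i by (auto simp: zig_def dual_form_adjoint)
  qed
  ultimately show ?thesis
    using fam.codim_radicals_eq[OF fd sub fd sub functional_dual_form(3,2), of "[0]" "Suc i" j "[0]" "CARD('n) - i" ?j]
    by (simp add: quot_rank_def)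
qed

subsection \<open>Betti numbers of \<open>A\<close>\<close>

lemma kh_apolar_dual:
  assumes "Suc i < CARD('n)"
  shows "kh [0] (as_submodule apolar) i j =
    kh [0] (as_submodule apolar) (CARD('n) - Suc (Suc i)) (int d + int CARD('n) - j)"
  using kh_eq_ranks[OF submodule_apolar no_const_apolar, of i j]
    kh_eq_ranks[OF submodule_apolar no_const_apolar, of "CARD('n) - Suc (Suc i)" "int d + int CARD('n) - j"]
    quot_dim_apolar_dual[of "Suc i" j] quot_rank_apolar_dual[of i j] quot_rank_apolar_dual[of "Suc i" j] assms
  by (simp add: Suc_diff_Suc)

lemma chains_apolar_eq_vanishing:
  assumes "j - int i \<le> int d - int r"
  shows "chains [0] (as_submodule apolar) i j = chains [0] (as_submodule vanishing) i j"
  by (rule chains_as_submodule_cong) (rule apolar_eq_vanishing[OF _ assms])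

lemma kh_apolar_low:
  assumes "j - int i \<le> int d - int r"
  shows "kh [0] (as_submodule apolar) i j = kh [0] (as_submodule vanishing) i j"
  using chains_apolar_eq_vanishing[of j i] chains_apolar_eq_vanishing[of j "Suc i"] assms
  by (simp add: kh_def cycles_def boundaries_def)

theorem kh_apolar:
  assumes i: "Suc i < CARD('n)"
  shows "kh [0] (as_submodule apolar) i j = kh [0] (as_submodule vanishing) i j +
    kh [0] (as_submodule vanishing) (CARD('n) - Suc (Suc i)) (int d + int CARD('n) - j)"
proof -
  let ?n = "CARD('n)"
  let ?A = "as_submodule apolar" and ?J = "as_submodule vanishing"
  define t where "t = j - int (Suc i)"
  define i' j' where "i' = ?n - Suc (Suc i)" and "j' = int d + int ?n - j"
  have t': "j' - int (Suc i') = int d - t" using i by (simp add: t_def i'_def j'_def of_nat_diff)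
  have n: "?n = i + i' + 2" using i by (simp add: i'_def)
  consider "t < int d - int r" | "int r < t" | "t = int r" "d = 2 * r" using r_le by linarith
  then have "kh [0] ?A i j = kh [0] ?J i j + kh [0] ?J i' j'"
  proof cases
    case 1
    then show ?thesis
      using kh_apolar_low[of j i] kh_vanishing_0[where i = i' and j = j'] t' by (simp add: t_def)
  next
    case 2
    have "kh [0] ?A i j = kh [0] ?A i' j'" using kh_apolar_dual[OF i] by (simp add: i'_def j'_def)
    also have "\<dots> = kh [0] ?J i' j'" using 2 t' by (intro kh_apolar_low) simp
    finally show ?thesis using 2 kh_vanishing_0[where i = i and j = j] by (simp add: t_def)
  next
    \<comment> \<open>Only here can both summands be nonzero. The differential that leaves \<open>A\<^sub>r\<close> is dual to one that
      enters \<open>A\<^sub>r\<close>, where \<open>A\<close> still agrees with \<open>R/I(Z)\<close>.\<close>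
    case 3
    have low: "quot_dim ?A (Suc m) l = quot_dim ?J (Suc m) l"
      "quot_rank ?A (Suc (Suc m)) l = quot_rank ?J (Suc (Suc m)) l" if "l - int (Suc m) = int r" for m l
      using chains_apolar_eq_vanishing[of l "Suc m"] that 3(2) by (simp_all add: quot_dim_def quot_rank_def zig_def)
    have j: "j - int (Suc i) = int r" "j' - int (Suc i') = int r" using 3 t' by (simp_all add: t_def)
    have "quot_rank ?A (Suc i) j = quot_rank ?A (Suc (Suc i')) j'"
      using quot_rank_apolar_dual[of i j] i n by (simp add: j'_def)
    then have 1: "kh [0] ?A i j = quot_dim ?J (Suc i) j - quot_rank ?J (Suc (Suc i')) j' - quot_rank ?J (Suc (Suc i)) j"
      using kh_eq_ranks[OF submodule_apolar no_const_apolar, of i j] low[OF j(1)] low[OF j(2)] by simp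
    have dim: "quot_dim ?J (Suc m) l = int (CARD('s) * (?n choose Suc m))" if "l - int (Suc m) = int r" for m l
      using that by (intro quot_dim_vanishing) simp
    have rank: "quot_rank ?J (Suc m) l = int (CARD('s) * ((?n - 1) choose m))" if "l - int (Suc m) = int r" for m l
      using that quot_rank_vanishing[of "int r" m] by (simp add: algebra_simps)
    have "?n choose Suc i' = ((?n - 1) choose i) + ((?n - 1) choose i')"
    proof -
      have "(?n - 1) choose Suc i' = (?n - 1) choose i"
        using binomial_symmetric[of "Suc i'" "?n - 1"] n by simp
      then show ?thesis using choose_reduce_nat[of ?n "Suc i'"] n by simp
    qed
    then show ?thesis
      using 1 kh_eq_ranks[OF submodule_vanishing no_const_vanishing, of i j]
        kh_eq_ranks[OF submodule_vanishing no_const_vanishing, of i' j']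
        dim[OF j(2)] rank[OF j(1)] rank[OF j(2)] by (simp add: algebra_simps)
  qed
  then show ?thesis by (simp add: i'_def j'_def)
qed

text \<open>The socle: by duality it is the homology of \<open>A\<close> in homological degree 0.\<close>

theorem kh_apolar_top:
  assumes "CARD('n) = Suc i"
  shows "kh [0] (as_submodule apolar) i j = (if j = int d + int CARD('n) then 1 else 0)"
  using kh_eq_ranks[OF submodule_apolar no_const_apolar, of i j] assms
    quot_dim_apolar_dual[of "Suc i" j] quot_rank_apolar_dual[of i j]
    quot_above(2)[OF _ submodule_apolar, of "Suc (Suc i)" j]
    quot_dim_0_minus_rank_1[OF submodule_apolar no_const_apolar, of "int d + int CARD('n) - j"]
  by auto

theorem kh_apolar_above:
  assumes "CARD('n) \<le> i"
  shows "kh [0] (as_submodule apolar) i j = 0"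
  using kh_eq_ranks[OF submodule_apolar no_const_apolar, of i j] assms
    quot_above[OF _ submodule_apolar, of "Suc i" j] quot_above[OF _ submodule_apolar, of "Suc (Suc i)" j] by simp

lemma kh_apolar_large:
  assumes "j > int d + int (Suc i)"
  shows "kh [0] (as_submodule apolar) i j = 0"
proof -
  have "chains [0] (as_submodule apolar) m j = ring_chains m j" if "m \<le> Suc i" for m
    using apolar_above[OF homog_family, of _ m j] that assms by (auto simp: chains_as_submodule_iff)
  then have "cycles [0] (as_submodule apolar) i j = cycles [0] (free_mod [0]) i j"
    and "boundaries [0] (as_submodule apolar) i j = boundaries [0] (free_mod [0]) i j"
    by (simp_all add: cycles_def boundaries_def)
  moreover have "cycles [0] (free_mod [0]) i j = (boundaries [0] (free_mod [0]) i j :: ('n, 'k) family set)"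
  proof (intro equalityI subsetI)
    fix f :: "('n, 'k) family" assume "f \<in> cycles [0] (free_mod [0]) i j"
    then show "f \<in> boundaries [0] (free_mod [0]) i j"
      by (rule free_cycle_is_boundary) (use assms in auto)
  next
    show "f \<in> cycles [0] (free_mod [0]) i j" if "f \<in> boundaries [0] (free_mod [0]) i j" for f :: "('n, 'k) family"
      using that kd_chains[OF submodule_free_mod] by (auto simp: cycles_def boundaries_def)
  qed
  ultimately show ?thesis by (simp add: kh_def)
qed

lemma exists_resolution_apolar: "\<exists>G \<psi>. min_graded_free_res apolar G \<psi>"
  using kh_apolar_large by (intro exists_min_graded_free_res[OF graded_apolar no_const_apolar]) blast

end

section \<open>General points impose independent conditions\<close>

text \<open>Exponent vectors are lists of length \<open>n\<close> once the variables are enumerated, and such lists are counted by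
  stars and bars.\<close>

lemma card_monomials_ge: "((CARD('n) - 1 + r) choose (CARD('n) - 1)) \<le> card {m :: 'n::finite \<Rightarrow>\<^sub>0 nat. mdeg m = r}"
proof -
  obtain es where es: "set es = (UNIV :: 'n set)" "distinct es"
    using finite_distinct_list[of "UNIV :: 'n set"] by auto
  then have len: "length es = CARD('n)" using distinct_card by fastforce
  define L where "L = {l :: nat list. length l = CARD('n) \<and> sum_list l = r}"
  define g where "g l = (\<Sum>i<CARD('n). Poly_Mapping.single (es ! i) (l ! i))" for l :: "nat list"
  have lookup: "Poly_Mapping.lookup (g l) (es ! i) = l ! i" if "i < CARD('n)" for l i
  proof -
    have "Poly_Mapping.lookup (g l) (es ! i) = (\<Sum>i'<CARD('n). if i' = i then l ! i else 0)"
      unfolding g_def lookup_sum using es(2) that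
      by (intro sum.cong refl) (auto simp: lookup_single when_def nth_eq_iff_index_eq len)
    then show ?thesis using that by simp
  qed
  have "mdeg (g l) = r" if "l \<in> L" for l
  proof -
    have "mdeg (g l) = (\<Sum>i<CARD('n). Poly_Mapping.lookup (g l) (es ! i))"
      unfolding mdeg_def using sum.reindex_bij_betw[of "(!) es" "{..<CARD('n)}" UNIV "Poly_Mapping.lookup (g l)"]
        bij_betw_nth[OF es(2), of "{..<CARD('n)}" UNIV] es(1) len by simp
    also have "\<dots> = (\<Sum>i<length l. l ! i)" using that lookup by (simp add: L_def)
    also have "\<dots> = r" using that by (auto simp: L_def sum_list_sum_nth atLeast0LessThan)
    finally show ?thesis .
  qed
  moreover have "inj_on g L"
  proof (rule inj_onI)
    fix l l' assume "l \<in> L" "l' \<in> L" "g l = g l'"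
    then show "l = l'" using lookup by (intro nth_equalityI) (auto simp: L_def, metis)
  qed
  ultimately have "card L \<le> card {m :: 'n \<Rightarrow>\<^sub>0 nat. mdeg m = r}"
    by (intro card_inj_on_le[of g]) (auto simp: finite_mdeg)
  moreover have "card L = (r + CARD('n) - 1) choose r"
    unfolding L_def by (rule card_length_sum_list)
  moreover have "(r + CARD('n) - 1) choose r = (CARD('n) - 1 + r) choose (CARD('n) - 1)"
  proof -
    obtain m where "CARD('n) = Suc m" using zero_less_card_finite[where 'a = 'n] gr0_conv_Suc by blast
    then show ?thesis using binomial_symmetric[of r "m + r"] by (simp add: add.commute)
  qed
  ultimately show ?thesis by simp
qed

text \<open>A point whose coordinates are distinct primes separates all monomials, by unique
  factorization.\<close>

lemma exists_separating_point:
  "\<exists>b :: 'n::finite \<Rightarrow> int. (\<forall>j. 0 < b j) \<and> inj (mono_eval b)"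
proof -
  obtain f :: "nat \<Rightarrow> nat" where f: "inj f" "range f \<subseteq> {p. prime p}"
    using infinite_countable_subset[OF primes_infinite] by blast
  define b where "b j = int (f (to_nat j))" for j :: 'n
  have b: "inj b" "\<And>j. prime (b j)"
    using f inj_eq[OF f(1)] by (auto simp: b_def inj_on_def)
  have "multiplicity (b j) (mono_eval b m) = Poly_Mapping.lookup m j" for m j
  proof -
    have "mono_eval b m = (\<Prod>p\<in>range b. p ^ Poly_Mapping.lookup m (inv b p))"
      unfolding mono_eval_def by (subst prod.reindex[OF b(1)]) (simp add: inv_f_f[OF b(1)])
    then have "multiplicity (b j) (mono_eval b m) =
        (if b j \<in> range b then Poly_Mapping.lookup m (inv b (b j)) else 0)"
      using b(2) by (simp only:, intro multiplicity_prod_prime_powers) auto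
    then show ?thesis by (simp add: inv_f_f[OF b(1)])
  qed
  then have "inj (mono_eval b)"
    by (intro injI poly_mapping_eqI) metis
  then show ?thesis using b(2) prime_gt_0_int by blast
qed

text \<open>The open set is given by the determinant of the values of \<open>s\<close> monomials of degree \<open>r\<close> at the \<open>s\<close> points.
  The powers \<open>0, \<dots>, s - 1\<close> of a separating point, coordinate by coordinate, make this a Vandermonde
  determinant.\<close>

lemma exists_zariski_open_independent_points:
  assumes "CARD('s::finite) \<le> (CARD('n) - 1 + r) choose (CARD('n) - 1)"
  shows "\<exists>U :: ('s \<times> 'n::finite \<Rightarrow> 'k::field_char_0) set.
    zariski_open U \<and> U \<noteq> {} \<and> (\<forall>a\<in>U. independent_points (\<lambda>i j. a (i, j)) r)"
proof -
  have "CARD('s) \<le> card {m :: 'n \<Rightarrow>\<^sub>0 nat. mdeg m = r}"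
    using assms card_monomials_ge order_trans by blast
  then obtain mo :: "'s \<Rightarrow> 'n \<Rightarrow>\<^sub>0 nat" where mo': "range mo \<subseteq> {m. mdeg m = r}" "inj mo"
    using card_le_inj[OF finite finite_mdeg, of "UNIV :: 's set" r] by blast
  then have mo: "inj mo" "\<And>i. mdeg (mo i) = r" by auto
  define V :: "('s \<times> 'n \<Rightarrow> 'k) \<Rightarrow> 'k^'s^'s" where
    "V a = (\<chi> k i. mono_eval (\<lambda>j. a (k, j)) (mo i))" for a
  define D :: "('s \<times> 'n, 'k) mpoly" where "D = (\<Sum>p | p permutes UNIV.
      of_int (sign p) * (\<Prod>k\<in>UNIV. \<Prod>j\<in>UNIV. pvar (k, j) ^ Poly_Mapping.lookup (mo (p k)) j))"
  have D: "peval D a = det (V a)" for a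
    by (simp add: D_def det_def V_def mono_eval_def)
  fix j0 :: 'n
  \<comment> \<open>For \<open>r = 0\<close> the determinant does not see the points, so one coordinate is required to be nonzero.\<close>
  define Q where "Q = D * (\<Prod>k\<in>UNIV. pvar (k, j0))"
  define U where "U = - {a. \<forall>p\<in>{Q}. peval p a = 0}"
  have memU: "a \<in> U \<longleftrightarrow> det (V a) \<noteq> 0 \<and> (\<forall>k. a (k, j0) \<noteq> 0)" for a
    by (simp add: U_def Q_def D)
  have "independent_points (\<lambda>i j. a (i, j)) r" if a: "a \<in> U" for a
  proof
    show "\<exists>j. a (i, j) \<noteq> 0" for i using a memU by blast
    fix i
    obtain B where B: "V a ** B = mat 1"
      using a memU invertible_det_nz[of "V a"] by (auto simp: invertible_def)
    define p where "p = (\<Sum>i'\<in>UNIV. Poly_Mapping.single (mo i') (B $ i' $ i))"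
    have "homog (int r) p" unfolding p_def by (intro homog_sum homog_single) (simp add: mo)
    moreover have "peval p (\<lambda>j. a (k, j)) = (if k = i then 1 else 0)" for k
    proof -
      have "peval p (\<lambda>j. a (k, j)) = (V a ** B) $ k $ i"
        by (simp add: p_def matrix_matrix_mult_def V_def mult.commute)
      then show ?thesis by (simp add: B mat_def)
    qed
    ultimately show "\<exists>p. homog (int r) p \<and> (\<forall>i'. peval p (\<lambda>j. a (i', j)) = (if i' = i then 1 else 0))"
      by blast
  qed
  moreover have "U \<noteq> {}"
  proof -
    obtain b :: "'n \<Rightarrow> int" where b: "\<And>j. 0 < b j" "inj (mono_eval b)"
      using exists_separating_point by blast
    obtain \<kappa> where \<kappa>: "bij_betw \<kappa> (UNIV :: 's set) {0..<CARD('s)}"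
      using ex_bij_betw_finite_nat[of "UNIV :: 's set"] by auto
    define a :: "'s \<times> 'n \<Rightarrow> 'k" where "a = (\<lambda>(k, j). of_int (b j) ^ \<kappa> k)"
    define y :: "'s \<Rightarrow> 'k" where "y i = of_int (mono_eval b (mo i))" for i
    have y: "inj y"
      using b(2) mo(1) by (auto simp: inj_on_def y_def)
    have "mono_eval (\<lambda>j. a (k, j)) (mo i) = y i ^ \<kappa> k" for k i
      by (simp add: a_def y_def mono_eval_def prod_power_distrib flip: power_mult)
         (simp add: mult.commute)
    then have V: "V a $ k $ i = y i ^ \<kappa> k" for k i by (simp add: V_def)
    \<comment> \<open>A row relation is a polynomial of degree below \<open>s\<close> with the \<open>s\<close> distinct roots \<open>y i\<close>.\<close>
    have "c = 0" if c: "transpose (V a) *v c = 0" for c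
    proof -
      define P where "P = (\<Sum>k\<in>UNIV. Polynomial.monom (c $ k) (\<kappa> k))"
      have "poly P (y i) = (transpose (V a) *v c) $ i" for i
        by (simp add: P_def poly_sum poly_monom matrix_vector_mult_def transpose_def V mult.commute)
      then have roots: "range y \<subseteq> {x. poly P x = 0}" using c by auto
      have \<kappa>_less: "\<kappa> k < CARD('s)" for k using \<kappa> by (auto simp: bij_betw_def)
      have "P = 0"
      proof (rule ccontr)
        assume P: "P \<noteq> 0"
        have "CARD('s) = card (range y)" using card_image[OF y] by simp
        also have "\<dots> \<le> card {x. poly P x = 0}" by (rule card_mono[OF poly_roots_finite[OF P] roots])
        also have "\<dots> \<le> degree P" by (rule card_poly_roots_bound[OF P])
        also have "\<dots> < CARD('s)"
        proof -
          have "degree P \<le> CARD('s) - 1"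
            unfolding P_def
          proof (rule degree_sum_le)
            show "degree (Polynomial.monom (c $ k) (\<kappa> k)) \<le> CARD('s) - 1" for k
              using degree_monom_le[of "c $ k" "\<kappa> k"] \<kappa>_less[of k] by linarith
          qed simp
          then show ?thesis using zero_less_card_finite[where 'a = 's] by linarith
        qed
        finally show False by simp
      qed
      have "c $ k = coeff P (\<kappa> k)" for k
      proof -
        have "coeff P (\<kappa> k) = (\<Sum>k'\<in>UNIV. if k' = k then c $ k else 0)"
          unfolding P_def coeff_sum using \<kappa>
          by (intro sum.cong refl) (auto simp: bij_betw_def inj_on_def)
        then show ?thesis by simp
      qed
      then show ?thesis using \<open>P = 0\<close> by (simp add: vec_eq_iff)
    qed
    then have "\<exists>B. B ** transpose (V a) = mat 1"
      using matrix_left_invertible_ker[of "transpose (V a)"] by blast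
    then have "det (V a) \<noteq> 0"
      using invertible_det_nz[of "transpose (V a)"] invertible_left_inverse[of "transpose (V a)"] by (simp add: det_transpose)
    moreover have "a (k, j0) \<noteq> 0" for k using b(1)[of j0] by (simp add: a_def less_imp_neq[symmetric])
    ultimately show ?thesis using memU by blast
  qed
  moreover have "zariski_open U" unfolding zariski_open_def U_def by blast
  ultimately show ?thesis by blast
qed

section \<open>The resolution of \<open>A\<close>\<close>

text \<open>The other coordinate vectors of a point add no condition, as \<open>p\<close> is homogeneous.\<close>

lemma vanishing_ideal_iff:
  fixes a :: "'s::finite \<times> 'n::finite \<Rightarrow> 'k::field_char_0"
  assumes p: "homog t p"
  shows "p \<in> vanishing_ideal (dual_points a) \<longleftrightarrow> (\<forall>i. peval p (\<lambda>j. a (i, j)) = 0)"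
proof
  let ?S = "{p. \<forall>i. peval p (\<lambda>j. a (i, j)) = 0}"
  assume "p \<in> vanishing_ideal (dual_points a)"
  moreover have "vanishing_ideal (dual_points a) \<subseteq> ?S"
    unfolding vanishing_ideal_def
  proof (rule module.span_minimal[OF module_mult_self])
    show "module.subspace (*) ?S"
      by (simp add: module.subspace_def[OF module_mult_self])
    have "(\<lambda>j. a (i, j)) \<in> proj_point (\<lambda>j. a (i, j))" for i
      unfolding proj_point_def by (auto intro!: exI[of _ 1])
    then show "{f. (\<exists>t. homog t f) \<and> (\<forall>P\<in>dual_points a. \<forall>v\<in>P. peval f v = 0)} \<subseteq> ?S"
      unfolding dual_points_def by blast
  qed
  ultimately show "\<forall>i. peval p (\<lambda>j. a (i, j)) = 0" by blast
next
  assume *: "\<forall>i. peval p (\<lambda>j. a (i, j)) = 0"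
  have "peval p (\<lambda>j. c * a (i, j)) = 0" for c i
  proof (cases "0 \<le> t")
    case True
    then show ?thesis using homog_peval_scale[of "nat t" p c "\<lambda>j. a (i, j)"] p * by simp
  next
    case False
    then show ?thesis using homog_neg[OF p] by simp
  qed
  then have "p \<in> {f. (\<exists>t. homog t f) \<and> (\<forall>P\<in>dual_points a. \<forall>v\<in>P. peval f v = 0)}"
    using p by (auto simp: dual_points_def proj_point_def)
  then show "p \<in> vanishing_ideal (dual_points a)"
    unfolding vanishing_ideal_def by (rule module.span_base[OF module_mult_self])
qed

lemma count_twist_dual: "count (mset (twist (dual xs) c)) j = count (mset xs) (- c - j)"
  by (induction xs) (auto simp: twist_def dual_def)

theorem resolution_of_apolar_algebra:
  fixes a :: "'s::finite \<times> 'n::finite \<Rightarrow> 'k::field_char_0"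
  assumes pts: "independent_points (\<lambda>i j. a (i, j)) r" and r: "2 * r \<le> d"
    and F: "min_graded_free_res (vanishing_ideal (dual_points a)) F \<phi>"
    and G: "min_graded_free_res (Ann (power_sum_form d a)) G \<psi>"
  shows "G 0 = [0]"
    and "Suc i < CARD('n) \<Longrightarrow> mset (G (Suc i)) =
      mset (F (Suc i) @ twist (dual (F (CARD('n) - Suc i))) (- int d - int CARD('n)))"
    and "G (CARD('n)) = [int d + int CARD('n)]"
    and "CARD('n) < i \<Longrightarrow> G i = []"
proof -
  interpret independent_points "\<lambda>i j. a (i, j)" r by (rule pts)
  interpret power_sum "\<lambda>i j. a (i, j)" r d by unfold_locales (rule r)
  have "Ann (power_sum_form d a) = apolar"
    by (simp add: set_eq_iff apolar_def Ann_power_sum_iff)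
  then have G': "int (count (mset (G (Suc i))) j) = kh [0] (as_submodule apolar) i j" for i j
    using betti_eq_kh[OF G] by simp
  have "chains [0] (as_submodule (vanishing_ideal (dual_points a))) i j = chains [0] (as_submodule vanishing) i j" for i j
    by (rule chains_as_submodule_cong) (simp add: vanishing_homog vanishing_ideal_iff)
  then have F': "int (count (mset (F (Suc i))) j) = kh [0] (as_submodule vanishing) i j" for i j
    using betti_eq_kh[OF F] by (simp add: kh_def cycles_def boundaries_def)
  show "G 0 = [0]" using G by (simp add: min_graded_free_res_def)
  show "mset (G (Suc i)) = mset (F (Suc i) @ twist (dual (F (CARD('n) - Suc i))) (- int d - int CARD('n)))"
    if i: "Suc i < CARD('n)"
  proof (rule multiset_eqI)
    fix j
    have "CARD('n) - Suc i = Suc (CARD('n) - Suc (Suc i))" using i by simp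
    then have "int (count (mset (G (Suc i))) j) = int (count (mset (F (Suc i))) j +
        count (mset (F (CARD('n) - Suc i))) (int d + int CARD('n) - j))"
      using kh_apolar[OF i, of j] G'[of i j] F'[of i j] F'[of "CARD('n) - Suc (Suc i)" "int d + int CARD('n) - j"]
      by simp
    then show "count (mset (G (Suc i))) j =
        count (mset (F (Suc i) @ twist (dual (F (CARD('n) - Suc i))) (- int d - int CARD('n)))) j"
      using count_twist_dual[of "F (CARD('n) - Suc i)" "- int d - int CARD('n)" j] by (simp add: add.commute)
  qed
  show "G (CARD('n)) = [int d + int CARD('n)]"
  proof -
    obtain m where m: "CARD('n) = Suc m" using zero_less_card_finite[where 'a = 'n] gr0_conv_Suc by blast
    have "mset (G (CARD('n))) = {#int d + int CARD('n)#}"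
    proof (rule multiset_eqI)
      fix j
      have "int (count (mset (G (CARD('n)))) j) = (if j = int d + int CARD('n) then 1 else 0)"
        using G'[of m j] kh_apolar_top[OF m, of j] m by simp
      then show "count (mset (G (CARD('n)))) j = count {#int d + int CARD('n)#} j" by (auto split: if_splits)
    qed
    then show ?thesis by simp
  qed
  show "G i = []" if "CARD('n) < i"
  proof -
    obtain m where m: "i = Suc m" "CARD('n) \<le> m" using \<open>CARD('n) < i\<close> by (cases i) auto
    have "mset (G i) = {#}"
    proof (rule multiset_eqI)
      fix j
      show "count (mset (G i)) j = count {#} j" using G'[of m j] kh_apolar_above[OF m(2), of j] m by simp
    qed
    then show ?thesis by simp
  qed
qed

theorem theorem4p8:
  fixes d s n r :: nat
  assumes "CARD('n::finite) = n" and "CARD('s::finite) = s"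
    and "d \<ge> 1" and "s \<ge> 1" and "n \<ge> 2"
    and "(n - 2 + r) choose (n - 1) < s" and "s \<le> (n - 1 + r) choose (n - 1)"
    and "r \<le> d div 2"
  shows "\<exists>U :: ('s \<times> 'n \<Rightarrow> 'k::{alg_closed_field, field_char_0}) set.
    zariski_open U \<and> U \<noteq> {} \<and>
    (\<forall>a\<in>U.
      (\<forall>i. \<exists>j. a (i, j) \<noteq> 0) \<and>
      (\<forall>F \<phi>. min_graded_free_res (vanishing_ideal (dual_points a)) F \<phi> \<and> (\<forall>i\<ge>n. F i = []) \<longrightarrow>
        (\<exists>G \<psi>. min_graded_free_res (Ann (power_sum_form d a)) G \<psi>) \<and>
        (\<forall>G \<psi>. min_graded_free_res (Ann (power_sum_form d a)) G \<psi> \<longrightarrow>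
          G 0 = [0] \<and>
          (\<forall>i\<in>{1..n - 1}.
             mset (G i) = mset (F i @ twist (dual (F (n - i))) (- int d - int n))) \<and>
          G n = [int d + int n] \<and>
          (\<forall>i>n. G i = []))))"
proof -
  have r: "2 * r \<le> d" using assms(8) by simp
  obtain U :: "('s \<times> 'n \<Rightarrow> 'k) set" where U: "zariski_open U" "U \<noteq> {}"
    "\<And>a. a \<in> U \<Longrightarrow> independent_points (\<lambda>i j. a (i, j)) r"
    using exists_zariski_open_independent_points[where 's = 's and 'n = 'n and 'k = 'k and r = r] assms(1,2,7) by auto
  show ?thesis
  proof (intro exI[of _ U] conjI ballI allI impI)
    show "zariski_open U" "U \<noteq> {}" by fact+
    fix a assume "a \<in> U"
    then have pts: "independent_points (\<lambda>i j. a (i, j)) r" by (rule U(3))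
    interpret independent_points "\<lambda>i j. a (i, j)" r by (rule pts)
    interpret power_sum "\<lambda>i j. a (i, j)" r d by unfold_locales (rule r)
    show "\<exists>j. a (i, j) \<noteq> 0" for i by (rule nonzero)
    have "Ann (power_sum_form d a) = apolar"
      by (simp add: set_eq_iff apolar_def Ann_power_sum_iff)
    then show "\<exists>G \<psi>. min_graded_free_res (Ann (power_sum_form d a)) G \<psi>"
      using exists_resolution_apolar by simp
    fix F \<phi> G \<psi>
    assume "min_graded_free_res (vanishing_ideal (dual_points a)) F \<phi> \<and> (\<forall>i\<ge>n. F i = [])"
      and G: "min_graded_free_res (Ann (power_sum_form d a)) G \<psi>"
    then have F: "min_graded_free_res (vanishing_ideal (dual_points a)) F \<phi>" by blast
    note res = resolution_of_apolar_algebra[OF pts r F G]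
    show "G 0 = [0]" by (rule res)
    show "mset (G i) = mset (F i @ twist (dual (F (n - i))) (- int d - int n))" if "i \<in> {1..n - 1}" for i
    proof -
      have "i < n" "Suc (i - 1) = i" using that assms(5) by auto
      then show ?thesis using res(2)[of "i - 1"] unfolding assms(1) by simp
    qed
    show "G n = [int d + int n]" using res(3) assms(1) by simp
    show "G i = []" if "n < i" for i using res(4) that assms(1) by simp
  qed
qed

end
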